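(* Fix an integer $r\ge 2$. For every $\varepsilon>0$ there is $N_0$ such that for every prime $p\equiv 1\pmod{2r}$ and every $n$ with $N=p^n\ge N_0$, there is a rotational Cayley $r$-coloring of the complete graph on $\mathbb{F}_p^n$ in which every monochromatic clique has order at most $(2+\varepsilon)\log_r N$.
   Context: A Cayley $r$-coloring of the complete graph on $\mathbb{F}_p^n$ is given by a map $c:\mathbb{F}_p^n\setminus\{0\}\to\mathbb{Z}_r$ with $c(x)=c(-x)$ for all $x$, the edge $\{x,y\}$ receiving color $c(x-y)$. It is rotational if there is a scalar $\alpha\in\mathbb{F}_p^{\times}$ of multiplicative order $2r$ such that $c(\alpha^ix)\equiv c(x)+i\pmod r$ for all $x\in\mathbb{F}_p^n\setminus\{0\}$ and all $i\in\mathbb{Z}$. A monochromatic clique is a vertex set all of whose edges receive the same color. *)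

theory Defs
  imports Complex_Main "HOL-Algebra.Module" "HOL-Number_Theory.Residues"
begin

text \<open>
  The free module \<open>R\<^sup>n\<close>: families indexed by \<open>{..<n}\<close> (extended by \<open>undefined\<close> elsewhere) with
  coordinatewise operations. The prime and the dimension have to be quantified inside a formula,
  so both live in carrier sets rather than in types.
\<close>

definition coord_module :: "('a, 'b) ring_scheme \<Rightarrow> nat \<Rightarrow> ('a, nat \<Rightarrow> 'a) module" where
  "coord_module R n =
    \<lparr> carrier = {..<n} \<rightarrow>\<^sub>E carrier R,
      monoid.mult = (\<lambda>x y. \<lambda>i\<in>{..<n}. x i \<otimes>\<^bsub>R\<^esub> y i),
      one = (\<lambda>i\<in>{..<n}. \<one>\<^bsub>R\<^esub>),
      zero = (\<lambda>i\<in>{..<n}. \<zero>\<^bsub>R\<^esub>),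
      add = (\<lambda>x y. \<lambda>i\<in>{..<n}. x i \<oplus>\<^bsub>R\<^esub> y i),
      smult = (\<lambda>a x. \<lambda>i\<in>{..<n}. a \<otimes>\<^bsub>R\<^esub> x i) \<rparr>"

lemma module_coord_module:
  assumes "cring R"
  shows "module R (coord_module R n)"
proof -
  interpret cring R by (rule assms)
  have grp: "abelian_group (coord_module R n)"
  proof (rule abelian_groupI)
    fix x assume x: "x \<in> carrier (coord_module R n)"
    then have "(\<lambda>i\<in>{..<n}. \<ominus>\<^bsub>R\<^esub> x i) \<in> carrier (coord_module R n)"
      by (auto simp: coord_module_def PiE_iff)
    moreover from x
    have "(\<lambda>i\<in>{..<n}. \<ominus>\<^bsub>R\<^esub> x i) \<oplus>\<^bsub>coord_module R n\<^esub> x = \<zero>\<^bsub>coord_module R n\<^esub>"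
      by (auto simp: coord_module_def PiE_iff fun_eq_iff l_neg)
    ultimately
    show "\<exists>y\<in>carrier (coord_module R n). y \<oplus>\<^bsub>coord_module R n\<^esub> x = \<zero>\<^bsub>coord_module R n\<^esub>"
      by blast
  qed (auto simp: coord_module_def PiE_iff fun_eq_iff a_ac extensional_def)
  show ?thesis
    by (rule moduleI[OF assms grp])
      (auto simp: coord_module_def PiE_iff fun_eq_iff l_distr r_distr m_assoc extensional_def)
qed

definition Fp :: "nat \<Rightarrow> int ring" where
  "Fp p = residue_ring (int p)"

definition Fpn :: "nat \<Rightarrow> nat \<Rightarrow> (int, nat \<Rightarrow> int) module" where
  "Fpn p n = coord_module (Fp p) n"

definition nonzero_vecs :: "nat \<Rightarrow> nat \<Rightarrow> (nat \<Rightarrow> int) set" where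
  "nonzero_vecs p n = carrier (Fpn p n) - {\<zero>\<^bsub>Fpn p n\<^esub>}"

text \<open>
  Colours are elements of \<open>\<int>\<^sub>r\<close>, represented by \<open>0, \<dots>, r - 1\<close>. A Cayley colouring is given by
  its generating map \<open>c\<close> on nonzero vectors; values of \<open>c\<close> elsewhere are irrelevant.
\<close>

definition cayley_coloring :: "nat \<Rightarrow> nat \<Rightarrow> nat \<Rightarrow> ((nat \<Rightarrow> int) \<Rightarrow> int) \<Rightarrow> bool" where
  "cayley_coloring r p n c \<longleftrightarrow>
     c \<in> nonzero_vecs p n \<rightarrow> carrier (residue_ring (int r)) \<and>
     (\<forall>x \<in> nonzero_vecs p n. c x = c (\<ominus>\<^bsub>Fpn p n\<^esub> x))"

definition edge_color :: "nat \<Rightarrow> nat \<Rightarrow> ((nat \<Rightarrow> int) \<Rightarrow> int) \<Rightarrow> (nat \<Rightarrow> int) \<Rightarrow> (nat \<Rightarrow> int) \<Rightarrow> int" where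
  "edge_color p n c x y = c (x \<ominus>\<^bsub>Fpn p n\<^esub> y)"

text \<open>Integer powers of the scalar are taken in the multiplicative group of the field.\<close>

definition rotational :: "nat \<Rightarrow> nat \<Rightarrow> nat \<Rightarrow> ((nat \<Rightarrow> int) \<Rightarrow> int) \<Rightarrow> bool" where
  "rotational r p n c \<longleftrightarrow>
     (\<exists>\<alpha> \<in> carrier (mult_of (Fp p)).
        group.ord (mult_of (Fp p)) \<alpha> = 2 * r \<and>
        (\<forall>x \<in> nonzero_vecs p n. \<forall>i::int.
           [c ((\<alpha> [^]\<^bsub>mult_of (Fp p)\<^esub> i) \<odot>\<^bsub>Fpn p n\<^esub> x) = c x + i] (mod int r)))"

definition monochromatic_clique ::
    "nat \<Rightarrow> nat \<Rightarrow> ((nat \<Rightarrow> int) \<Rightarrow> int) \<Rightarrow> (nat \<Rightarrow> int) set \<Rightarrow> bool" where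
  "monochromatic_clique p n c S \<longleftrightarrow>
     S \<subseteq> carrier (Fpn p n) \<and>
     (\<exists>k. \<forall>x \<in> S. \<forall>y \<in> S. x \<noteq> y \<longrightarrow> edge_color p n c x y = k)"

end

theory Submission
  imports Defs "HOL-Library.Function_Algebras" "HOL-Real_Asymp.Real_Asymp"
begin

text \<open>The exponents are dictated by the error terms of the union bound. With
  \<open>(1 - \<eta>)\<^sup>2 = 2 / (2 + \<epsilon>)\<close>, a share 1 - \<eta> of the independent
  colours pays exactly for the choice of the generators that enter singly. The remaining \<eta> b
  must beat two losses: choosing A inside the span of its generators costs a factor exp (O(k log
  k)), and the generators that enter in bulk cost r to a power of order q k, where q is the number
  of elements added per round. The bulk argument ends after s rounds only if a constant multiple of
  q, raised to the power s, exceeds k; hence q has order k powr (1/s), and b must grow faster than k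
  powr (1 + 1/s). A set with additive structure, such as an arithmetic progression, has only O(k)
  differences, which would not be enough. This is why doubling chains are excluded: a chain of four
  gives b of order k powr (7/6), and s = 7 makes 8/7 smaller than 7/6.

  The threshold on N may depend on r and \<epsilon> only, so linear spans, whose size involves p,
  cannot be counted; all coefficients come from sets of size O(r).\<close>

text \<open>
  Fix \<open>\<alpha>\<close> of order \<open>2 r\<close>, so \<open>\<alpha> ^ r = - 1\<close>. A rotational colouring is a free choice of one colour per orbit of
  \<open>\<alpha>\<close>; we tie the colours of some pairs \<open>x, 2 x\<close> together such that among \<open>x, 2 x, 4 x, 8 x\<close> two consecutive ones
  always differ, and choose the rest at random. If \<open>A\<close> is a monochromatic clique with \<open>k\<close> elements, then
  \<open>A - A\<close> contains no such chain, and Petridis' inequality gives \<open>card (A - A) \<ge> k powr (7/6)\<close>.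

  The probability that \<open>A\<close> is monochromatic is about \<open>r powr (- b)\<close> with \<open>b\<close> the number of independent colours of
  \<open>A - A\<close>. The union bound works because few sets have a small \<open>b\<close>: up to lower order terms, \<open>A\<close> lies in the
  span of \<open>2 b / k\<close> of its elements, with short combinations whose coefficients come from a set of
  bounded size. These elements are chosen one after the other. An element \<open>x\<close> outside the current span
  \<open>V\<close> gives the differences \<open>x - a\<close> with \<open>a \<in> A \<inter> V\<close>, which are new because they leave \<open>V\<close>, and in
  general also the differences \<open>x - a\<close> with \<open>a \<in> A - V\<close>. Summing over all steps, either the first or the
  second kind contributes at least half of \<open>k\<close> per step on average. With \<open>card X \<le> r powr (k / (2 + \<epsilon>))\<close> the expected
  number of monochromatic cliques is then less than one.
\<close>

section \<open>Counting lemmas\<close>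

lemma pigeonhole_fibre:
  assumes "finite S" "finite T" "f ` S \<subseteq> T" "T \<noteq> {}"
  shows "\<exists>t\<in>T. card S \<le> card T * card {s \<in> S. f s = t}"
proof (rule ccontr)
  assume "\<not> ?thesis"
  then have lt: "card T * card {s \<in> S. f s = t} < card S" if "t \<in> T" for t
    using that by force
  have "S = (\<Union>t\<in>T. {s \<in> S. f s = t})"
    using assms(3) by auto
  then have "card S = (\<Sum>t\<in>T. card {s \<in> S. f s = t})"
    using assms(1,2) by (subst card_UN_disjoint[symmetric]) auto
  then have "card T * card S = (\<Sum>t\<in>T. card T * card {s \<in> S. f s = t})"
    by (simp add: sum_distrib_left)
  also have "\<dots> < (\<Sum>t\<in>T. card S)"
    using assms(2,4) lt by (intro sum_strict_mono) auto
  finally show False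
    by simp
qed

text \<open>\<open>local\<close> says that \<open>P t b\<close> looks only at the values of
  \<open>b\<close> below \<open>t\<close>, so updating \<open>b\<close> at \<open>t\<close> does not
  disturb the choices already made.\<close>

lemma dependent_choice_upto:
  fixes q :: nat
  assumes "\<And>b t. t < q \<Longrightarrow> (\<And>i. i < t \<Longrightarrow> P i b (b i)) \<Longrightarrow> \<exists>y. P t b y"
    and local: "\<And>t b b' y. (\<And>i. i < t \<Longrightarrow> b i = b' i) \<Longrightarrow> P t b y = P t b' y"
  shows "\<exists>b. \<forall>t<q. P t b (b t)"
proof -
  have "t \<le> q \<Longrightarrow> \<exists>b. \<forall>i<t. P i b (b i)" for t
  proof (induction t)
    case (Suc t)
    then obtain b where b: "\<forall>i<t. P i b (b i)" by auto
    obtain y where y: "P t b y"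
      using assms(1)[of t b] Suc.prems b by auto
    have "\<forall>i<Suc t. P i (b(t := y)) ((b(t := y)) i)"
    proof (intro allI impI)
      fix i assume "i < Suc t"
      then consider "i < t" | "i = t" by linarith
      then show "P i (b(t := y)) ((b(t := y)) i)"
      proof cases
        case 1
        then show ?thesis
          using b local[of i b "b(t := y)"] by auto
      next
        case 2
        then show ?thesis
          using y local[of t b "b(t := y)"] by auto
      qed
    qed
    then show ?case by blast
  qed auto
  then show ?thesis by blast
qed

lemma card_subsets_le_power:
  assumes "finite S"
  shows "card {A. A \<subseteq> S \<and> card A = k} \<le> card S ^ k"
proof (cases "k \<le> card S")
  case True
  then show ?thesis
    using binomial_le_pow[OF True] n_subsets[OF assms] by simp
next
  case False
  then show ?thesis
    using n_subsets[OF assms, of k] by (simp add: binomial_eq_0)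
qed

lemma sum_UNION_le:
  fixes f :: "'b \<Rightarrow> real"
  assumes "finite I" "\<And>i. i \<in> I \<Longrightarrow> finite (B i)" "\<And>x. 0 \<le> f x"
  shows "sum f (\<Union>i\<in>I. B i) \<le> (\<Sum>i\<in>I. sum f (B i))"
  using assms(1,2)
proof (induction I rule: finite_induct)
  case (insert i I)
  have "sum f (B i \<union> (\<Union>i\<in>I. B i)) + sum f (B i \<inter> (\<Union>i\<in>I. B i)) = sum f (B i) + sum f (\<Union>i\<in>I. B i)"
    using insert by (intro sum.union_inter) auto
  moreover have "0 \<le> sum f (B i \<inter> (\<Union>i\<in>I. B i))"
    by (intro sum_nonneg assms(3))
  ultimately show ?case
    using insert by simp
qed simp

lemma card_PiE_prescribed:
  fixes v :: "'i \<Rightarrow> 'c"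
  assumes "finite I" "J \<subseteq> I" "finite S"
  shows "card {\<omega> \<in> I \<rightarrow>\<^sub>E S. \<forall>i\<in>J. \<omega> i = v i} \<le> card S ^ (card I - card J)"
proof -
  define F where "F = {\<omega> \<in> I \<rightarrow>\<^sub>E S. \<forall>i\<in>J. \<omega> i = v i}"
  have inj: "inj_on (\<lambda>\<omega>. restrict \<omega> (I - J)) F"
  proof (rule inj_onI)
    fix \<omega> \<omega>' assume w: "\<omega> \<in> F" "\<omega>' \<in> F" "restrict \<omega> (I - J) = restrict \<omega>' (I - J)"
    show "\<omega> = \<omega>'"
    proof (rule extensionalityI[of _ I])
      show "\<omega> \<in> extensional I" "\<omega>' \<in> extensional I"
        using w by (auto simp: F_def PiE_iff)
      show "\<omega> i = \<omega>' i" if "i \<in> I" for i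
      proof (cases "i \<in> J")
        case False
        then show ?thesis
          using fun_cong[OF w(3), of i] that by simp
      qed (use w in \<open>simp add: F_def\<close>)
    qed
  qed
  have "(\<lambda>\<omega>. restrict \<omega> (I - J)) ` F \<subseteq> (I - J) \<rightarrow>\<^sub>E S"
    by (auto simp: F_def restrict_PiE_iff dest: PiE_mem)
  then have "card F \<le> card ((I - J) \<rightarrow>\<^sub>E S)"
    using inj assms by (intro card_inj_on_le) (auto intro: finite_PiE)
  also have "\<dots> = card S ^ card (I - J)"
    using assms by (simp add: card_PiE)
  also have "card (I - J) = card I - card J"
    using assms by (intro card_Diff_subset) (auto intro: finite_subset)
  finally show ?thesis
    by (simp add: F_def)
qed

lemmas cong_mod_def = unique_euclidean_semiring_class.cong_def

section \<open>Spans with bounded coefficients\<close>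

text \<open>
  Vectors of $\mathbb{F}_p^n$ are represented by elements of \<open>X\<close>, which contains one member of each
  class modulo \<open>N\<close>; scalars are integers, and \<open>nz\<close> plays the role of the units modulo \<open>p\<close>. In the
  application \<open>\<Lambda>\<close> consists of the multipliers \<open>m\<close> for which the colours of \<open>v\<close> and \<open>m v\<close> are not
  independent.
\<close>

locale reduced_module = Modules.module scale
  for scale :: "'a::comm_ring_1 \<Rightarrow> 'v::ab_group_add \<Rightarrow> 'v" (infixr \<open>*s\<close> 75) +
  fixes N X :: "'v set" and L \<Lambda> nz :: "'a set"
  assumes subspace_N: "subspace N"
    and nz_cancel: "a \<in> nz \<Longrightarrow> a *s v \<in> N \<Longrightarrow> v \<in> N"
    and finite_X: "finite X"
    and X_inj: "x \<in> X \<Longrightarrow> y \<in> X \<Longrightarrow> x - y \<in> N \<Longrightarrow> x = y"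
    and X_rep: "\<exists>x\<in>X. v - x \<in> N"
    and finite_L: "finite L"
    and L_0: "0 \<in> L" and L_1: "1 \<in> L" and L_uminus: "a \<in> L \<Longrightarrow> - a \<in> L"
    and nz_1: "1 \<in> nz" and nz_uminus: "a \<in> nz \<Longrightarrow> - a \<in> nz"
    and Lam_L: "\<Lambda> \<subseteq> L" and Lam_nz: "\<Lambda> \<subseteq> nz"
    and Lam_diff_L: "\<kappa> \<in> \<Lambda> \<Longrightarrow> 1 - \<kappa> \<in> L"
    and Lam_diff_nz: "\<kappa> \<in> \<Lambda> \<Longrightarrow> \<kappa> \<noteq> 1 \<Longrightarrow> 1 - \<kappa> \<in> nz"
    and Lam_inverse: "\<kappa> \<in> \<Lambda> \<Longrightarrow> \<exists>\<kappa>'\<in>\<Lambda>. \<forall>v. (\<kappa>' * \<kappa>) *s v - v \<in> N"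
    and Lam_neg_1: "- 1 \<in> \<Lambda>" "(- 1 :: 'a) \<noteq> 1"
begin

lemma N_diff: "u \<in> N \<Longrightarrow> v \<in> N \<Longrightarrow> u - v \<in> N"
  using subspace_diff[OF subspace_N] .

lemma N_add: "u \<in> N \<Longrightarrow> v \<in> N \<Longrightarrow> u + v \<in> N"
  using subspace_add[OF subspace_N] .

lemma N_scale: "v \<in> N \<Longrightarrow> a *s v \<in> N"
  using subspace_scale[OF subspace_N] .

lemma N_uminus: "v \<in> N \<Longrightarrow> - v \<in> N"
  using subspace_neg[OF subspace_N] .

lemma N_0 [simp]: "0 \<in> N"
  using subspace_0[OF subspace_N] .

lemma Lam_finite: "finite \<Lambda>"
  by (rule finite_subset[OF Lam_L finite_L])

lemma card_Lam_pos: "card \<Lambda> > 0"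
  using Lam_finite Lam_neg_1(1) by (auto simp: card_gt_0_iff)

definition comb :: "('a \<times> 'v) list \<Rightarrow> 'v" where
  "comb zs = (\<Sum>(a, u)\<leftarrow>zs. a *s u)"

lemma comb_simps [simp]: "comb [] = 0" "comb ((a, u) # zs) = a *s u + comb zs"
  by (simp_all add: comb_def)

text \<open>
  \<open>sp s Y\<close> is a substitute for the linear span of \<open>Y\<close> that has only polynomially many elements, with a
  bound that does not depend on \<open>p\<close>: at each of the \<open>s\<close> steps, one linear equation with coefficients from
  the fixed finite set \<open>L\<close> is solved.
\<close>

fun sp :: "nat \<Rightarrow> 'v set \<Rightarrow> 'v set" where
  "sp 0 Y = Y"
| "sp (Suc s) Y = {x \<in> X. \<exists>\<mu> \<in> L \<inter> nz. \<exists>zs. length zs \<le> 6 \<and>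
      set zs \<subseteq> L \<times> insert 0 (sp s Y) \<and> \<mu> *s x - comb zs \<in> N}"

declare sp.simps(2) [simp del]

lemma sp_SucI:
  assumes "\<mu> *s x - comb zs \<in> N" "x \<in> X" "\<mu> \<in> L" "\<mu> \<in> nz" "length zs \<le> 6"
    and "set zs \<subseteq> L \<times> insert 0 (sp s Y)"
  shows "x \<in> sp (Suc s) Y"
  using assms by (auto simp: sp.simps(2))

lemma sp_subset_X: "Y \<subseteq> X \<Longrightarrow> sp s Y \<subseteq> X"
  by (cases s) (auto simp: sp.simps(2))

lemma sp_mono_set: "Y \<subseteq> Y' \<Longrightarrow> sp s Y \<subseteq> sp s Y'"
proof (induction s)
  case (Suc s)
  then have "L \<times> insert 0 (sp s Y) \<subseteq> L \<times> insert 0 (sp s Y')"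
    by auto
  then show ?case
    unfolding sp.simps by (intro Collect_mono) (meson order_trans)
qed simp

lemma sp_Suc_superset:
  assumes "Y \<subseteq> X"
  shows "sp s Y \<subseteq> sp (Suc s) Y"
proof
  fix x assume x: "x \<in> sp s Y"
  then show "x \<in> sp (Suc s) Y"
    using sp_subset_X[OF assms] L_1 nz_1
    by (intro sp_SucI[of 1 x "[(1, x)]"]) auto
qed

lemma sp_mono_level: "Y \<subseteq> X \<Longrightarrow> s \<le> s' \<Longrightarrow> sp s Y \<subseteq> sp s' Y"
  by (rule lift_Suc_mono_le[of "\<lambda>s. sp s Y"]) (auto dest: sp_Suc_superset)

lemma sp_mono: "Y \<subseteq> Y' \<Longrightarrow> Y' \<subseteq> X \<Longrightarrow> s \<le> s' \<Longrightarrow> sp s Y \<subseteq> sp s' Y'"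
  by (rule order_trans[OF sp_mono_set sp_mono_level])

lemma sp_base: "Y \<subseteq> X \<Longrightarrow> Y \<subseteq> sp s Y"
  using sp_mono_level[of Y 0 s] by simp

lemma finite_sp: "Y \<subseteq> X \<Longrightarrow> finite (sp s Y)"
  by (rule finite_subset[OF sp_subset_X finite_X])

text \<open>By \<open>nz_cancel\<close> and \<open>X_inj\<close> an element of the next level is
  determined by the pair (\<open>\<mu>\<close>, \<open>zs\<close>) of an equation that it solves, so
  it suffices to count such pairs. The \<open>+ 1\<close> on the right accounts for the zero vector
  allowed in \<open>zs\<close>.\<close>

lemma card_sp_Suc:
  assumes Y: "Y \<subseteq> X"
  shows "card (sp (Suc s) Y) + 1 \<le> (8 * card L ^ 7) * (card (sp s Y) + 1) ^ 6"
proof -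
  define S where "S = L \<times> insert 0 (sp s Y)"
  define Z where "Z = {zs. set zs \<subseteq> S \<and> length zs \<le> 6}"
  define n where "n = card L * (card (sp s Y) + 1)"
  have L1: "card L \<ge> 1"
    using L_1 finite_L by (metis One_nat_def Suc_leI card_gt_0_iff empty_iff)
  have n1: "n \<ge> 1"
    using L1 by (simp add: n_def)
  have finS: "finite S"
    using finite_L finite_sp[OF Y] by (simp add: S_def)
  have "card S = card L * card (insert 0 (sp s Y))"
    by (simp add: S_def card_cartesian_product)
  also have "\<dots> \<le> n"
    unfolding n_def by (intro mult_le_mono2) (use card_insert_le_m1[of "card (sp s Y) + 1" "sp s Y" 0] in simp)
  finally have cS: "card S \<le> n" .
  have finZ: "finite Z"
    using finite_lists_length_le[OF finS] by (simp add: Z_def)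
  have "card Z = (\<Sum>i\<le>6. card S ^ i)"
    using card_lists_length_le[OF finS, of 6] by (simp add: Z_def)
  also have "\<dots> \<le> (\<Sum>i\<le>(6::nat). n ^ 6)"
    using cS n1 by (intro sum_mono order_trans[OF power_mono power_increasing]) auto
  finally have cZ: "card Z \<le> 7 * n ^ 6"
    by simp
  define f where "f = (\<lambda>(\<mu>, zs). THE x. x \<in> X \<and> \<mu> *s x - comb zs \<in> N)"
  have "sp (Suc s) Y \<subseteq> f ` (L \<times> Z)"
  proof
    fix x assume "x \<in> sp (Suc s) Y"
    then obtain \<mu> zs where x: "x \<in> X" "\<mu> \<in> L" "\<mu> \<in> nz" "zs \<in> Z" "\<mu> *s x - comb zs \<in> N"
      by (auto simp: Z_def S_def sp.simps(2))
    have "f (\<mu>, zs) = x"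
      unfolding f_def prod.case
    proof (rule the_equality)
      fix y assume y: "y \<in> X \<and> \<mu> *s y - comb zs \<in> N"
      then have "(\<mu> *s y - comb zs) - (\<mu> *s x - comb zs) \<in> N"
        using x N_diff by blast
      then have "\<mu> *s (y - x) \<in> N"
        by (simp add: algebra_simps)
      then show "y = x"
        using nz_cancel X_inj x y by blast
    qed (use x in auto)
    then show "x \<in> f ` (L \<times> Z)"
      using x by force
  qed
  then have "card (sp (Suc s) Y) \<le> card (f ` (L \<times> Z))"
    using finZ finite_L by (intro card_mono) auto
  also have "\<dots> \<le> card L * card Z"
    using card_image_le[of "L \<times> Z" f] finZ finite_L by (simp add: card_cartesian_product)
  also have "\<dots> \<le> card L * (7 * n ^ 6)"
    using cZ by simp
  finally have "card (sp (Suc s) Y) \<le> 7 * (card L * n ^ 6)"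
    by simp
  moreover have "1 \<le> card L * n ^ 6"
    using L1 n1 by simp
  ultimately have "card (sp (Suc s) Y) + 1 \<le> 8 * (card L * n ^ 6)"
    by linarith
  also have "\<dots> = (8 * card L ^ 7) * (card (sp s Y) + 1) ^ 6"
    using power_Suc[of "card L" 6] unfolding n_def power_mult_distrib by simp
  finally show ?thesis .
qed

text \<open>Each level takes a sixth power and multiplies by a constant not exceeding the base; the
  base 7 of the exponent, instead of 6, absorbs that constant.\<close>

lemma card_sp:
  assumes Y: "Y \<subseteq> X"
  shows "card (sp s Y) + 1 \<le> (8 * card L ^ 7 * (card Y + 1)) ^ (7 ^ s)"
proof (induction s)
  case 0
  have "card L \<ge> 1"
    using L_1 finite_L by (metis One_nat_def Suc_leI card_gt_0_iff empty_iff)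
  then have "1 * (card Y + 1) \<le> 8 * card L ^ 7 * (card Y + 1)"
    by (intro mult_le_mono1) simp
  then show ?case by simp
next
  case (Suc s)
  define C a where "C = 8 * card L ^ 7" and "a = C * (card Y + 1)"
  have C1: "C \<ge> 1"
    using L_1 finite_L by (auto simp: C_def Suc_le_eq card_gt_0_iff)
  have aC: "C \<le> a" and a1: "a \<ge> 1"
    using C1 by (auto simp: a_def)
  have "card (sp (Suc s) Y) + 1 \<le> C * (card (sp s Y) + 1) ^ 6"
    using card_sp_Suc[OF Y] by (simp add: C_def)
  also have "\<dots> \<le> a * (a ^ (7 ^ s)) ^ 6"
    using Suc aC by (intro mult_mono power_mono) (auto simp: C_def a_def)
  also have "\<dots> = a ^ (1 + 7 ^ s * 6)"
    by (simp add: power_mult)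
  also have "\<dots> \<le> a ^ (7 ^ Suc s)"
    using a1 by (intro power_increasing) auto
  finally show ?case
    by (simp add: C_def a_def)
qed

text \<open>
  The differences belonging to the pairs of such a set receive independent colours.
\<close>

definition sepd :: "('v \<times> 'v) set \<Rightarrow> bool" where
  "sepd P \<longleftrightarrow> (\<forall>y b. (y, b) \<in> P \<longrightarrow> y \<noteq> b) \<and>
     (\<forall>y b y' b'. (y, b) \<in> P \<longrightarrow> (y', b') \<in> P \<longrightarrow> (y, b) \<noteq> (y', b') \<longrightarrow>
        (\<forall>\<kappa>\<in>\<Lambda>. \<kappa> *s (y - b) - (y' - b') \<notin> N))"

lemma sepdD: "sepd P \<Longrightarrow> (y, b) \<in> P \<Longrightarrow> (y', b') \<in> P \<Longrightarrow> (y, b) \<noteq> (y', b') \<Longrightarrow>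
    \<kappa> \<in> \<Lambda> \<Longrightarrow> \<kappa> *s (y - b) - (y' - b') \<notin> N"
  unfolding sepd_def by blast

lemma sepd_neq: "sepd P \<Longrightarrow> (y, b) \<in> P \<Longrightarrow> y \<noteq> b"
  unfolding sepd_def by blast

lemma sepd_empty [simp]: "sepd {}"
  by (simp add: sepd_def)

text \<open>Being a \<Lambda>-multiple modulo \<open>N\<close> is a symmetric relation, so new pairs
  have to be compared with old ones in one order only.\<close>

lemma Lam_swap:
  assumes "\<kappa> \<in> \<Lambda>" "\<kappa> *s u - v \<in> N"
  shows "\<exists>\<kappa>'\<in>\<Lambda>. \<kappa>' *s v - u \<in> N"
proof -
  obtain \<kappa>' where l: "\<kappa>' \<in> \<Lambda>" "(\<kappa>' * \<kappa>) *s u - u \<in> N"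
    using Lam_inverse assms by blast
  have "((\<kappa>' * \<kappa>) *s u - u) - \<kappa>' *s (\<kappa> *s u - v) \<in> N"
    using l N_scale[OF assms(2)] N_diff by blast
  then have "\<kappa>' *s v - u \<in> N"
    by (simp add: algebra_simps)
  with l show ?thesis by blast
qed

lemma sepd_extend:
  assumes P: "sepd P" and x: "x \<in> X" and B: "B \<subseteq> X" "x \<notin> B"
    and new: "\<And>b b' \<kappa>. b \<in> B \<Longrightarrow> b' \<in> B \<Longrightarrow> \<kappa> \<in> \<Lambda> \<Longrightarrow> \<kappa> \<noteq> 1 \<Longrightarrow> \<kappa> *s (x - b) - (x - b') \<notin> N"
    and old: "\<And>b y b' \<kappa>. b \<in> B \<Longrightarrow> (y, b') \<in> P \<Longrightarrow> \<kappa> \<in> \<Lambda> \<Longrightarrow> \<kappa> *s (x - b) - (y - b') \<notin> N"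
  shows "sepd (P \<union> {x} \<times> B)"
proof -
  have new': "\<kappa> *s (x - b) - (x - b') \<notin> N"
    if "b \<in> B" "b' \<in> B" "\<kappa> \<in> \<Lambda>" "b \<noteq> b'" for b b' \<kappa>
  proof (cases "\<kappa> = 1")
    case True
    then show ?thesis
      using that B X_inj[of b' b] by (auto simp: algebra_simps)
  qed (use new that in blast)
  have old': "\<kappa> *s (y - b') - (x - b) \<notin> N" if "b \<in> B" "(y, b') \<in> P" "\<kappa> \<in> \<Lambda>" for b y b' \<kappa>
    using Lam_swap[of \<kappa> "y - b'" "x - b"] that old by blast
  have neq: "y \<noteq> b" if "(y, b) \<in> P \<union> {x} \<times> B" for y b
    using sepd_neq[OF P] B that by auto
  have "\<kappa> *s (y - b) - (y' - b') \<notin> N"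
    if asm: "(y, b) \<in> P \<union> {x} \<times> B" "(y', b') \<in> P \<union> {x} \<times> B" "(y, b) \<noteq> (y', b')" "\<kappa> \<in> \<Lambda>"
    for y b y' b' \<kappa>
  proof -
    consider "(y, b) \<in> P" "(y', b') \<in> P" | "(y, b) \<in> P" "y' = x" "b' \<in> B"
      | "y = x" "b \<in> B" "(y', b') \<in> P" | "y = x" "b \<in> B" "y' = x" "b' \<in> B"
      using asm(1,2) by auto
    then show ?thesis
    proof cases
      case 1
      then show ?thesis by (rule sepdD[OF P _ _ asm(3,4)])
    next
      case 2
      then show ?thesis using old'[of b' y b \<kappa>] asm(4) by simp
    next
      case 3
      then show ?thesis using old[of b y' b' \<kappa>] asm(4) by simp
    next
      case 4
      then show ?thesis using new'[of b b' \<kappa>] asm(3,4) by simp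
    qed
  qed
  with neq show ?thesis
    unfolding sepd_def by (intro conjI allI impI ballI)
qed

text \<open>
  The elements \<open>b\<close> for which the difference \<open>x - b\<close> brings no new independent colour compared with the
  differences between \<open>Y\<close> and \<open>A\<close>.
\<close>

definition bad :: "'v set \<Rightarrow> 'v set \<Rightarrow> 'v \<Rightarrow> 'v set" where
  "bad A Y x = {b \<in> A. \<exists>\<kappa>\<in>\<Lambda>. (\<exists>y\<in>Y. \<exists>c\<in>A. \<kappa> *s (x - b) - (y - c) \<in> N) \<or>
     (\<kappa> \<noteq> 1 \<and> (\<exists>c\<in>A. \<kappa> *s (x - b) - (x - c) \<in> N))}"

text \<open>The multiplier - 1 relates the zero difference x - x to itself. This keeps
  \<open>x\<close> out of \<open>A - bad A Y x\<close> in \<open>sepd_extend_good\<close>.\<close>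

lemma self_bad: "x \<in> A \<Longrightarrow> x \<in> bad A Y x"
  unfolding bad_def
  by (intro CollectI conjI bexI[of _ "- 1"] disjI2 bexI[of _ x] Lam_neg_1) (auto simp: Lam_neg_1)

text \<open>Solving the relation for \<open>c\<close> gives both cases of \<open>bad\<close> one
  shape: t = 0 and w in \<open>Y\<close> for a difference y - c, and t = 1 and w = 0 for a
  difference x - c. The coefficients of \<open>x\<close> and of \<open>b\<close> are both units, so
  either of the two can be recovered from the other data.\<close>

lemma badE:
  assumes "b \<in> bad A Y x"
  obtains \<kappa> t w c where "\<kappa> \<in> \<Lambda>" "t \<in> {0, 1}" "t - \<kappa> \<in> nz" "t - \<kappa> \<in> L" "w \<in> insert 0 Y" "c \<in> A"
    "c - (w + (t - \<kappa>) *s x + \<kappa> *s b) \<in> N"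
proof -
  from assms obtain \<kappa> where l: "\<kappa> \<in> \<Lambda>" and
    "(\<exists>y\<in>Y. \<exists>c\<in>A. \<kappa> *s (x - b) - (y - c) \<in> N) \<or> (\<kappa> \<noteq> 1 \<and> (\<exists>c\<in>A. \<kappa> *s (x - b) - (x - c) \<in> N))"
    by (auto simp: bad_def)
  then show thesis
  proof (elim disjE bexE conjE)
    fix y c assume "y \<in> Y" "c \<in> A" "\<kappa> *s (x - b) - (y - c) \<in> N"
    then show thesis
      using l Lam_L Lam_nz L_uminus nz_uminus
      by (intro that[of \<kappa> 0 y c]) (auto simp: algebra_simps)
  next
    fix c assume "\<kappa> \<noteq> 1" "c \<in> A" "\<kappa> *s (x - b) - (x - c) \<in> N"
    then show thesis
      using l Lam_diff_L Lam_diff_nz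
      by (intro that[of \<kappa> 1 0 c]) (auto simp: algebra_simps)
  qed
qed


text \<open>Any coincidence is a linear equation for \<open>x\<close> with coefficient 1 - \<kappa>
  or \<kappa>, both units, and all other vectors in \<open>sp m Y\<close>; it would put
  \<open>x\<close> into the next level.\<close>

lemma sepd_extend_inner:
  assumes A: "A \<subseteq> X" "Y \<subseteq> A" "x \<in> A" and x: "x \<notin> sp (Suc m) Y"
    and P: "sepd P" "fst ` P \<subseteq> Y" "snd ` P \<subseteq> sp m Y"
  shows "sepd (P \<union> {x} \<times> (A \<inter> sp m Y))"
proof (rule sepd_extend[OF P(1)])
  have YX: "Y \<subseteq> X" using A by auto
  show "x \<notin> A \<inter> sp m Y"
    using x sp_Suc_superset[OF YX] by auto
  show "\<kappa> *s (x - b) - (x - b') \<notin> N"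
    if b: "b \<in> A \<inter> sp m Y" "b' \<in> A \<inter> sp m Y" "\<kappa> \<in> \<Lambda>" "\<kappa> \<noteq> 1" for b b' \<kappa>
  proof
    assume "\<kappa> *s (x - b) - (x - b') \<in> N"
    from N_uminus[OF this] have rel: "(1 - \<kappa>) *s x - comb [(1, b'), (- \<kappa>, b)] \<in> N"
      by (simp add: algebra_simps)
    have "x \<in> sp (Suc m) Y"
      by (rule sp_SucI[OF rel])
        (use A b L_1 L_uminus Lam_L Lam_diff_L Lam_diff_nz in auto)
    with x show False ..
  qed
  show "\<kappa> *s (x - b) - (y - b') \<notin> N"
    if b: "b \<in> A \<inter> sp m Y" "(y, b') \<in> P" "\<kappa> \<in> \<Lambda>" for b y b' \<kappa>
  proof
    assume "\<kappa> *s (x - b) - (y - b') \<in> N"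
    then have rel: "\<kappa> *s x - comb [(\<kappa>, b), (1, y), (- 1, b')] \<in> N"
      by (simp add: algebra_simps)
    have yb: "y \<in> sp m Y" "b' \<in> sp m Y"
      using b(2) P sp_base[OF YX] by force+
    have "x \<in> sp (Suc m) Y"
      by (rule sp_SucI[OF rel]) (use A b yb L_1 L_uminus Lam_L Lam_nz in auto)
    with x show False ..
  qed
qed (use A in auto)

lemma sepd_extend_good:
  assumes A: "A \<subseteq> X" "x \<in> A"
    and P: "sepd P" "fst ` P \<subseteq> Y" "snd ` P \<subseteq> A"
  shows "sepd (P \<union> {x} \<times> (A - bad A Y x))"
proof (rule sepd_extend[OF P(1)])
  show "x \<notin> A - bad A Y x"
    using self_bad[OF A(2)] by auto
  show "\<kappa> *s (x - b) - (x - b') \<notin> N"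
    if "b \<in> A - bad A Y x" "b' \<in> A - bad A Y x" "\<kappa> \<in> \<Lambda>" "\<kappa> \<noteq> 1" for b b' \<kappa>
    using that by (auto simp: bad_def)
  show "\<kappa> *s (x - b) - (y - b') \<notin> N"
    if "b \<in> A - bad A Y x" "(y, b') \<in> P" "\<kappa> \<in> \<Lambda>" for b y b' \<kappa>
  proof -
    have "y \<in> Y" "b' \<in> A"
      using that(2) P by force+
    then show ?thesis
      using that by (auto simp: bad_def)
  qed
qed (use A in auto)

text \<open>Double counting of the pairs (x, b) with b bad for x. The b of low degree account for at
  most half of the at least \<eta> |A| |F| pairs, and every other b for at most |F| of them.\<close>

lemma core_large:
  fixes \<eta> :: real
  assumes A: "finite A" and F: "finite F" "F \<noteq> {}" and \<eta>: "\<eta> > 0"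
    and many: "\<And>x. x \<in> F \<Longrightarrow> \<eta> * card A \<le> card (bad A Y x - V)"
  shows "\<eta> * card A / 2 \<le> card {b \<in> A - V. \<eta> * card F / 2 \<le> card {x \<in> F. b \<in> bad A Y x}}"
proof -
  define G where "G = (\<lambda>b. {x \<in> F. b \<in> bad A Y x})"
  define Core where "Core = {b \<in> A - V. \<eta> * card F / 2 \<le> card (G b)}"
  have CF: "card F > 0"
    using F by (simp add: card_gt_0_iff)
  have "card F * (\<eta> * card A) = (\<Sum>x\<in>F. \<eta> * card A)"
    by simp
  also have "\<dots> \<le> (\<Sum>x\<in>F. real (card (bad A Y x - V)))"
    by (intro sum_mono many)
  also have "\<dots> = (\<Sum>x\<in>F. \<Sum>b\<in>A - V. if b \<in> bad A Y x then 1 else 0)"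
  proof (rule sum.cong)
    fix x
    have "bad A Y x - V = {b \<in> A - V. b \<in> bad A Y x}"
      by (auto simp: bad_def)
    then show "real (card (bad A Y x - V)) = (\<Sum>b\<in>A - V. if b \<in> bad A Y x then 1 else 0)"
      using A by (simp add: sum.If_cases Int_def)
  qed simp
  also have "\<dots> = (\<Sum>b\<in>A - V. \<Sum>x\<in>F. if b \<in> bad A Y x then 1 else 0)"
    by (rule sum.swap)
  also have "\<dots> = (\<Sum>b\<in>A - V. real (card (G b)))"
    using F by (simp add: sum.If_cases Int_def G_def)
  also have "\<dots> \<le> (\<Sum>b\<in>A - V. (if b \<in> Core then real (card F) else 0) + \<eta> * card F / 2)"
  proof (rule sum_mono)
    fix b assume b: "b \<in> A - V"
    have "card (G b) \<le> card F"
      using F by (intro card_mono) (auto simp: G_def)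
    then show "real (card (G b)) \<le> (if b \<in> Core then real (card F) else 0) + \<eta> * card F / 2"
      using b \<eta> by (auto simp: Core_def add_increasing2)
  qed
  also have "\<dots> = card Core * card F + card (A - V) * (\<eta> * card F / 2)"
  proof -
    have "{b \<in> A - V. b \<in> Core} = Core"
      by (auto simp: Core_def)
    then show ?thesis
      using A by (simp add: sum.distrib sum.If_cases Int_def)
  qed
  also have "\<dots> \<le> card Core * card F + card A * (\<eta> * card F / 2)"
    using A \<eta> by (intro add_left_mono mult_right_mono) (auto intro: card_mono)
  finally have "card F * (\<eta> * card A / 2) \<le> card F * real (card Core)"
    by (simp add: field_simps)
  then have "\<eta> * card A / 2 \<le> card Core"
    using CF by (simp only: mult_le_cancel_left_pos of_nat_0_less_iff)
  then show ?thesis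
    by (simp add: Core_def G_def)
qed


text \<open>Independence of \<open>F\<close> relative to \<open>Y\<close>. The level
  \<open>l\<close> is a budget: passing from a difference of new elements to a difference of old
  ones costs one level, so round \<open>j\<close> starts with the budget s - j.\<close>

definition separated :: "nat \<Rightarrow> 'v set \<Rightarrow> 'v set \<Rightarrow> bool" where
  "separated l Y F \<longleftrightarrow> (\<forall>f\<in>F. \<forall>f'\<in>F. f \<noteq> f' \<longrightarrow> (\<forall>\<sigma>\<in>insert 0 (sp l Y). f - f' - \<sigma> \<notin> N))"

text \<open>
  If all \<open>x\<close> outside the span have many bad partners, then each \<open>x\<close> of a family \<open>F\<close> combines with many
  independent \<open>b\<close> to further elements \<open>w + \<mu> x + \<kappa> b\<close> of \<open>A\<close>, unless a few elements of \<open>A\<close> suffice to enlarge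
  the part of \<open>A\<close> in the span by a positive proportion. As the families grow geometrically inside the
  finite set \<open>A\<close>, the second alternative must occur after \<open>s\<close> rounds.
\<close>

lemma bulk_round:
  fixes \<eta> :: real and q :: nat
  assumes A: "A \<subseteq> X" and Y: "Y \<subseteq> A" and Z: "Z \<subseteq> A" and F: "F \<subseteq> A" and \<eta>: "\<eta> > 0"
    and many: "\<And>x. x \<in> A - sp (Suc m) Y \<Longrightarrow> \<eta> * card A \<le> card (bad A Y x - sp m Y)"
    and F_out: "F \<inter> sp (Suc m) Y = {}" and F_in: "F \<subseteq> sp j (Y \<union> Z)" and js: "j < s"
    and F_sep: "separated (s - j) Y F" and M: "M = m + s + 5"
    and small: "\<And>Z'. Z \<subseteq> Z' \<Longrightarrow> Z' \<subseteq> A \<Longrightarrow> card Z' \<le> card Z + q \<Longrightarrow>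
      card (A \<inter> sp M (Y \<union> Z')) < card (A \<inter> sp m Y) + \<eta> * card A / 2"
  shows "\<exists>Z' F'. Z \<subseteq> Z' \<and> Z' \<subseteq> A \<and> card Z' \<le> card Z + q \<and> F' \<subseteq> A \<and> F' \<inter> sp (Suc m) Y = {} \<and>
    F' \<subseteq> sp (Suc j) (Y \<union> Z') \<and> separated (s - Suc j) Y F' \<and>
    q * \<eta> / (4 * card \<Lambda>) * card F \<le> card F'"
proof (cases "F = {}")
  case True
  then show ?thesis
    using Z by (intro exI[of _ Z] exI[of _ "{}"]) (auto simp: separated_def)
next
  case F_ne: False
  have finA: "finite A"
    by (rule finite_subset[OF A finite_X])
  have finF: "finite F" and finZ: "finite Z"
    using F Z finA finite_subset by blast+
  have YX: "Y \<subseteq> X" and ZX: "Z \<subseteq> X"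
    using A Y Z by auto
  define Core where "Core = {b \<in> A - sp m Y. \<eta> * card F / 2 \<le> card {x \<in> F. b \<in> bad A Y x}}"
  have Core_A: "Core \<subseteq> A - sp m Y"
    by (auto simp: Core_def)
  have Core_card: "\<eta> * card A / 2 \<le> card Core"
    unfolding Core_def using finA finF F_ne \<eta> many F F_out by (intro core_large) auto
  \<comment> \<open>If a few further elements spanned all of \<open>Core\<close>, the part of
    \<open>A\<close> in the span would grow by \<eta> |A| / 2, against \<open>small\<close>.\<close>
  have new: "\<exists>b. b \<in> Core \<and> b \<notin> sp M (Y \<union> Z')"
    if Z': "Z \<subseteq> Z'" "Z' \<subseteq> A" "card Z' \<le> card Z + q" for Z'
  proof (rule ccontr)
    assume "\<not> ?thesis"
    then have sub: "Core \<subseteq> sp M (Y \<union> Z')" by blast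
    have "Y \<union> Z' \<subseteq> X"
      using A Y Z' by auto
    then have "sp m Y \<subseteq> sp M (Y \<union> Z')"
      by (intro sp_mono) (auto simp: M)
    then have "(A \<inter> sp m Y) \<union> Core \<subseteq> A \<inter> sp M (Y \<union> Z')"
      using sub Core_A by auto
    then have "card ((A \<inter> sp m Y) \<union> Core) \<le> card (A \<inter> sp M (Y \<union> Z'))"
      using finA by (intro card_mono) auto
    moreover have "card ((A \<inter> sp m Y) \<union> Core) = card (A \<inter> sp m Y) + card Core"
      using finA Core_A by (intro card_Un_disjoint) (auto intro: finite_subset)
    ultimately show False
      using small[OF Z'] Core_card by linarith
  qed
  \<comment> \<open>Each b t is taken outside the span of everything chosen before it. All later
    contradictions arise by solving a relation for such a b t.\<close>
  have "\<exists>b. \<forall>t<q. b t \<in> Core \<and> b t \<notin> sp M (Y \<union> (Z \<union> b ` {..<t}))"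
  proof (rule dependent_choice_upto)
    fix b :: "nat \<Rightarrow> 'v" and t
    assume t: "t < q" and b: "\<And>i. i < t \<Longrightarrow> b i \<in> Core \<and> b i \<notin> sp M (Y \<union> (Z \<union> b ` {..<i}))"
    have "card (Z \<union> b ` {..<t}) \<le> card Z + card (b ` {..<t})"
      by (rule card_Un_le)
    also have "card (b ` {..<t}) \<le> t"
      using card_image_le[of "{..<t}" b] by simp
    finally show "\<exists>y. y \<in> Core \<and> y \<notin> sp M (Y \<union> (Z \<union> b ` {..<t}))"
      using t b Core_A Z by (intro new) auto
  next
    fix t and b b' :: "nat \<Rightarrow> 'v" and y
    assume "\<And>i. i < t \<Longrightarrow> b i = b' i"
    then have "b ` {..<t} = b' ` {..<t}"
      by (intro image_cong) auto
    then show "(y \<in> Core \<and> y \<notin> sp M (Y \<union> (Z \<union> b ` {..<t}))) =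
        (y \<in> Core \<and> y \<notin> sp M (Y \<union> (Z \<union> b' ` {..<t})))"
      by simp
  qed
  then obtain b where b_core: "\<And>t. t < q \<Longrightarrow> b t \<in> Core"
    and b_new: "\<And>t. t < q \<Longrightarrow> b t \<notin> sp M (Y \<union> (Z \<union> b ` {..<t}))"
    by blast
  have b_A: "b t \<in> A" if "t < q" for t
    using b_core[OF that] Core_A by auto
  define U where "U = (\<lambda>t. Y \<union> (Z \<union> b ` {..<t}))"
  have U_X: "U t \<subseteq> X" if "t \<le> q" for t
    using that b_A A YX ZX by (auto simp: U_def)
  define Z' where "Z' = Z \<union> b ` {..<q}"
  define Pr where "Pr = Sigma {..<q} (\<lambda>t. {x \<in> F. b t \<in> bad A Y x})"
  have finPr: "finite Pr"
    using finF by (auto simp: Pr_def)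
  have Pr_card: "q * (\<eta> * card F / 2) \<le> card Pr"
  proof -
    have "q * (\<eta> * card F / 2) = (\<Sum>t<q. \<eta> * card F / 2)"
      by simp
    also have "\<dots> \<le> (\<Sum>t<q. real (card {x \<in> F. b t \<in> bad A Y x}))"
      using b_core by (intro sum_mono) (auto simp: Core_def)
    also have "\<dots> = card Pr"
      using finF by (simp add: Pr_def)
    finally show ?thesis .
  qed
  \<comment> \<open>\<open>e p\<close> collects the witnesses of \<open>badE\<close> for the
    incidence p = (t, x); its last component, called \<open>C p\<close> below, is the element of
    \<open>A\<close> that the incidence produces.\<close>
  have "\<forall>p\<in>Pr. \<exists>e. fst e \<in> \<Lambda> \<and> fst (snd e) \<in> {0, 1} \<and> fst (snd e) - fst e \<in> nz \<and>
      fst (snd e) - fst e \<in> L \<and> fst (snd (snd e)) \<in> insert 0 Y \<and> snd (snd (snd e)) \<in> A \<and>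
      snd (snd (snd e)) - (fst (snd (snd e)) + (fst (snd e) - fst e) *s snd p + fst e *s b (fst p)) \<in> N"
    (is "\<forall>p\<in>Pr. \<exists>e. ?R p e")
  proof
    fix p assume "p \<in> Pr"
    then have "b (fst p) \<in> bad A Y (snd p)"
      by (auto simp: Pr_def)
    then obtain \<kappa> \<tau> w c where "\<kappa> \<in> \<Lambda>" "\<tau> \<in> {0, 1}" "\<tau> - \<kappa> \<in> nz" "\<tau> - \<kappa> \<in> L" "w \<in> insert 0 Y" "c \<in> A"
      "c - (w + (\<tau> - \<kappa>) *s snd p + \<kappa> *s b (fst p)) \<in> N"
      by (rule badE)
    then show "\<exists>e. ?R p e"
      by (intro exI[of _ "(\<kappa>, \<tau>, w, c)"]) simp
  qed
  then obtain e where e: "\<forall>p\<in>Pr. ?R p (e p)"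
    by (rule bchoice[THEN exE])
  define ty where "ty = (\<lambda>p. (fst (e p), fst (snd (e p))))"
  define W where "W = (\<lambda>p. fst (snd (snd (e p))))"
  define C where "C = (\<lambda>p. snd (snd (snd (e p))))"
  have ty_sub: "ty ` Pr \<subseteq> \<Lambda> \<times> {0, 1}"
    using e by (auto simp: ty_def)
  have ty_fin: "card (\<Lambda> \<times> {0, 1 :: 'a}) \<le> 2 * card \<Lambda>"
    by (simp add: card_cartesian_product)
  \<comment> \<open>Fixing the coefficients costs a factor 2 |\<Lambda>|. Together with the factor
    \<eta> / 2 from \<open>Core\<close> this gives the growth rate q \<eta> / (4
    |\<Lambda>|).\<close>
  have "\<exists>t\<in>\<Lambda> \<times> {0, 1}. card Pr \<le> card (\<Lambda> \<times> {0, 1 :: 'a}) * card {p \<in> Pr. ty p = t}"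
    using finPr Lam_finite Lam_neg_1(1) ty_sub by (intro pigeonhole_fibre) auto
  then obtain \<kappa> \<tau> where "card Pr \<le> card (\<Lambda> \<times> {0, 1 :: 'a}) * card {p \<in> Pr. ty p = (\<kappa>, \<tau>)}"
    by (metis surj_pair)
  then have ty_card: "card Pr \<le> 2 * card \<Lambda> * card {p \<in> Pr. ty p = (\<kappa>, \<tau>)}"
    using ty_fin by (meson le_trans mult_le_mono1)
  define Pr' where "Pr' = {p \<in> Pr. ty p = (\<kappa>, \<tau>)}"
  define \<mu> where "\<mu> = \<tau> - \<kappa>"
  have Pr': "\<kappa> \<in> L" "\<kappa> \<in> nz" "\<mu> \<in> L" "\<mu> \<in> nz" "W (t, x) \<in> insert 0 Y" "C (t, x) \<in> A"
    "C (t, x) - (W (t, x) + \<mu> *s x + \<kappa> *s b t) \<in> N" "t < q" "x \<in> F" if p: "(t, x) \<in> Pr'" for t x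
  proof -
    have "(t, x) \<in> Pr" and eq: "fst (e (t, x)) = \<kappa>" "fst (snd (e (t, x))) = \<tau>"
      using p by (auto simp: Pr'_def ty_def)
    with e have R: "?R (t, x) (e (t, x))"
      by blast
    show "\<kappa> \<in> L" "\<kappa> \<in> nz" "\<mu> \<in> L" "\<mu> \<in> nz" "W (t, x) \<in> insert 0 Y" "C (t, x) \<in> A"
      "C (t, x) - (W (t, x) + \<mu> *s x + \<kappa> *s b t) \<in> N"
      using R Lam_L Lam_nz unfolding eq W_def C_def \<mu>_def fst_conv snd_conv by blast+
    show "t < q" "x \<in> F"
      using \<open>(t, x) \<in> Pr\<close> by (auto simp: Pr_def)
  qed
  have later: "C (t, x) - C (t', x') - a *s \<sigma> \<notin> N"
    if p: "(t, x) \<in> Pr'" "(t', x') \<in> Pr'" "t' < t"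
      and \<sigma>: "\<sigma> \<in> insert 0 (sp (s - Suc j) Y)" and a: "a \<in> L"
    for t x t' x' \<sigma> a
  proof
    assume N: "C (t, x) - C (t', x') - a *s \<sigma> \<in> N"
    have "(C (t, x) - C (t', x') - a *s \<sigma>) - (C (t, x) - (W (t, x) + \<mu> *s x + \<kappa> *s b t))
        + (C (t', x') - (W (t', x') + \<mu> *s x' + \<kappa> *s b t')) \<in> N"
      by (intro N_add N_diff N Pr'(7)[OF p(1)] Pr'(7)[OF p(2)])
    \<comment> \<open>This relation has six terms on the right, which is the length allowed in
      \<open>sp\<close>.\<close>
    then have rel: "\<kappa> *s b t - comb [(- 1, W (t, x)), (1, W (t', x')), (- \<mu>, x), (\<mu>, x'),
        (\<kappa>, b t'), (a, \<sigma>)] \<in> N"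
      by (simp add: algebra_simps)
    have tq: "t < q" "t' < q"
      using Pr'(8) p by auto
    have UX: "U t \<subseteq> X"
      using U_X tq by auto
    have mem: "W (t, x) \<in> insert 0 (sp s (U t))" "W (t', x') \<in> insert 0 (sp s (U t))" "b t' \<in> sp s (U t)"
      using Pr'(5)[OF p(1)] Pr'(5)[OF p(2)] sp_base[OF UX, of s] p(3) by (auto simp: U_def)
    have "sp j (Y \<union> Z) \<subseteq> sp s (U t)"
      using js UX by (intro sp_mono) (auto simp: U_def)
    then have memx: "x \<in> sp s (U t)" "x' \<in> sp s (U t)"
      using F_in Pr'(9)[OF p(1)] Pr'(9)[OF p(2)] by auto
    have "sp (s - Suc j) Y \<subseteq> sp s (U t)"
      using UX by (intro sp_mono) (auto simp: U_def)
    with \<sigma> have \<sigma>': "\<sigma> \<in> insert 0 (sp s (U t))"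
      by auto
    have "b t \<in> sp (Suc s) (U t)"
      by (rule sp_SucI[OF rel]) (use Pr'(1-4)[OF p(1)] b_A[OF tq(1)] A mem memx \<sigma>' a L_1 L_uminus in auto)
    also have "\<dots> \<subseteq> sp M (U t)"
      using UX by (intro sp_mono_level) (auto simp: M)
    finally show False
      using b_new[OF tq(1)] by (simp add: U_def)
  qed
  have key: "C (t, x) - C (t', x') - \<sigma> \<notin> N"
    if p: "(t, x) \<in> Pr'" "(t', x') \<in> Pr'" "(t, x) \<noteq> (t', x')" and \<sigma>: "\<sigma> \<in> insert 0 (sp (s - Suc j) Y)"
    for t x t' x' \<sigma>
  proof -
    consider "t' < t" | "t < t'" | "t = t'" "x \<noteq> x'"
      using p(3) by fastforce
    then show ?thesis
    proof cases
      case 1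
      then show ?thesis using later[OF p(1,2) 1 \<sigma> L_1] by simp
    next
      case 2
      have "C (t', x') - C (t, x) - (- 1) *s \<sigma> \<notin> N"
        by (rule later[OF p(2,1) 2 \<sigma> L_uminus[OF L_1]])
      then show ?thesis
        using N_uminus[of "C (t, x) - C (t', x') - \<sigma>"] by (auto simp: algebra_simps)
    next
      case 3
      show ?thesis
      proof
        assume N: "C (t, x) - C (t', x') - \<sigma> \<in> N"
        \<comment> \<open>For equal t the terms with b t cancel. The class of x - x' then solves an
          equation over \<open>sp (s - Suc j) Y\<close>, so it lies one level higher, where the
          separation of \<open>F\<close> excludes it.\<close>
        obtain \<rho> where \<rho>: "\<rho> \<in> X" "x - x' - \<rho> \<in> N"
          using X_rep[of "x - x'"] by auto
        have p2: "(t, x') \<in> Pr'"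
          using p 3 by auto
        have "(C (t, x) - C (t', x') - \<sigma>) - (C (t, x) - (W (t, x) + \<mu> *s x + \<kappa> *s b t))
            + (C (t, x') - (W (t, x') + \<mu> *s x' + \<kappa> *s b t)) - \<mu> *s (x - x' - \<rho>) \<in> N"
          by (intro N_add N_diff N_scale N \<rho> Pr'(7)[OF p(1)] Pr'(7)[OF p2])
        then have rel: "\<mu> *s \<rho> - comb [(1, \<sigma>), (- 1, W (t, x)), (1, W (t, x'))] \<in> N"
          using 3 by (simp add: algebra_simps)
        have "\<rho> \<in> sp (Suc (s - Suc j)) Y"
          by (rule sp_SucI[OF rel])
            (use Pr'(3-5)[OF p(1)] Pr'(5)[OF p2] \<rho>(1) \<sigma> sp_base[OF YX, of "s - Suc j"] L_1 L_uminus in auto)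
        then have "\<rho> \<in> sp (s - j) Y"
          using js by (simp add: Suc_diff_Suc)
        then show False
          using F_sep \<rho>(2) Pr'(9)[OF p(1)] Pr'(9)[OF p2] 3 unfolding separated_def by blast
      qed
    qed
  qed
  define F' where "F' = C ` Pr'"
  have inj: "inj_on C Pr'"
  proof (rule inj_onI, rule ccontr)
    fix p p' assume p: "p \<in> Pr'" "p' \<in> Pr'" "C p = C p'" "p \<noteq> p'"
    then show False
      using key[of "fst p" "snd p" "fst p'" "snd p'" 0] by simp
  qed
  have F'_card: "q * \<eta> / (4 * card \<Lambda>) * card F \<le> card F'"
  proof -
    have "card Pr \<le> 2 * card \<Lambda> * card F'"
      using ty_card card_image[OF inj] by (simp add: F'_def Pr'_def)
    then have "real (card Pr) \<le> 2 * card \<Lambda> * card F'"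
      using of_nat_mono by fastforce
    then have "q * (\<eta> * card F / 2) \<le> 2 * card \<Lambda> * card F'"
      using Pr_card by linarith
    then show ?thesis
      using card_Lam_pos by (simp add: field_simps)
  qed
  have "separated (s - Suc j) Y F'"
    unfolding separated_def
  proof (intro ballI impI)
    fix f f' \<sigma> assume f: "f \<in> F'" "f' \<in> F'" "f \<noteq> f'" "\<sigma> \<in> insert 0 (sp (s - Suc j) Y)"
    then obtain t x t' x' where "(t, x) \<in> Pr'" "(t', x') \<in> Pr'" "f = C (t, x)" "f' = C (t', x')"
      by (auto simp: F'_def)
    with f show "f - f' - \<sigma> \<notin> N"
      using key[of t x t' x' \<sigma>] by auto
  qed
  moreover have "F' \<subseteq> A"
    using Pr'(6) by (auto simp: F'_def)
  \<comment> \<open>Again b t could be expressed by older elements, now by \<open>C (t, x)\<close>,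
    \<open>W (t, x)\<close> and \<open>x\<close>.\<close>
  moreover have "F' \<inter> sp (Suc m) Y = {}"
  proof (rule ccontr)
    assume "F' \<inter> sp (Suc m) Y \<noteq> {}"
    then obtain t x where p: "(t, x) \<in> Pr'" and c: "C (t, x) \<in> sp (Suc m) Y"
      by (auto simp: F'_def)
    define l where "l = Suc m + s"
    have UX: "U t \<subseteq> X"
      using U_X Pr'(8)[OF p] by auto
    have "sp (Suc m) Y \<subseteq> sp l (U t)"
      by (rule sp_mono) (use UX in \<open>auto simp: U_def l_def\<close>)
    moreover have "sp j (Y \<union> Z) \<subseteq> sp l (U t)"
      by (rule sp_mono) (use UX js in \<open>auto simp: U_def l_def\<close>)
    moreover have "Y \<subseteq> sp l (U t)"
      using sp_base[OF UX, of l] by (auto simp: U_def)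
    ultimately have mem: "C (t, x) \<in> sp l (U t)" "x \<in> sp l (U t)" "W (t, x) \<in> insert 0 (sp l (U t))"
      using c F_in Pr'(9)[OF p] Pr'(5)[OF p] by auto
    have rel: "\<kappa> *s b t - comb [(1, C (t, x)), (- 1, W (t, x)), (- \<mu>, x)] \<in> N"
      using N_uminus[OF Pr'(7)[OF p]] by (simp add: algebra_simps)
    have "b t \<in> sp (Suc l) (U t)"
      by (rule sp_SucI[OF rel]) (use Pr'(1-4)[OF p] b_A[OF Pr'(8)[OF p]] A mem L_1 L_uminus in auto)
    also have "\<dots> \<subseteq> sp M (U t)"
      using UX by (intro sp_mono_level) (auto simp: M l_def)
    finally show False
      using b_new[OF Pr'(8)[OF p]] by (simp add: U_def)
  qed
  moreover have "F' \<subseteq> sp (Suc j) (Y \<union> Z')"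
  proof
    fix c assume "c \<in> F'"
    then obtain t x where p: "(t, x) \<in> Pr'" and c: "c = C (t, x)"
      by (auto simp: F'_def)
    have UX: "Y \<union> Z' \<subseteq> X"
      using U_X[of q] by (simp add: U_def Z'_def)
    have "sp j (Y \<union> Z) \<subseteq> sp j (Y \<union> Z')"
      by (intro sp_mono_set) (auto simp: Z'_def)
    then have mem: "x \<in> sp j (Y \<union> Z')" "W (t, x) \<in> insert 0 (sp j (Y \<union> Z'))" "b t \<in> sp j (Y \<union> Z')"
      using F_in Pr'(5,8,9)[OF p] sp_base[OF UX, of j] by (auto simp: Z'_def)
    have rel: "1 *s c - comb [(1, W (t, x)), (\<mu>, x), (\<kappa>, b t)] \<in> N"
      using Pr'(7)[OF p] by (simp add: c algebra_simps)
    show "c \<in> sp (Suc j) (Y \<union> Z')"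
      by (rule sp_SucI[OF rel]) (use Pr'(1-6)[OF p] A c mem L_1 nz_1 in auto)
  qed
  moreover have "card Z' \<le> card Z + q"
    unfolding Z'_def using card_Un_le[of Z "b ` {..<q}"] card_image_le[of "{..<q}" b] by simp
  moreover have "Z \<subseteq> Z'" "Z' \<subseteq> A"
    using Z b_A by (auto simp: Z'_def)
  ultimately show ?thesis
    using F'_card by blast
qed

section \<open>Small generating sets\<close>

text \<open>The rounds start from the single element x0. Keeping x0 in \<open>Z\<close> guarantees
  that adding \<open>Z\<close> to \<open>Y\<close> really enlarges it, as the maximality argument in
  \<open>structure_theorem\<close> requires.\<close>

lemma bulk_step:
  fixes \<eta> :: real and q :: nat
  assumes A: "A \<subseteq> X" and Y: "Y \<subseteq> A" and \<eta>: "\<eta> > 0" and x0: "x0 \<in> A - sp (Suc m) Y"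
    and many: "\<And>x. x \<in> A - sp (Suc m) Y \<Longrightarrow> \<eta> * card A \<le> card (bad A Y x - sp m Y)"
    and big: "(q * \<eta> / (4 * card \<Lambda>)) ^ s > card A" and M: "M = m + s + 5"
  shows "\<exists>Z\<subseteq>A. x0 \<in> Z \<and> card Z \<le> 1 + s * q \<and>
    card (A \<inter> sp m Y) + \<eta> * card A / 2 \<le> card (A \<inter> sp M (Y \<union> Z))"
proof (rule ccontr)
  assume "\<not> ?thesis"
  then have small: "card (A \<inter> sp M (Y \<union> Z)) < card (A \<inter> sp m Y) + \<eta> * card A / 2"
    if "Z \<subseteq> A" "x0 \<in> Z" "card Z \<le> 1 + s * q" for Z
    using that not_le by blast
  define \<theta> where "\<theta> = q * \<eta> / (4 * card \<Lambda>)"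
  have "j \<le> s \<Longrightarrow> \<exists>Z F. x0 \<in> Z \<and> Z \<subseteq> A \<and> card Z \<le> 1 + j * q \<and> F \<subseteq> A \<and> F \<inter> sp (Suc m) Y = {} \<and>
    F \<subseteq> sp j (Y \<union> Z) \<and> separated (s - j) Y F \<and> \<theta> ^ j \<le> card F" for j
  proof (induction j)
    case 0
    then show ?case
      using x0 by (intro exI[of _ "{x0}"]) (auto simp: separated_def)
  next
    case (Suc j)
    then obtain Z F where ZF: "x0 \<in> Z" "Z \<subseteq> A" "card Z \<le> 1 + j * q" "F \<subseteq> A" "F \<inter> sp (Suc m) Y = {}"
      "F \<subseteq> sp j (Y \<union> Z)" "separated (s - j) Y F" "\<theta> ^ j \<le> card F"
      by auto
    have "Suc j * q \<le> s * q"
      using Suc.prems by (intro mult_le_mono1)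
    then have small': "card (A \<inter> sp M (Y \<union> Z')) < card (A \<inter> sp m Y) + \<eta> * card A / 2"
      if "Z \<subseteq> Z'" "Z' \<subseteq> A" "card Z' \<le> card Z + q" for Z'
      using that ZF(1,3) by (intro small) auto
    have "\<exists>Z' F'. Z \<subseteq> Z' \<and> Z' \<subseteq> A \<and> card Z' \<le> card Z + q \<and> F' \<subseteq> A \<and> F' \<inter> sp (Suc m) Y = {} \<and>
        F' \<subseteq> sp (Suc j) (Y \<union> Z') \<and> separated (s - Suc j) Y F' \<and> \<theta> * card F \<le> card F'"
      unfolding \<theta>_def
    proof (rule bulk_round[OF A Y ZF(2,4) \<eta> _ ZF(5,6) Suc_le_lessD[OF Suc.prems] ZF(7) M])
    qed (fact many small')+
    then obtain Z' F' where ZF': "Z \<subseteq> Z'" "Z' \<subseteq> A" "card Z' \<le> card Z + q" "F' \<subseteq> A" "F' \<inter> sp (Suc m) Y = {}"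
      "F' \<subseteq> sp (Suc j) (Y \<union> Z')" "separated (s - Suc j) Y F'" "\<theta> * card F \<le> card F'"
      by (elim exE conjE) (rule that)
    have "\<theta> ^ Suc j \<le> \<theta> * card F"
      unfolding power_Suc using ZF(8) \<eta> by (intro mult_left_mono) (auto simp: \<theta>_def)
    with ZF' ZF show ?case
      by (intro exI[of _ Z'] exI[of _ F']) auto
  qed
  then obtain F where "F \<subseteq> A" "\<theta> ^ s \<le> card F"
    by blast
  moreover have "card F \<le> card A" if "F \<subseteq> A"
    using that by (rule card_mono[OF finite_subset[OF A finite_X]])
  ultimately show False
    using big unfolding \<theta>_def by fastforce
qed

text \<open>
  The generating set \<open>Y\<close> has been built by \<open>e\<close> single steps and \<open>\<beta>\<close> bulk steps. A single step that adds \<open>x\<close>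
  puts the pairs \<open>(x, b)\<close> into \<open>PE\<close> for all \<open>b\<close> that are not bad, and into \<open>PV\<close> for all \<open>b\<close> in the span; together
  these are almost \<open>card A\<close> new pairs.
\<close>

definition state ::
    "'v set \<Rightarrow> real \<Rightarrow> nat \<Rightarrow> nat \<Rightarrow> 'v set \<Rightarrow> nat \<Rightarrow> nat \<Rightarrow> ('v \<times> 'v) set \<Rightarrow> ('v \<times> 'v) set \<Rightarrow> bool" where
  "state A \<eta> s q Y e \<beta> PE PV \<longleftrightarrow> Y \<subseteq> A \<and> card Y \<le> e + \<beta> * (1 + s * q) \<and>
     real \<beta> * (\<eta> * real (card A) / 2) \<le> real (card (A \<inter> sp (\<beta> * (s + 5)) Y)) \<and>
     sepd PE \<and> fst ` PE \<subseteq> Y \<and> snd ` PE \<subseteq> A \<and>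
     sepd PV \<and> fst ` PV \<subseteq> Y \<and> snd ` PV \<subseteq> A \<inter> sp (\<beta> * (s + 5)) Y \<and>
     real e * ((1 - \<eta>) * real (card A)) \<le> real (card PE + card PV)"

text \<open>\<open>A\<close> is covered by the elements that are not bad, those in the span, and the
  bad ones outside the span. The last part is small by \<open>few\<close>; the first two are the
  second components of the pairs added to \<open>PE\<close> and \<open>PV\<close>.\<close>

lemma state_extend:
  fixes \<eta> :: real
  assumes A: "A \<subseteq> X" and st: "state A \<eta> s q Y e \<beta> PE PV"
    and x: "x \<in> A" "x \<notin> sp (Suc (\<beta> * (s + 5))) Y"
    and few: "card (bad A Y x - sp (\<beta> * (s + 5)) Y) < \<eta> * card A"
  shows "\<exists>PE' PV'. state A \<eta> s q (insert x Y) (Suc e) \<beta> PE' PV'"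
proof -
  define m where "m = \<beta> * (s + 5)"
  have finA: "finite A"
    by (rule finite_subset[OF A finite_X])
  have YA: "Y \<subseteq> A" and YX: "Y \<subseteq> X"
    using st A by (auto simp: state_def)
  have finY: "finite Y"
    by (rule finite_subset[OF YA finA])
  have xY: "x \<notin> Y"
    using x sp_base[OF YX] by blast
  have sub: "sp m Y \<subseteq> sp m (insert x Y)"
    by (rule sp_mono_set) auto
  define PE' where "PE' = PE \<union> {x} \<times> (A - bad A Y x)"
  define PV' where "PV' = PV \<union> {x} \<times> (A \<inter> sp m Y)"
  have PE: "sepd PE" "fst ` PE \<subseteq> Y" "snd ` PE \<subseteq> A" and PV: "sepd PV" "fst ` PV \<subseteq> Y" "snd ` PV \<subseteq> A \<inter> sp m Y"
    using st unfolding state_def m_def by blast+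
  have PEA: "PE \<subseteq> Y \<times> A"
    using subset_fst_snd[of PE] Sigma_mono[OF PE(2,3)] by (rule order_trans)
  have "snd ` PV \<subseteq> A"
    using PV(3) by simp
  then have PVA: "PV \<subseteq> Y \<times> A"
    using subset_fst_snd[of PV] Sigma_mono[OF PV(2)] by blast
  have fin: "finite PE" "finite PV"
    using finite_subset[OF PEA] finite_subset[OF PVA] finA finY by auto
  have "card PE' = card PE + card (A - bad A Y x)"
    unfolding PE'_def using fin finA PEA xY by (subst card_Un_disjoint) (auto simp: card_cartesian_product)
  moreover have "card PV' = card PV + card (A \<inter> sp m Y)"
    unfolding PV'_def using fin finA PVA xY by (subst card_Un_disjoint) (auto simp: card_cartesian_product)
  moreover have "(1 - \<eta>) * card A \<le> card (A - bad A Y x) + card (A \<inter> sp m Y)"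
  proof -
    have "A \<subseteq> (A - bad A Y x) \<union> ((A \<inter> sp m Y) \<union> (bad A Y x - sp m Y))"
      by auto
    then have "card A \<le> card ((A - bad A Y x) \<union> ((A \<inter> sp m Y) \<union> (bad A Y x - sp m Y)))"
      using finA by (intro card_mono) (auto simp: bad_def)
    also have "\<dots> \<le> card (A - bad A Y x) + (card (A \<inter> sp m Y) + card (bad A Y x - sp m Y))"
      by (intro order_trans[OF card_Un_le] add_left_mono card_Un_le)
    finally show ?thesis
      using few unfolding m_def by (simp add: algebra_simps)
  qed
  ultimately have "Suc e * ((1 - \<eta>) * card A) \<le> card PE' + card PV'"
    using st by (simp add: state_def algebra_simps)
  moreover have "sepd PE'"
    unfolding PE'_def by (rule sepd_extend_good[OF A x(1) PE])
  moreover have "sepd PV'"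
    unfolding PV'_def using x PV by (intro sepd_extend_inner[OF A YA]) (auto simp: m_def)
  moreover have "card (A \<inter> sp m Y) \<le> card (A \<inter> sp m (insert x Y))"
    using sub finA by (intro card_mono) auto
  then have "\<beta> * (\<eta> * card A / 2) \<le> card (A \<inter> sp m (insert x Y))"
    using st unfolding state_def m_def by linarith
  moreover have "card (insert x Y) \<le> Suc e + \<beta> * (1 + s * q)"
    using st finY xY by (simp add: state_def)
  moreover have "fst ` PE' \<subseteq> insert x Y" "snd ` PE' \<subseteq> A" "fst ` PV' \<subseteq> insert x Y"
    "snd ` PV' \<subseteq> A \<inter> sp m (insert x Y)"
    using PEA PV(2,3) sub x(1) by (auto simp: PE'_def PV'_def)
  ultimately have "state A \<eta> s q (insert x Y) (Suc e) \<beta> PE' PV'"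
    unfolding state_def m_def[symmetric] using YA x(1) by (intro conjI insert_subsetI)
  then show ?thesis by blast
qed

text \<open>Take a state with |Y| maximal. If some element of \<open>A\<close> lay outside the span,
  either one such element would have few bad partners and could be added singly, or all would have
  many and a bulk step would enlarge \<open>Y\<close>.\<close>

theorem structure_theorem:
  fixes \<eta> :: real
  assumes A: "A \<subseteq> X" and \<eta>: "\<eta> > 0" and big: "(q * \<eta> / (4 * card \<Lambda>)) ^ s > card A"
  shows "\<exists>Y e \<beta> PE PV. state A \<eta> s q Y e \<beta> PE PV \<and> A \<subseteq> sp (Suc (\<beta> * (s + 5))) Y"
proof -
  have finA: "finite A"
    by (rule finite_subset[OF A finite_X])
  define R where "R = (\<lambda>n. \<exists>Y e \<beta> PE PV. state A \<eta> s q Y e \<beta> PE PV \<and> card Y = n)"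
  have "R 0"
    unfolding R_def by (intro exI[of _ "{}"] exI[of _ 0]) (simp add: state_def)
  moreover have bound: "n \<le> card A" if "R n" for n
    using that finA by (auto simp: R_def state_def intro: card_mono)
  ultimately obtain n where n: "R n" "\<And>n'. R n' \<Longrightarrow> n' \<le> n"
    using Nat.ex_has_greatest_nat[of R 0 "card A"] by blast
  then obtain Y e \<beta> PE PV where st: "state A \<eta> s q Y e \<beta> PE PV" and cY: "card Y = n"
    by (auto simp: R_def)
  define m where "m = \<beta> * (s + 5)"
  have YA: "Y \<subseteq> A" and YX: "Y \<subseteq> X"
    using st A by (auto simp: state_def)
  have finY: "finite Y"
    by (rule finite_subset[OF YA finA])
  have larger: False if "state A \<eta> s q Y' e' \<beta>' PE' PV'" "Y \<subset> Y'" for Y' e' \<beta>' PE' PV'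
  proof -
    have "finite Y'"
      using that finA by (auto simp: state_def intro: finite_subset)
    then have "card Y < card Y'"
      using that by (intro psubset_card_mono)
    then show False
      using n(2)[of "card Y'"] that cY unfolding R_def by fastforce
  qed
  have out: "x \<notin> Y" if "x \<in> A - sp (Suc m) Y" for x
    using that sp_base[OF YX, of "Suc m"] by auto
  have many: "\<eta> * card A \<le> card (bad A Y x - sp m Y)" if x: "x \<in> A - sp (Suc m) Y" for x
  proof (rule ccontr)
    assume "\<not> ?thesis"
    then obtain PE' PV' where "state A \<eta> s q (insert x Y) (Suc e) \<beta> PE' PV'"
      using state_extend[OF A st, of x] x unfolding m_def by auto
    then show False
      using larger out[OF x] by blast
  qed
  have "A \<subseteq> sp (Suc m) Y"
  proof (rule ccontr)
    assume "\<not> ?thesis"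
    then obtain x0 where x0: "x0 \<in> A - sp (Suc m) Y" by blast
    define M where "M = m + s + 5"
    obtain Z where Z: "Z \<subseteq> A" "x0 \<in> Z" "card Z \<le> 1 + s * q"
      "card (A \<inter> sp m Y) + \<eta> * card A / 2 \<le> card (A \<inter> sp M (Y \<union> Z))"
      using bulk_step[OF A YA \<eta> x0 many big M_def] by auto
    have M: "M = Suc \<beta> * (s + 5)"
      by (simp add: M_def m_def)
    have "sp m Y \<subseteq> sp M (Y \<union> Z)"
      using A YA Z by (intro sp_mono) (auto simp: M_def)
    moreover have "card (Y \<union> Z) \<le> e + Suc \<beta> * (1 + s * q)"
      using card_Un_le[of Y Z] Z(3) st by (simp add: state_def)
    moreover have "Suc \<beta> * (\<eta> * card A / 2) \<le> card (A \<inter> sp M (Y \<union> Z))"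
      using st Z(4) unfolding state_def m_def by (simp add: algebra_simps)
    ultimately have "state A \<eta> s q (Y \<union> Z) e (Suc \<beta>) PE PV"
      using st Z(1) unfolding state_def M[symmetric] m_def[symmetric] by (intro conjI) auto
    then show False
      using larger out[OF x0] Z(2) by blast
  qed
  then show ?thesis
    using st unfolding m_def by blast
qed


text \<open>The quantity b of the overview.\<close>

definition maxsep :: "'v set \<Rightarrow> nat" where
  "maxsep A = Max (card ` {P. P \<subseteq> A \<times> A \<and> sepd P})"

lemma maxsep_ge:
  assumes "A \<subseteq> X" "P \<subseteq> A \<times> A" "sepd P"
  shows "card P \<le> maxsep A"
proof -
  have "finite A"
    by (rule finite_subset[OF assms(1) finite_X])
  then have "finite {P. P \<subseteq> A \<times> A \<and> sepd P}"
    by (auto intro: rev_finite_subset[of "Pow (A \<times> A)"])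
  then show ?thesis
    unfolding maxsep_def using assms by (intro Max_ge) auto
qed

lemma maxsep_witness:
  assumes "A \<subseteq> X"
  obtains P where "P \<subseteq> A \<times> A" "sepd P" "card P = maxsep A"
proof -
  have "finite A"
    by (rule finite_subset[OF assms(1) finite_X])
  then have "finite {P. P \<subseteq> A \<times> A \<and> sepd P}"
    by (auto intro: rev_finite_subset[of "Pow (A \<times> A)"])
  moreover have "{} \<in> {P. P \<subseteq> A \<times> A \<and> sepd P}"
    by simp
  ultimately have "maxsep A \<in> card ` {P. P \<subseteq> A \<times> A \<and> sepd P}"
    unfolding maxsep_def by (intro Max_in) auto
  then show thesis
    using that by auto
qed

text \<open>The larger of \<open>PE\<close> and \<open>PV\<close> holds at least half of the pairs;
  this loss of a factor 2 is the source of the 2 in the clique bound. Every bulk step secures a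
  further share \<eta> / 2 of \<open>A\<close>, so there are at most 2 / \<eta> of them.\<close>

lemma small_generating_set:
  fixes \<eta> :: real and q s :: nat
  assumes A: "A \<subseteq> X" and k: "card A > 0" and \<eta>: "\<eta> > 0" "\<eta> < 1"
    and big: "(q * \<eta> / (4 * card \<Lambda>)) ^ s > card A"
    and M: "M = Suc (nat \<lfloor>2 / \<eta>\<rfloor> * (s + 5))"
  obtains Y where "Y \<subseteq> A" "A \<subseteq> sp M Y"
    "(1 - \<eta>) * card A / 2 * (card Y - 2 / \<eta> * (1 + s * q)) \<le> maxsep A"
proof -
  obtain Y e \<beta> PE PV where st: "state A \<eta> s q Y e \<beta> PE PV" and sub: "A \<subseteq> sp (Suc (\<beta> * (s + 5))) Y"
    using structure_theorem[OF A \<eta>(1) big] by (elim exE conjE) (rule that)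
  have finA: "finite A"
    by (rule finite_subset[OF A finite_X])
  have YA: "Y \<subseteq> A"
    using st unfolding state_def by (elim conjE)
  have YX: "Y \<subseteq> X"
    using YA A by auto
  have st': "fst ` PE \<subseteq> Y" "snd ` PE \<subseteq> A" "fst ` PV \<subseteq> Y" "snd ` PV \<subseteq> A \<inter> sp (\<beta> * (s + 5)) Y"
    "sepd PE" "sepd PV" "card Y \<le> e + \<beta> * (1 + s * q)"
    "real \<beta> * (\<eta> * real (card A) / 2) \<le> real (card (A \<inter> sp (\<beta> * (s + 5)) Y))"
    "real e * ((1 - \<eta>) * real (card A)) \<le> real (card PE + card PV)"
    using st by (simp_all add: state_def)
  have PE: "PE \<subseteq> A \<times> A"
    by (rule order_trans[OF subset_fst_snd Sigma_mono[OF order_trans[OF st'(1) YA] st'(2)]])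
  have PV: "PV \<subseteq> A \<times> A"
    by (rule order_trans[OF subset_fst_snd Sigma_mono[OF order_trans[OF st'(3) YA] order_trans[OF st'(4) Int_lower1]]])
  have "real \<beta> * (\<eta> * card A / 2) \<le> card (A \<inter> sp (\<beta> * (s + 5)) Y)"
    by (rule st'(8))
  also have "\<dots> \<le> card A"
    using finA by (intro of_nat_mono card_mono) auto
  finally have "real \<beta> \<le> 2 / \<eta>"
    using k \<eta> by (simp add: field_simps)
  then have \<beta>: "\<beta> \<le> nat \<lfloor>2 / \<eta>\<rfloor>"
    by linarith
  have "Suc (\<beta> * (s + 5)) \<le> M"
    unfolding M using \<beta> by (intro Suc_le_mono[THEN iffD2] mult_le_mono1)
  then have sub': "A \<subseteq> sp M Y"
    using sub sp_mono_level[OF YX] by blast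
  have "real (card Y) \<le> real (e + \<beta> * (1 + s * q))"
    by (rule of_nat_mono[OF st'(7)])
  also have "\<dots> = e + \<beta> * (1 + real s * q)"
    by (simp add: algebra_simps)
  also have "\<dots> \<le> e + 2 / \<eta> * (1 + real s * q)"
    using \<open>real \<beta> \<le> 2 / \<eta>\<close> by (intro add_left_mono mult_right_mono) auto
  finally have "card Y - 2 / \<eta> * (1 + real s * q) \<le> e"
    by simp
  then have "(1 - \<eta>) * card A / 2 * (card Y - 2 / \<eta> * (1 + real s * q)) \<le> (1 - \<eta>) * card A / 2 * e"
    using \<eta> by (intro mult_left_mono) auto
  also have "\<dots> = e * ((1 - \<eta>) * card A) / 2"
    by simp
  also have "e * ((1 - \<eta>) * card A) \<le> card PE + card PV"
    by (rule st'(9))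
  also have "card PE + card PV \<le> 2 * maxsep A"
    using maxsep_ge[OF A PE st'(5)] maxsep_ge[OF A PV st'(6)] by simp
  finally have "(1 - \<eta>) * card A / 2 * (card Y - 2 / \<eta> * (1 + s * q)) \<le> maxsep A"
    by simp
  then show thesis
    by (rule that[OF YA sub'])
qed

text \<open>The sets are grouped by the size R of a generating set, which can be chosen in at most
  |X| ^ R ways; a set inside the span then has at most W ^ k choices. The equation for \<eta> makes
  (1 - \<eta>) times the coefficient (1 - \<eta>) k / 2 equal to k / (2 + \<epsilon>), so the powers
  of r that depend on R cancel.\<close>

lemma sum_maxsep_bound:
  fixes \<eta> \<epsilon> r b :: real and q s k :: nat
  assumes r: "r > 1" and \<epsilon>: "\<epsilon> > 0" and \<eta>: "\<eta> > 0" "\<eta> < 1" "(1 - \<eta>)\<^sup>2 = 2 / (2 + \<epsilon>)" and k: "k > 0"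
    and big: "(q * \<eta> / (4 * card \<Lambda>)) ^ s > k"
    and M: "M = Suc (nat \<lfloor>2 / \<eta>\<rfloor> * (s + 5))"
    and N: "card X \<le> r powr (k / (2 + \<epsilon>))"
    and K: "\<K> \<subseteq> {A. A \<subseteq> X \<and> card A = k}" "\<And>A. A \<in> \<K> \<Longrightarrow> b \<le> maxsep A"
  shows "(\<Sum>A\<in>\<K>. r powr (- real (maxsep A))) \<le>
    (k + 1) * ((8 * card L ^ 7 * (k + 1)) ^ (7 ^ M)) ^ k * r powr (2 / \<eta> * (1 + s * q) * (k / (2 + \<epsilon>)) - \<eta> * b)"
proof -
  define \<kappa> where "\<kappa> = 2 / \<eta> * (1 + real s * q)"
  define W where "W = (8 * card L ^ 7 * (k + 1)) ^ (7 ^ M)"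
  define T where "T = r powr (\<kappa> * (k / (2 + \<epsilon>)) - \<eta> * b)"
  define KR where "KR = (\<lambda>R. {A \<in> \<K>. \<exists>Y\<subseteq>X. card Y = R \<and> A \<subseteq> sp M Y \<and> (1 - \<eta>) * k / 2 * (R - \<kappa>) \<le> maxsep A})"
  have finK: "finite \<K>"
    by (rule finite_subset[OF K(1)]) (use finite_X in auto)
  have KR_card: "card (KR R) \<le> card X ^ R * W ^ k" if R: "R \<le> k" for R
  proof -
    define YS where "YS = {Y. Y \<subseteq> X \<and> card Y = R}"
    have finYS: "finite YS"
      using finite_X by (simp add: YS_def)
    have finS: "finite {A. A \<subseteq> sp M Y \<and> card A = k}" if "Y \<in> YS" for Y
      using that finite_sp[of Y M] by (auto simp: YS_def)
    have "KR R \<subseteq> (\<Union>Y\<in>YS. {A. A \<subseteq> sp M Y \<and> card A = k})"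
      using K(1) by (auto simp: KR_def YS_def)
    then have "card (KR R) \<le> card (\<Union>Y\<in>YS. {A. A \<subseteq> sp M Y \<and> card A = k})"
      using finYS finS by (intro card_mono) auto
    also have "\<dots> \<le> (\<Sum>Y\<in>YS. card {A. A \<subseteq> sp M Y \<and> card A = k})"
      by (rule card_UN_le[OF finYS])
    also have "\<dots> \<le> (\<Sum>Y\<in>YS. W ^ k)"
    proof (rule sum_mono)
      fix Y assume Y: "Y \<in> YS"
      then have YX: "Y \<subseteq> X" and cY: "card Y = R"
        by (auto simp: YS_def)
      have "card (sp M Y) \<le> (8 * card L ^ 7 * (R + 1)) ^ (7 ^ M)"
        using card_sp[OF YX, of M] cY by simp
      also have "\<dots> \<le> W"
        unfolding W_def using R by (intro power_mono mult_le_mono2) auto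
      finally have "card (sp M Y) ^ k \<le> W ^ k"
        by (rule power_mono) simp
      then show "card {A. A \<subseteq> sp M Y \<and> card A = k} \<le> W ^ k"
        using card_subsets_le_power[OF finite_sp[OF YX], of M k] by linarith
    qed
    also have "\<dots> = card YS * W ^ k"
      by simp
    also have "\<dots> \<le> card X ^ R * W ^ k"
      unfolding YS_def by (intro mult_le_mono1 card_subsets_le_power finite_X)
    finally show ?thesis .
  qed
  have half: "(1 - \<eta>) * ((1 - \<eta>) * k / 2) = k / (2 + \<epsilon>)"
  proof -
    have "(1 - \<eta>) * ((1 - \<eta>) * k / 2) = (1 - \<eta>)\<^sup>2 * (k / 2)"
      by (simp add: power2_eq_square)
    also have "\<dots> = k / (2 + \<epsilon>)"
      unfolding \<eta>(3) using \<epsilon> by (simp add: field_simps)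
    finally show ?thesis .
  qed
  have KR_sum: "(\<Sum>A\<in>KR R. r powr (- real (maxsep A))) \<le> W ^ k * T" if R: "R \<le> k" for R
  proof -
    \<comment> \<open>A convex combination of the two lower bounds for \<open>maxsep A\<close>, with
      weights 1 - \<eta> for the one by R and \<eta> for \<open>b\<close>.\<close>
    define \<rho> where "\<rho> = (k / (2 + \<epsilon>)) * (R - \<kappa>) + \<eta> * b"
    have "r powr (- real (maxsep A)) \<le> r powr (- \<rho>)" if A: "A \<in> KR R" for A
    proof -
      have "(1 - \<eta>) * ((1 - \<eta>) * k / 2 * (R - \<kappa>)) + \<eta> * b \<le> (1 - \<eta>) * maxsep A + \<eta> * maxsep A"
        using A K(2)[of A] \<eta> by (intro add_mono mult_left_mono) (auto simp: KR_def)
      then have "\<rho> \<le> maxsep A"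
        unfolding \<rho>_def half[symmetric] by (simp add: algebra_simps)
      then show ?thesis
        using r by simp
    qed
    then have "(\<Sum>A\<in>KR R. r powr (- real (maxsep A))) \<le> (\<Sum>A\<in>KR R. r powr (- \<rho>))"
      by (rule sum_mono)
    also have "\<dots> = card (KR R) * r powr (- \<rho>)"
      by simp
    also have "\<dots> \<le> (real (card X) ^ R * real W ^ k) * r powr (- \<rho>)"
      using KR_card[OF R] by (intro mult_right_mono) (auto simp flip: of_nat_power of_nat_mult)
    also have "\<dots> \<le> ((r powr (k / (2 + \<epsilon>))) ^ R * real W ^ k) * r powr (- \<rho>)"
      using N by (intro mult_right_mono power_mono) auto
    also have "(r powr (k / (2 + \<epsilon>))) ^ R = r powr (k / (2 + \<epsilon>) * R)"
      using r by (simp add: powr_powr flip: powr_realpow)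
    also have "r powr (k / (2 + \<epsilon>) * R) * real W ^ k * r powr (- \<rho>) = W ^ k * (r powr (k / (2 + \<epsilon>) * R) * r powr (- \<rho>))"
      by simp
    also have "r powr (k / (2 + \<epsilon>) * R) * r powr (- \<rho>) = r powr (k / (2 + \<epsilon>) * R + - \<rho>)"
      by (rule powr_add[symmetric])
    also have "k / (2 + \<epsilon>) * R + - \<rho> = \<kappa> * (k / (2 + \<epsilon>)) - \<eta> * b"
      by (simp add: \<rho>_def algebra_simps diff_divide_distrib)
    finally show ?thesis
      by (simp add: T_def)
  qed
  have cover: "\<K> \<subseteq> (\<Union>R\<in>{..k}. KR R)"
  proof
    fix A assume A: "A \<in> \<K>"
    then have AX: "A \<subseteq> X" and cA: "card A = k"
      using K(1) by auto
    have bigA: "(q * \<eta> / (4 * card \<Lambda>)) ^ s > card A" and posA: "card A > 0"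
      using big k cA by auto
    obtain Y where Y: "Y \<subseteq> A" "A \<subseteq> sp M Y" "(1 - \<eta>) * card A / 2 * (card Y - 2 / \<eta> * (1 + s * q)) \<le> maxsep A"
      by (rule small_generating_set[OF AX posA \<eta>(1,2) bigA M])
    have "card Y \<le> card A"
      by (rule card_mono[OF finite_subset[OF AX finite_X] Y(1)])
    moreover have "A \<in> KR (card Y)"
      unfolding KR_def using A Y AX cA by (auto simp: \<kappa>_def intro!: exI[of _ Y])
    ultimately show "A \<in> (\<Union>R\<in>{..k}. KR R)"
      using cA by auto
  qed
  have "(\<Sum>A\<in>\<K>. r powr (- real (maxsep A))) \<le> (\<Sum>A\<in>(\<Union>R\<in>{..k}. KR R). r powr (- real (maxsep A)))"
    using cover finK by (intro sum_mono2) (auto simp: KR_def)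
  also have "\<dots> \<le> (\<Sum>R\<in>{..k}. \<Sum>A\<in>KR R. r powr (- real (maxsep A)))"
    using finK by (intro sum_UNION_le) (auto simp: KR_def)
  also have "\<dots> \<le> (\<Sum>R\<in>{..k}. W ^ k * T)"
    by (intro sum_mono KR_sum) auto
  also have "\<dots> = (k + 1) * W ^ k * T"
    by (simp add: algebra_simps)
  finally show ?thesis
    unfolding W_def T_def \<kappa>_def by simp
qed


text \<open>Let \<open>P\<close> be a largest separated set. A nonzero difference that is no
  \<Lambda>-multiple of a difference from \<open>P\<close> could be added to it; so every class is
  zero or one of the |\<Lambda>| |P| multiples.\<close>

lemma diff_classes_le:
  assumes A: "A \<subseteq> X" and one: "1 \<in> \<Lambda>"
    and g: "\<And>y b. g y b \<in> X" "\<And>y b. y - b - g y b \<in> N"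
  shows "card ((\<lambda>(y, b). g y b) ` (A \<times> A)) \<le> 1 + card \<Lambda> * maxsep A"
proof -
  obtain P where P: "P \<subseteq> A \<times> A" "sepd P" "card P = maxsep A"
    by (rule maxsep_witness[OF A])
  have finA: "finite A"
    by (rule finite_subset[OF A finite_X])
  have finP: "finite P"
    using P(1) finA by (auto intro: finite_subset)
  define h where "h = (\<lambda>((y, b), \<kappa>). SOME x. x \<in> X \<and> \<kappa> *s (y - b) - x \<in> N)"
  have h: "h ((y, b), \<kappa>) \<in> X" "\<kappa> *s (y - b) - h ((y, b), \<kappa>) \<in> N" for y b \<kappa>
    using someI_ex[of "\<lambda>x. x \<in> X \<and> \<kappa> *s (y - b) - x \<in> N"] X_rep[of "\<kappa> *s (y - b)"]
    unfolding h_def prod.case by blast+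
  have ex: "\<exists>y' b' \<kappa>. (y', b') \<in> P \<and> \<kappa> \<in> \<Lambda> \<and> \<kappa> *s (y' - b') - (y - b) \<in> N"
    if yb: "y \<in> A" "b \<in> A" "y \<noteq> b" for y b
  proof (rule ccontr)
    assume *: "\<not> ?thesis"
    have "(y, b) \<notin> P"
      using * one by fastforce
    have "sepd (P \<union> {y} \<times> {b})"
    proof (rule sepd_extend[OF P(2)])
      show "\<kappa> *s (y - b1) - (y - b2) \<notin> N" if k: "b1 \<in> {b}" "b2 \<in> {b}" "\<kappa> \<in> \<Lambda>" "\<kappa> \<noteq> 1" for b1 b2 \<kappa>
      proof
        assume "\<kappa> *s (y - b1) - (y - b2) \<in> N"
        then have "- (\<kappa> *s (y - b) - (y - b)) \<in> N"
          using k by (intro N_uminus) auto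
        then have "(1 - \<kappa>) *s (y - b) \<in> N"
          by (simp add: algebra_simps)
        then have "y - b \<in> N"
          by (rule nz_cancel[OF Lam_diff_nz[OF k(3,4)]])
        then show False
          using X_inj[of y b] yb A by auto
      qed
      show "\<kappa> *s (y - b1) - (y' - b') \<notin> N" if k: "b1 \<in> {b}" "(y', b') \<in> P" "\<kappa> \<in> \<Lambda>" for b1 y' b' \<kappa>
        using Lam_swap[OF k(3), of "y - b" "y' - b'"] k * by blast
    qed (use yb A in auto)
    then have "card (P \<union> {y} \<times> {b}) \<le> maxsep A"
      using P(1) yb by (intro maxsep_ge[OF A]) auto
    then show False
      using \<open>(y, b) \<notin> P\<close> finP P(3) by simp
  qed
  obtain z where z: "z \<in> X" "0 - z \<in> N"
    using X_rep[of 0] by blast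
  have "(\<lambda>(y, b). g y b) ` (A \<times> A) \<subseteq> insert z (h ` (P \<times> \<Lambda>))"
  proof clarify
    fix y b assume yb: "y \<in> A" "b \<in> A" "g y b \<notin> h ` (P \<times> \<Lambda>)"
    show "g y b = z"
    proof (cases "y = b")
      case True
      have "(0 - z) - (y - b - g y b) \<in> N"
        by (rule N_diff[OF z(2) g(2)])
      then show ?thesis
        using True X_inj[OF g(1) z(1)] by simp
    next
      case False
      then obtain y' b' \<kappa> where k: "(y', b') \<in> P" "\<kappa> \<in> \<Lambda>" "\<kappa> *s (y' - b') - (y - b) \<in> N"
        using ex[OF yb(1,2)] by blast
      have "(\<kappa> *s (y' - b') - h ((y', b'), \<kappa>)) - (\<kappa> *s (y' - b') - (y - b)) - (y - b - g y b) \<in> N"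
        by (intro N_diff h(2) k(3) g(2))
      then have "g y b = h ((y', b'), \<kappa>)"
        using X_inj[OF g(1) h(1)] by simp
      then show ?thesis
        using yb(3) k by blast
    qed
  qed
  then have "card ((\<lambda>(y, b). g y b) ` (A \<times> A)) \<le> card (insert z (h ` (P \<times> \<Lambda>)))"
    using finP Lam_finite by (intro card_mono) auto
  also have "\<dots> \<le> Suc (card (h ` (P \<times> \<Lambda>)))"
    using finP Lam_finite by (intro card_insert_le_m1) auto
  also have "card (h ` (P \<times> \<Lambda>)) \<le> card (P \<times> \<Lambda>)"
    using finP Lam_finite by (intro card_image_le) auto
  finally show ?thesis
    by (simp add: card_cartesian_product P(3) mult.commute)
qed

end

section \<open>Difference sets without doubling chains\<close>

context comm_group
begin

lemma finite_set_mult: "finite H \<Longrightarrow> finite K \<Longrightarrow> finite (H <#> K)"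
  by (simp add: set_mult_def)

text \<open>Induction on \<open>C\<close>. With a new element c, the product X C gains exactly |X| -
  |W| elements, while X B C gains at most |X B| - |Z B|, because the translates of Z B by c are
  already present. Commutativity gives W \<subseteq> Z, and minimality of the growth of
  \<open>X\<close>, applied to \<open>Z\<close>, compares the two gains.\<close>

lemma petridis:
  assumes fin: "finite X" "finite B" "finite C" and car: "X \<subseteq> carrier G" "B \<subseteq> carrier G" "C \<subseteq> carrier G"
    and min: "\<And>Z. Z \<subseteq> X \<Longrightarrow> card (X <#> B) * card Z \<le> card (Z <#> B) * card X"
  shows "card (X <#> B <#> C) * card X \<le> card (X <#> B) * card (X <#> C)"
  using fin(3) car(3)
proof (induction C rule: finite_induct)
  case empty
  then show ?case by (simp add: set_mult_def)
next
  case (insert c C)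
  define XB where "XB = X <#> B"
  have c: "c \<in> carrier G" and C: "C \<subseteq> carrier G" "finite C"
    using insert by auto
  have XBc: "XB \<subseteq> carrier G"
    unfolding XB_def using car by (intro set_mult_closed) auto
  have finXB: "finite XB" and finXC: "finite (X <#> C)" and finXBC: "finite (XB <#> C)"
    unfolding XB_def using fin C by (auto intro: finite_set_mult)
  define Z where "Z = {x \<in> X. \<forall>b\<in>B. x \<otimes> b \<otimes> c \<in> XB <#> C}"
  define W where "W = {x \<in> X. x \<otimes> c \<in> X <#> C}"
  have ZX: "Z \<subseteq> X" and WX: "W \<subseteq> X"
    by (auto simp: Z_def W_def)
  have inj: "inj_on (\<lambda>t. t \<otimes> c) T" if "T \<subseteq> carrier G" for T
    using that c by (intro inj_onI) (simp add: subset_iff)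
  have WZ: "W \<subseteq> Z"
  proof
    fix x assume x: "x \<in> W"
    then obtain x' c' where x': "x' \<in> X" "c' \<in> C" "x \<otimes> c = x' \<otimes> c'"
      by (auto simp: W_def set_mult_def)
    have "x \<otimes> b \<otimes> c \<in> XB <#> C" if b: "b \<in> B" for b
    proof -
      have car': "x \<in> carrier G" "x' \<in> carrier G" "c' \<in> carrier G" "b \<in> carrier G"
        using x x' b WX car C by auto
      have "x \<otimes> b \<otimes> c = (x \<otimes> c) \<otimes> b"
        using car' c by (simp add: m_ac)
      also have "\<dots> = (x' \<otimes> b) \<otimes> c'"
        unfolding x'(3) using car' by (simp add: m_ac)
      finally show ?thesis
        using x' b by (auto simp: XB_def set_mult_def)
    qed
    then show "x \<in> Z"
      using x WX by (auto simp: Z_def)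
  qed
  have ZB: "Z <#> B \<subseteq> XB"
    using ZX by (auto simp: XB_def set_mult_def)
  have "XB <#> insert c C \<subseteq> (XB <#> C) \<union> (\<lambda>t. t \<otimes> c) ` (XB - (Z <#> B))"
  proof
    fix t assume "t \<in> XB <#> insert c C"
    then obtain y c' where y: "y \<in> XB" "c' \<in> insert c C" "t = y \<otimes> c'"
      by (auto simp: set_mult_def)
    show "t \<in> (XB <#> C) \<union> (\<lambda>t. t \<otimes> c) ` (XB - (Z <#> B))"
    proof (cases "c' \<in> C")
      case True
      then show ?thesis
        using y by (auto simp: set_mult_def)
    next
      case False
      then have t: "t = y \<otimes> c"
        using y by auto
      show ?thesis
      proof (cases "y \<in> Z <#> B")
        case True
        then obtain z b where "z \<in> Z" "b \<in> B" "y = z \<otimes> b"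
          by (auto simp: set_mult_def)
        then show ?thesis
          using t by (simp add: Z_def)
      qed (use y t in blast)
    qed
  qed
  then have "card (XB <#> insert c C) \<le> card ((XB <#> C) \<union> (\<lambda>t. t \<otimes> c) ` (XB - (Z <#> B)))"
    using finXB finXBC by (intro card_mono) auto
  also have "\<dots> \<le> card (XB <#> C) + card (XB - (Z <#> B))"
    using card_image_le[of "XB - (Z <#> B)" "\<lambda>t. t \<otimes> c"] finXB
    by (intro order_trans[OF card_Un_le] add_left_mono) auto
  finally have 1: "card (XB <#> insert c C) + card (Z <#> B) \<le> card (XB <#> C) + card XB"
    using card_Diff_subset[OF finite_subset[OF ZB finXB] ZB] card_mono[OF finXB ZB] by linarith
  have "X <#> insert c C = (X <#> C) \<union> (\<lambda>t. t \<otimes> c) ` (X - W)"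
    by (auto simp: set_mult_def W_def)
  moreover have "(X <#> C) \<inter> (\<lambda>t. t \<otimes> c) ` (X - W) = {}"
    by (auto simp: W_def)
  ultimately have "card (X <#> insert c C) = card (X <#> C) + card ((\<lambda>t. t \<otimes> c) ` (X - W))"
    using finXC fin by (simp add: card_Un_disjoint)
  also have "card ((\<lambda>t. t \<otimes> c) ` (X - W)) = card (X - W)"
    by (intro card_image inj) (use car in auto)
  finally have 2: "card (X <#> insert c C) + card W = card (X <#> C) + card X"
    using card_Diff_subset[OF finite_subset[OF WX fin(1)] WX] card_mono[OF fin(1) WX] by linarith
  have "card (XB <#> insert c C) * card X + card (Z <#> B) * card X \<le> card (XB <#> C) * card X + card XB * card X"
    using mult_le_mono1[OF 1, of "card X"] by (simp add: algebra_simps)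
  also have "\<dots> \<le> card XB * card (X <#> C) + card XB * card X"
    using insert.IH C by (simp add: XB_def)
  also have "\<dots> = card XB * card (X <#> insert c C) + card XB * card W"
    using arg_cong[OF 2, of "\<lambda>n. card XB * n"] by (simp add: algebra_simps)
  also have "\<dots> \<le> card XB * card (X <#> insert c C) + card XB * card Z"
    using card_mono[OF finite_subset[OF ZX fin(1)] WZ] by simp
  also have "\<dots> \<le> card XB * card (X <#> insert c C) + card (Z <#> B) * card X"
    using min[OF ZX] by (simp add: XB_def)
  finally show ?case
    by (simp add: XB_def)
qed

text \<open>\<open>X\<close> minimises the ratio |X B| / |X| over the nonempty subsets of
  \<open>A\<close>; the inequalities are stated without denominators so that they include the empty
  set.\<close>

lemma exists_min_growth:
  assumes "finite A" "A \<noteq> {}"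
  obtains X where "X \<subseteq> A" "X \<noteq> {}" "card (X <#> B) * card A \<le> card (A <#> B) * card X"
    "\<And>Z. Z \<subseteq> X \<Longrightarrow> card (X <#> B) * card Z \<le> card (Z <#> B) * card X"
proof -
  define f where "f = (\<lambda>X. real (card (X <#> B)) / card X)"
  define S where "S = {X. X \<subseteq> A \<and> X \<noteq> {}}"
  have "finite S" "S \<noteq> {}"
    using assms by (auto simp: S_def)
  then obtain X where X: "X \<in> S" and le: "\<And>Z. Z \<in> S \<Longrightarrow> f X \<le> f Z"
    by (meson arg_min_least arg_min_if_finite(1))
  have pos: "card Z > 0" if "Z \<in> S" for Z
    using that assms by (auto simp: S_def card_gt_0_iff intro: finite_subset)
  have main: "card (X <#> B) * card Z \<le> card (Z <#> B) * card X" if Z: "Z \<in> S" for Z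
  proof -
    have "real (card (X <#> B)) * card Z \<le> real (card (Z <#> B)) * card X"
      using le[OF Z] pos[OF Z] pos[OF X] by (simp add: f_def field_simps)
    then show ?thesis
      by (metis of_nat_le_iff of_nat_mult)
  qed
  show thesis
  proof (rule that)
    show "X \<subseteq> A" "X \<noteq> {}"
      using X by (auto simp: S_def)
    show "card (X <#> B) * card A \<le> card (A <#> B) * card X"
      using assms by (intro main) (auto simp: S_def)
    show "card (X <#> B) * card Z \<le> card (Z <#> B) * card X" if "Z \<subseteq> X" for Z
      using that X main[of Z] by (cases "Z = {}") (auto simp: S_def)
  qed
qed

definition diffs :: "'a set \<Rightarrow> 'a set" where
  "diffs A = {a \<otimes> inv b | a b. a \<in> A \<and> b \<in> A}"

lemma square_quotient:
  assumes "a \<in> carrier G" "a' \<in> carrier G" "c \<in> carrier G" "c' \<in> carrier G"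
    and "c \<otimes> inv a \<otimes> inv a = c' \<otimes> inv a' \<otimes> inv a'"
  shows "c \<otimes> inv c' = (a \<otimes> inv a') \<otimes> (a \<otimes> inv a')"
proof -
  have "c \<otimes> inv a \<otimes> inv a \<otimes> (a \<otimes> a) = c \<otimes> ((inv a \<otimes> a) \<otimes> (inv a \<otimes> a))"
    using assms(1-4) by (simp only: m_ac inv_closed m_closed)
  then have "c = c \<otimes> inv a \<otimes> inv a \<otimes> (a \<otimes> a)"
    using assms(1-4) by simp
  also have "\<dots> = c' \<otimes> inv a' \<otimes> inv a' \<otimes> (a \<otimes> a)"
    by (simp only: assms(5))
  finally have "c \<otimes> inv c' = c' \<otimes> inv a' \<otimes> inv a' \<otimes> (a \<otimes> a) \<otimes> inv c'"
    by simp
  also have "\<dots> = (a \<otimes> inv a') \<otimes> (a \<otimes> inv a') \<otimes> (c' \<otimes> inv c')"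
    using assms(1-4) by (simp only: m_ac inv_closed m_closed)
  finally show ?thesis
    using assms(1-4) by simp
qed

text \<open>
  The map $(a, c, e, g) \mapsto (c - 2a, e - 2c, g - 2e)$ is injective on \<open>A \<times> X\<^sup>3\<close>, where \<open>X\<close> is the subset of
  \<open>A\<close> from the Pluennecke--Petridis argument.
\<close>

lemma diffs_large:
  assumes A: "finite A" "A \<subseteq> carrier G"
    and free: "\<And>u. u \<in> carrier G \<Longrightarrow> u \<noteq> \<one> \<Longrightarrow> u \<in> diffs A \<Longrightarrow> u \<otimes> u \<in> diffs A \<Longrightarrow>
      (u \<otimes> u) \<otimes> (u \<otimes> u) \<in> diffs A \<Longrightarrow>
      ((u \<otimes> u) \<otimes> (u \<otimes> u)) \<otimes> ((u \<otimes> u) \<otimes> (u \<otimes> u)) \<in> diffs A \<Longrightarrow> False"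
  shows "card A ^ 7 \<le> card (diffs A) ^ 6"
proof (cases "A = {}")
  case False
  define B where "B = (\<lambda>a. inv a) ` A"
  have B: "finite B" "B \<subseteq> carrier G"
    using A by (auto simp: B_def)
  have AB: "A <#> B = diffs A"
    by (auto simp: set_mult_def diffs_def B_def)
  obtain X where X: "X \<subseteq> A" "X \<noteq> {}" "card (X <#> B) * card A \<le> card (A <#> B) * card X"
    and min: "\<And>Z. Z \<subseteq> X \<Longrightarrow> card (X <#> B) * card Z \<le> card (Z <#> B) * card X"
    using exists_min_growth[OF A(1) False] by metis
  have finX: "finite X" and Xc: "X \<subseteq> carrier G"
    using X A finite_subset by auto
  define E where "E = X <#> B <#> B"
  have finE: "finite E"
    unfolding E_def using finX B by (intro finite_set_mult)
  have pet: "card E * card X \<le> card (X <#> B) * card (X <#> B)"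
    unfolding E_def by (rule petridis[OF finX B(1) B(1) Xc B(2) B(2) min])
  define h where "h = (\<lambda>c a. c \<otimes> inv a \<otimes> inv a)"
  have h_E: "h c a \<in> E" if "c \<in> X" "a \<in> A" for c a
    using that by (auto simp: h_def E_def B_def set_mult_def)
  define f where "f = (\<lambda>(a, c, e, g). (h c a, h e c, h g e))"
  have "inj_on f (A \<times> X \<times> X \<times> X)"
  proof (rule inj_onI)
    fix s s' assume s: "s \<in> A \<times> X \<times> X \<times> X" "s' \<in> A \<times> X \<times> X \<times> X" "f s = f s'"
    obtain a c e g where s1: "s = (a, c, e, g)"
      by (cases s)
    obtain a' c' e' g' where s2: "s' = (a', c', e', g')"
      by (cases s')
    have mem: "a \<in> A" "c \<in> X" "e \<in> X" "g \<in> X" "a' \<in> A" "c' \<in> X" "e' \<in> X" "g' \<in> X"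
      and eq: "f (a, c, e, g) = f (a', c', e', g')"
      using s by (auto simp: s1 s2)
    have car: "a \<in> carrier G" "c \<in> carrier G" "e \<in> carrier G" "g \<in> carrier G"
      "a' \<in> carrier G" "c' \<in> carrier G" "e' \<in> carrier G" "g' \<in> carrier G"
      using mem X A by auto
    \<comment> \<open>In additive notation a - a', c - c', e - e', g - g' are u, 2u, 4u, 8u. All
      four lie in \<open>diffs A\<close>, so \<open>free\<close> forces u to be trivial.\<close>
    define u where "u = a \<otimes> inv a'"
    have u: "u \<in> carrier G"
      using car by (simp add: u_def)
    have c: "c \<otimes> inv c' = u \<otimes> u"
      using square_quotient[of a a' c c'] car eq by (simp add: f_def h_def u_def)
    have e: "e \<otimes> inv e' = (u \<otimes> u) \<otimes> (u \<otimes> u)"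
      using square_quotient[of c c' e e'] car eq by (simp add: f_def h_def c)
    have g: "g \<otimes> inv g' = ((u \<otimes> u) \<otimes> (u \<otimes> u)) \<otimes> ((u \<otimes> u) \<otimes> (u \<otimes> u))"
      using square_quotient[of e e' g g'] car eq by (simp add: f_def h_def e)
    have dI: "x \<otimes> inv y \<in> diffs A" if "x \<in> A" "y \<in> A" for x y
      using that by (auto simp: diffs_def)
    have "u \<in> diffs A" "u \<otimes> u \<in> diffs A" "(u \<otimes> u) \<otimes> (u \<otimes> u) \<in> diffs A"
      "((u \<otimes> u) \<otimes> (u \<otimes> u)) \<otimes> ((u \<otimes> u) \<otimes> (u \<otimes> u)) \<in> diffs A"
      using dI[of a a'] dI[of c c'] dI[of e e'] dI[of g g'] mem X(1) unfolding c e g u_def by auto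
    then have "u = \<one>"
      using free[OF u] by blast
    then have "a \<otimes> inv a' = \<one>" "c \<otimes> inv c' = \<one>" "e \<otimes> inv e' = \<one>" "g \<otimes> inv g' = \<one>"
      using u_def c e g by simp_all
    then show "s = s'"
      using car by (simp add: s1 s2 inv_solve_right')
  qed
  moreover have "f ` (A \<times> X \<times> X \<times> X) \<subseteq> E \<times> E \<times> E"
    using h_E X(1) by (auto simp: f_def)
  ultimately have "card (A \<times> X \<times> X \<times> X) \<le> card (E \<times> E \<times> E)"
    using finE by (intro card_inj_on_le) auto
  then have inj: "card A * card X ^ 3 \<le> card E ^ 3"
    by (simp add: card_cartesian_product power3_eq_cube)
  \<comment> \<open>It remains to combine k x^3 \<le> |E|^3 with |E| k^2 \<le> d^2 x, which follows
    from Petridis' inequality; the unknown size x of \<open>X\<close> cancels.\<close>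
  define x k d y where "x = card X" and "k = card A" and "d = card (diffs A)" and "y = card (X <#> B)"
  have x: "x > 0"
    using X finX by (simp add: x_def card_gt_0_iff)
  have yk: "y * k \<le> d * x"
    using X(3) by (simp add: AB x_def k_def d_def y_def)
  have "(card E * x) * (k * k) \<le> (y * k) * (y * k)"
    using mult_le_mono1[OF pet, of "k * k"] by (simp add: x_def y_def algebra_simps)
  also have "\<dots> \<le> (d * x) * (d * x)"
    by (rule mult_le_mono[OF yk yk])
  finally have "x * (card E * k\<^sup>2) \<le> x * (d\<^sup>2 * x)"
    by (simp add: power2_eq_square algebra_simps)
  then have "card E * k\<^sup>2 \<le> d\<^sup>2 * x"
    using x by simp
  then have "(card E * k\<^sup>2) ^ 3 \<le> (d\<^sup>2 * x) ^ 3"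
    by (rule power_mono) simp
  then have "card E ^ 3 * k ^ 6 \<le> d ^ 6 * x ^ 3"
    by (simp add: power_mult_distrib flip: power_mult)
  moreover have "(k * x ^ 3) * k ^ 6 \<le> card E ^ 3 * k ^ 6"
    using inj by (intro mult_le_mono1) (simp add: k_def x_def)
  ultimately have "(k * x ^ 3) * k ^ 6 \<le> d ^ 6 * x ^ 3"
    by (rule order_trans[rotated])
  then have "(k * k ^ 6) * x ^ 3 \<le> d ^ 6 * x ^ 3"
    by (simp only: ac_simps)
  then have "k * k ^ 6 \<le> d ^ 6"
    using x by simp
  then show ?thesis
    using power_Suc[of k 6] by (simp add: k_def d_def)
qed simp

end

section \<open>The random colouring\<close>

locale rot_field =
  fixes p n r :: nat and \<alpha> :: int
  assumes prime_p: "prime p" and r_ge: "r \<ge> 2" and p_ge: "p \<ge> 5" and \<alpha>: "\<alpha> \<in> {1..<int p}"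
    and pow_cong_iff: "[\<alpha> ^ i = \<alpha> ^ j] (mod int p) \<longleftrightarrow> [i = j] (mod 2 * r)"
    and pow_r: "[\<alpha> ^ r = - 1] (mod int p)"
begin

definition V :: "(nat \<Rightarrow> int) set" where "V = {..<n} \<rightarrow>\<^sub>E {0..<int p}"

definition zv :: "nat \<Rightarrow> int" where "zv = (\<lambda>i\<in>{..<n}. 0)"

definition NZ :: "(nat \<Rightarrow> int) set" where "NZ = V - {zv}"

definition sm :: "int \<Rightarrow> (nat \<Rightarrow> int) \<Rightarrow> nat \<Rightarrow> int" where
  "sm a x = (\<lambda>i\<in>{..<n}. a * x i mod int p)"

text \<open>The inverse of 2 modulo the odd prime \<open>p\<close>.\<close>

definition i2 :: int where "i2 = (int p + 1) div 2"

lemma p_pos: "int p > 0"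
  using p_ge by simp

lemma prime_int_p: "prime (int p)"
  using prime_p by simp

lemma finite_V: "finite V"
  by (simp add: V_def finite_PiE)

lemma finite_NZ: "finite NZ"
  by (simp add: NZ_def finite_V)

lemma card_V: "card V = p ^ n"
  by (simp add: V_def card_PiE)

lemma sm_V: "sm a x \<in> V"
  using p_pos by (auto simp: sm_def V_def)

lemma sm_sm: "sm a (sm b x) = sm (a * b) x"
  by (auto simp: sm_def fun_eq_iff mod_mult_right_eq mult.assoc)

lemma sm_1: "x \<in> V \<Longrightarrow> sm 1 x = x"
  by (auto simp: sm_def V_def PiE_iff extensional_def fun_eq_iff)

lemma sm_cong: "[a = b] (mod int p) \<Longrightarrow> sm a x = sm b x"
  by (auto simp: sm_def fun_eq_iff cong_mod_def intro: mod_mult_cong)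

lemma sm_eq_iff:
  assumes "x \<in> NZ"
  shows "sm a x = sm b x \<longleftrightarrow> [a = b] (mod int p)"
proof
  assume eq: "sm a x = sm b x"
  have x: "x \<in> {..<n} \<rightarrow>\<^sub>E {0..<int p}" "x \<noteq> zv"
    using assms by (auto simp: NZ_def V_def)
  have "\<exists>i<n. x i \<noteq> 0"
  proof (rule ccontr)
    assume "\<not> ?thesis"
    then have "x = zv"
      using x(1) by (intro extensionalityI[of x "{..<n}"]) (auto simp: zv_def PiE_iff)
    with x(2) show False ..
  qed
  then obtain i where i: "i < n" "x i \<noteq> 0"
    by blast
  have "x i \<in> {0..<int p}"
    using PiE_mem[OF x(1)] i(1) by simp
  then have ndvd: "\<not> int p dvd x i"
    using i by (auto dest: zdvd_imp_le)
  have "a * x i mod int p = b * x i mod int p"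
    using fun_cong[OF eq, of i] i by (simp add: sm_def)
  then have "int p dvd (a - b) * x i"
    by (simp add: mod_eq_dvd_iff left_diff_distrib)
  then have "int p dvd a - b"
    using ndvd prime_dvd_mult_iff[OF prime_int_p] by blast
  then show "[a = b] (mod int p)"
    by (simp add: cong_iff_dvd_diff)
qed (rule sm_cong)

lemma sm_NZ:
  assumes "x \<in> NZ" "\<not> int p dvd a"
  shows "sm a x \<in> NZ"
proof -
  have "sm 0 x = zv"
    by (auto simp: sm_def zv_def)
  then have "sm a x \<noteq> zv"
    using sm_eq_iff[OF assms(1), of a 0] assms(2) by (auto simp: cong_0_iff)
  then show ?thesis
    using sm_V by (auto simp: NZ_def)
qed

lemma \<alpha>_ndvd: "\<not> int p dvd \<alpha>"
  using \<alpha> by (auto dest: zdvd_imp_le)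

lemma \<alpha>_pow_ndvd: "\<not> int p dvd \<alpha> ^ j"
  using \<alpha>_ndvd prime_dvd_power[OF prime_int_p, of \<alpha> j] by blast

lemma two_ndvd: "\<not> int p dvd 2"
  using p_ge by (auto dest: zdvd_imp_le)

lemma pow_2r: "[\<alpha> ^ (2 * r) = 1] (mod int p)"
  using pow_cong_iff[of "2 * r" 0] by (simp add: cong_mod_def)

lemma two_i2: "[2 * i2 = 1] (mod int p)"
proof -
  have "odd p"
    using prime_odd_nat[OF prime_p] p_ge by simp
  then have "even (int p + 1)"
    by simp
  then have "2 * i2 = int p + 1"
    unfolding i2_def by (rule dvd_mult_div_cancel)
  then show ?thesis
    by (simp add: cong_mod_def)
qed

lemma i2_ndvd: "\<not> int p dvd i2"
proof
  assume "int p dvd i2"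
  then have "int p dvd 2 * i2"
    by simp
  moreover have "int p dvd 2 * i2 - 1"
    using two_i2 by (simp add: cong_iff_dvd_diff)
  ultimately have "int p dvd 1"
    using dvd_diff[of "int p" "2 * i2" "2 * i2 - 1"] by simp
  then show False
    using p_ge by simp
qed

definition half :: "(nat \<Rightarrow> int) \<Rightarrow> nat \<Rightarrow> int" where "half = sm i2"

lemma half_double: "x \<in> V \<Longrightarrow> half (sm 2 x) = x" "x \<in> V \<Longrightarrow> sm 2 (half x) = x"
  using sm_cong[OF two_i2, of x] sm_1[of x] by (simp_all add: half_def sm_sm mult.commute)

lemma half_NZ: "x \<in> NZ \<Longrightarrow> half x \<in> NZ"
  unfolding half_def by (rule sm_NZ[OF _ i2_ndvd])

lemma NZ_V: "x \<in> NZ \<Longrightarrow> x \<in> V"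
  by (simp add: NZ_def)

lemma half_sm: "half (sm a x) = sm a (half x)"
  by (simp add: half_def sm_sm mult.commute)

definition orb :: "(nat \<Rightarrow> int) \<Rightarrow> (nat \<Rightarrow> int) set" where
  "orb x = {sm (\<alpha> ^ j) x | j. True}"

lemma orb_self: "x \<in> V \<Longrightarrow> x \<in> orb x"
  unfolding orb_def using sm_1[of x] by (auto intro: exI[of _ 0])

lemma orb_NZ: "x \<in> NZ \<Longrightarrow> orb x \<subseteq> NZ"
  using sm_NZ \<alpha>_pow_ndvd by (auto simp: orb_def)

lemma orb_sym:
  assumes "y \<in> orb x" "x \<in> V"
  shows "x \<in> orb y"
proof -
  obtain j where y: "y = sm (\<alpha> ^ j) x"
    using assms by (auto simp: orb_def)
  \<comment> \<open>The inverse of \<alpha> ^ j is written as \<alpha> ^ (2 r j - j); this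
    inequality makes the subtraction of naturals exact.\<close>
  have "j \<le> 2 * r * j"
    using mult_le_mono1[of 1 "2 * r" j] r_ge by simp
  then have "sm (\<alpha> ^ (2 * r * j - j)) y = sm (\<alpha> ^ (2 * r * j)) x"
    by (simp add: y sm_sm flip: power_add)
  also have "\<dots> = sm (\<alpha> ^ 0) x"
    by (intro sm_cong) (simp only: pow_cong_iff, simp add: cong_mod_def)
  finally show ?thesis
    using assms sm_1[of x] by (auto simp: orb_def intro!: exI[of _ "2 * r * j - j"])
qed

lemma orb_trans: "y \<in> orb x \<Longrightarrow> z \<in> orb y \<Longrightarrow> z \<in> orb x"
  by (auto simp: orb_def sm_sm simp flip: power_add)

lemma orb_eq: "y \<in> orb x \<Longrightarrow> x \<in> V \<Longrightarrow> orb y = orb x"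
  by (intro equalityI subsetI) (erule (1) orb_trans, rule orb_trans[OF orb_sym])

definition rep :: "(nat \<Rightarrow> int) set \<Rightarrow> nat \<Rightarrow> int" where "rep U = (SOME y. y \<in> U)"

text \<open>The position of \<open>x\<close> in its orbit, counted from the chosen representative.
  For nonzero \<open>x\<close> it is meaningful modulo 2 r.\<close>

definition ind :: "(nat \<Rightarrow> int) \<Rightarrow> nat" where
  "ind x = (LEAST j. x = sm (\<alpha> ^ j) (rep (orb x)))"

lemma rep_orb: "x \<in> V \<Longrightarrow> rep (orb x) \<in> orb x"
  using someI[of "\<lambda>y. y \<in> orb x" x] orb_self[of x] by (simp add: rep_def)

lemma ind_spec: "x \<in> V \<Longrightarrow> x = sm (\<alpha> ^ ind x) (rep (orb x))"
proof -
  assume x: "x \<in> V"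
  have "x \<in> orb (rep (orb x))"
    by (rule orb_sym[OF rep_orb[OF x] x])
  then obtain j where "x = sm (\<alpha> ^ j) (rep (orb x))"
    by (auto simp: orb_def)
  then show ?thesis
    unfolding ind_def by (rule LeastI)
qed

lemma ind_sm:
  assumes x: "x \<in> NZ"
  shows "[ind (sm \<alpha> x) = ind x + 1] (mod 2 * r)"
proof -
  let ?y = "sm \<alpha> x"
  have y: "?y \<in> orb x"
    by (auto simp: orb_def intro: exI[of _ 1])
  have orb: "orb ?y = orb x"
    by (rule orb_eq[OF y NZ_V[OF x]])
  have R: "rep (orb x) \<in> NZ"
    using rep_orb[OF NZ_V[OF x]] orb_NZ[OF x] by blast
  have "sm (\<alpha> ^ ind ?y) (rep (orb x)) = ?y"
    using ind_spec[OF sm_V, of \<alpha> x] orb by simp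
  also have "\<dots> = sm \<alpha> (sm (\<alpha> ^ ind x) (rep (orb x)))"
    using ind_spec[OF NZ_V[OF x]] by simp
  also have "\<dots> = sm (\<alpha> ^ (ind x + 1)) (rep (orb x))"
    by (simp add: sm_sm)
  finally show ?thesis
    using sm_eq_iff[OF R] pow_cong_iff by blast
qed

end

text \<open>
  For \<open>x \<in> T\<close> the colour of \<open>2 x\<close> is tied to the colour of \<open>x\<close>, so that the two are different.
\<close>

locale rot_tails = rot_field +
  fixes T :: "(nat \<Rightarrow> int) set"
  assumes T_NZ: "T \<subseteq> NZ" and T_rot: "x \<in> T \<Longrightarrow> sm \<alpha> x \<in> T" and T_disj: "x \<in> T \<Longrightarrow> sm 2 x \<notin> T"
begin

text \<open>The vector whose orbit carries the free colour that determines the colour of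
  \<open>x\<close>: a vector 2 y with y in \<open>T\<close> borrows it from y.\<close>

definition rt :: "(nat \<Rightarrow> int) \<Rightarrow> nat \<Rightarrow> int" where
  "rt x = (if half x \<in> T then half x else x)"

text \<open>The index makes the colour advance by one under \<alpha>. The extra 1 gives 2 y the
  colour of y plus one for y in \<open>T\<close>, which is a different colour because r \<ge>
  2.\<close>

definition col :: "((nat \<Rightarrow> int) set \<Rightarrow> int) \<Rightarrow> (nat \<Rightarrow> int) \<Rightarrow> int" where
  "col \<omega> x = (\<omega> (orb (rt x)) + int (ind (rt x)) + (if half x \<in> T then 1 else 0)) mod int r"

lemma T_rot_iff:
  assumes "x \<in> V"
  shows "sm \<alpha> x \<in> T \<longleftrightarrow> x \<in> T"
proof
  have pow: "sm (\<alpha> ^ j) y \<in> T" if "y \<in> T" for y j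
  proof (induction j)
    case 0
    then show ?case using that T_NZ sm_1 NZ_V by auto
  next
    case (Suc j)
    then show ?case using T_rot[of "sm (\<alpha> ^ j) y"] by (simp add: sm_sm)
  qed
  assume "sm \<alpha> x \<in> T"
  then have "sm (\<alpha> ^ (2 * r - 1)) (sm \<alpha> x) \<in> T"
    by (rule pow)
  also have "sm (\<alpha> ^ (2 * r - 1)) (sm \<alpha> x) = sm (\<alpha> ^ (2 * r)) x"
    using r_ge by (simp add: sm_sm flip: power_Suc2)
  also have "\<dots> = x"
    using sm_cong[OF pow_2r] sm_1[OF assms] by simp
  finally show "x \<in> T" .
qed (rule T_rot)

lemma rt_NZ: "x \<in> NZ \<Longrightarrow> rt x \<in> NZ"
  using half_NZ by (simp add: rt_def)

lemma rt_sm: "x \<in> NZ \<Longrightarrow> rt (sm \<alpha> x) = sm \<alpha> (rt x)"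
  using T_rot_iff[OF NZ_V[OF half_NZ]] by (simp add: rt_def half_sm)

lemma col_range: "col \<omega> x \<in> {0..<int r}"
  using r_ge by (simp add: col_def)

lemma col_cong:
  "[col \<omega> x = \<omega> (orb (rt x)) + int (ind (rt x)) + (if half x \<in> T then 1 else 0)] (mod int r)"
  unfolding col_def cong_mod_def by (rule mod_mod_trivial)

lemma col_sm:
  assumes x: "x \<in> NZ"
  shows "[col \<omega> (sm \<alpha> x) = col \<omega> x + 1] (mod int r)"
proof -
  have "[ind (sm \<alpha> (rt x)) = ind (rt x) + 1] (mod 2 * r)"
    by (rule ind_sm[OF rt_NZ[OF x]])
  then have "[ind (sm \<alpha> (rt x)) = ind (rt x) + 1] (mod r)"
    by (rule cong_dvd_modulus_nat) simp
  then have ind: "[int (ind (sm \<alpha> (rt x))) = int (ind (rt x)) + 1] (mod int r)"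
    by (simp add: add.commute flip: cong_int_iff)
  have orb: "orb (sm \<alpha> (rt x)) = orb (rt x)"
    by (rule orb_eq) (auto simp: orb_def NZ_V[OF rt_NZ[OF x]] intro: exI[of _ 1])
  have half: "half (sm \<alpha> x) \<in> T \<longleftrightarrow> half x \<in> T"
    using T_rot_iff[OF NZ_V[OF half_NZ[OF x]]] by (simp add: half_sm)
  define t :: int where "t = (if half x \<in> T then 1 else 0)"
  have "[col \<omega> (sm \<alpha> x) = \<omega> (orb (rt x)) + int (ind (sm \<alpha> (rt x))) + t] (mod int r)"
    using col_cong[of \<omega> "sm \<alpha> x"] unfolding rt_sm[OF x] orb half t_def .
  also have "[\<omega> (orb (rt x)) + int (ind (sm \<alpha> (rt x))) + t = \<omega> (orb (rt x)) + (int (ind (rt x)) + 1) + t] (mod int r)"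
    by (intro cong_add ind cong_refl)
  also have "\<omega> (orb (rt x)) + (int (ind (rt x)) + 1) + t = (\<omega> (orb (rt x)) + int (ind (rt x)) + t) + 1"
    by simp
  also have "[(\<omega> (orb (rt x)) + int (ind (rt x)) + t) + 1 = col \<omega> x + 1] (mod int r)"
    unfolding t_def by (intro cong_add cong_refl cong_sym[OF col_cong])
  finally show ?thesis .
qed

lemma col_pow:
  assumes x: "x \<in> NZ"
  shows "[col \<omega> (sm (\<alpha> ^ j) x) = col \<omega> x + int j] (mod int r)"
proof (induction j)
  case 0
  then show ?case using sm_1[OF NZ_V[OF x]] by simp
next
  case (Suc j)
  have "[col \<omega> (sm \<alpha> (sm (\<alpha> ^ j) x)) = col \<omega> (sm (\<alpha> ^ j) x) + 1] (mod int r)"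
    by (rule col_sm[OF sm_NZ[OF x \<alpha>_pow_ndvd]])
  also have "[col \<omega> (sm (\<alpha> ^ j) x) + 1 = col \<omega> x + int j + 1] (mod int r)"
    by (intro cong_add Suc cong_refl)
  finally show ?case
    by (simp add: sm_sm ac_simps)
qed

text \<open>As - 1 is \<alpha> ^ r modulo \<open>p\<close>, negation shifts the colour by r, hence
  not at all.\<close>

lemma col_neg:
  assumes x: "x \<in> NZ"
  shows "col \<omega> (sm (- 1) x) = col \<omega> x"
proof -
  have "sm (- 1) x = sm (\<alpha> ^ r) x"
    by (rule sm_cong[OF cong_sym[OF pow_r]])
  then have "[col \<omega> (sm (- 1) x) = col \<omega> x + int r] (mod int r)"
    using col_pow[OF x, of \<omega> r] by simp
  then show ?thesis
    using col_range[of \<omega> x] col_range[of \<omega> "sm (- 1) x"] by (simp add: cong_mod_def)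
qed

lemma col_double:
  assumes x: "x \<in> T"
  shows "col \<omega> (sm 2 x) \<noteq> col \<omega> x"
proof
  have xV: "x \<in> V"
    using x T_NZ NZ_V by auto
  have hx: "half x \<notin> T"
    using T_disj[of "half x"] half_double(2)[OF xV] x by auto
  have "half (sm 2 x) = x"
    by (rule half_double(1)[OF xV])
  then have "col \<omega> (sm 2 x) = (\<omega> (orb x) + int (ind x) + 1) mod int r"
    using x by (simp add: col_def rt_def)
  moreover have "col \<omega> x = (\<omega> (orb x) + int (ind x)) mod int r"
    using hx by (simp add: col_def rt_def)
  moreover assume "col \<omega> (sm 2 x) = col \<omega> x"
  ultimately have "[\<omega> (orb x) + int (ind x) + 1 = \<omega> (orb x) + int (ind x)] (mod int r)"
    by (simp add: cong_mod_def)
  then have "int r dvd 1"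
    by (simp add: cong_iff_dvd_diff)
  then show False
    using r_ge by simp
qed

end

text \<open>If 2 is a power of \<alpha>, no ties are made. Otherwise \<open>T\<close> is taken of
  maximal size: if x, 2 x and x / 2 were all outside \<open>T\<close>, the orbit of x could be
  added. That no u and 2 u both lie in this orbit is where 2 not being a power of \<alpha>
  enters.\<close>

lemma (in rot_field) tails_exist:
  "\<exists>T. rot_tails p n r \<alpha> T \<and>
     ((\<exists>j. [\<alpha> ^ j = 2] (mod int p)) \<or> (\<forall>x\<in>NZ. x \<in> T \<or> sm 2 x \<in> T \<or> half x \<in> T))"
proof (cases "\<exists>j. [\<alpha> ^ j = 2] (mod int p)")
  case True
  have "rot_tails p n r \<alpha> {}"
    by unfold_locales auto
  with True show ?thesis by blast
next
  case False
  define TT where "TT = {T. T \<subseteq> NZ \<and> (\<forall>x\<in>T. sm \<alpha> x \<in> T) \<and> (\<forall>x\<in>T. sm 2 x \<notin> T)}"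
  have "{} \<in> TT"
    by (simp add: TT_def)
  moreover have "\<forall>T. T \<in> TT \<longrightarrow> card T < Suc (card NZ)"
    using finite_NZ by (auto simp: TT_def less_Suc_eq_le intro: card_mono)
  ultimately obtain T where T: "T \<in> TT" and max: "\<And>T'. T' \<in> TT \<Longrightarrow> card T' \<le> card T"
    using ex_has_greatest_nat[of "\<lambda>T. T \<in> TT" "{}" card "Suc (card NZ)"] by blast
  have T_NZ: "T \<subseteq> NZ" and T_rot: "\<And>x. x \<in> T \<Longrightarrow> sm \<alpha> x \<in> T" and T_disj: "\<And>x. x \<in> T \<Longrightarrow> sm 2 x \<notin> T"
    using T by (auto simp: TT_def)
  have pow: "sm (\<alpha> ^ j) y \<in> T" if "y \<in> T" for y j
  proof (induction j)
    case 0
    then show ?case using that T_NZ sm_1 NZ_V by auto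
  next
    case (Suc j)
    then show ?case using T_rot[of "sm (\<alpha> ^ j) y"] by (simp add: sm_sm)
  qed
  have "x \<in> T \<or> sm 2 x \<in> T \<or> half x \<in> T" if x: "x \<in> NZ" for x
  proof (rule ccontr)
    assume "\<not> ?thesis"
    then have n: "x \<notin> T" "sm 2 x \<notin> T" "half x \<notin> T"
      by auto
    have xV: "x \<in> V"
      by (rule NZ_V[OF x])
    define T' where "T' = T \<union> orb x"
    have "T' \<subseteq> NZ"
      using T_NZ orb_NZ[OF x] by (simp add: T'_def)
    moreover have "sm \<alpha> u \<in> T'" if "u \<in> T'" for u
    proof -
      have "sm \<alpha> u \<in> orb x" if "u \<in> orb x"
        using that by (auto simp: orb_def sm_sm simp flip: power_Suc)
      then show ?thesis
        using \<open>u \<in> T'\<close> T_rot by (auto simp: T'_def)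
    qed
    moreover have "sm 2 u \<notin> T'" if u: "u \<in> T'" for u
    proof
      assume 2: "sm 2 u \<in> T'"
      consider "u \<in> T" "sm 2 u \<in> orb x" | "u \<in> orb x" "sm 2 u \<in> T" | "u \<in> orb x" "sm 2 u \<in> orb x"
        using u 2 T_disj by (auto simp: T'_def)
      then show False
      proof cases
        case 1
        have "x \<in> orb (sm 2 u)"
          by (rule orb_sym[OF 1(2) xV])
        then obtain i where "x = sm (\<alpha> ^ i) (sm 2 u)"
          by (auto simp: orb_def)
        then have "x = sm 2 (sm (\<alpha> ^ i) u)"
          by (simp add: sm_sm mult.commute)
        then have "half x = sm (\<alpha> ^ i) u"
          using half_double(1)[OF sm_V] by simp
        then show False
          using pow[OF 1(1)] n(3) by simp
      next
        case 2
        have "x \<in> orb u"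
          by (rule orb_sym[OF 2(1) xV])
        then obtain i where "x = sm (\<alpha> ^ i) u"
          by (auto simp: orb_def)
        then have "sm 2 x = sm (\<alpha> ^ i) (sm 2 u)"
          by (simp add: sm_sm mult.commute)
        then show False
          using pow[OF 2(2)] n(2) by simp
      next
        case 3
        have uN: "u \<in> NZ"
          using 3(1) orb_NZ[OF x] by blast
        have "sm 2 u \<in> orb u"
          using 3(2) orb_eq[OF 3(1) xV] by simp
        then obtain i where "sm (\<alpha> ^ i) u = sm 2 u"
          by (auto simp: orb_def)
        then show False
          using sm_eq_iff[OF uN] False by blast
      qed
    qed
    ultimately have "T' \<in> TT"
      by (auto simp: TT_def)
    then have "card T' \<le> card T"
      by (rule max)
    moreover have "card T < card T'"
      using \<open>T' \<subseteq> NZ\<close> finite_NZ orb_self[OF xV] n(1)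
      by (intro psubset_card_mono) (auto simp: T'_def intro: finite_subset)
    ultimately show False by simp
  qed
  moreover have "rot_tails p n r \<alpha> T"
    using T_NZ T_rot T_disj by unfold_locales auto
  ultimately show ?thesis by blast
qed

locale rot_maximal = rot_tails +
  assumes maximal: "(\<exists>j. [\<alpha> ^ j = 2] (mod int p)) \<or> (\<forall>x\<in>NZ. x \<in> T \<or> sm 2 x \<in> T \<or> half x \<in> T)"
begin

text \<open>If 2 is \<alpha> ^ j, doubling shifts the colour by j, so r divides j and 2 is 1 or - 1
  modulo \<open>p\<close>, impossible for p \<ge> 5. Otherwise maximality at 2 x puts one of x, 2 x,
  4 x into \<open>T\<close>, and its colour differs from that of its double.\<close>

lemma no_doubling_chain:
  assumes x: "x \<in> NZ" and eq: "col \<omega> x = k" "col \<omega> (sm 2 x) = k" "col \<omega> (sm 4 x) = k" "col \<omega> (sm 8 x) = k"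
  shows False
  using maximal
proof
  assume "\<exists>j. [\<alpha> ^ j = 2] (mod int p)"
  then obtain j where j: "[\<alpha> ^ j = 2] (mod int p)" by blast
  have "[col \<omega> (sm (\<alpha> ^ j) x) = col \<omega> x + int j] (mod int r)"
    by (rule col_pow[OF x])
  then have "[k = k + int j] (mod int r)"
    unfolding sm_cong[OF j] eq .
  then have "int r dvd int j"
    by (simp add: cong_iff_dvd_diff)
  then obtain t where t: "j = r * t"
    by auto
  have "[(\<alpha> ^ r) ^ t = (- 1) ^ t] (mod int p)"
    by (intro cong_pow pow_r)
  then have "[2 = (- 1) ^ t] (mod int p)"
    using cong_trans[OF cong_sym[OF j]] by (simp add: t power_mult)
  then have "int p dvd 2 - (- 1) ^ t"
    by (simp add: cong_iff_dvd_diff)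
  moreover have "(- 1 :: int) ^ t = 1 \<or> (- 1 :: int) ^ t = - 1"
    by (cases "even t") auto
  ultimately have "int p dvd 1 \<or> int p dvd 3"
    by auto
  then show False
    using p_ge zdvd_imp_le[of "int p" 1] zdvd_imp_le[of "int p" 3] by auto
next
  assume "\<forall>x\<in>NZ. x \<in> T \<or> sm 2 x \<in> T \<or> half x \<in> T"
  then have "sm 2 x \<in> T \<or> sm 2 (sm 2 x) \<in> T \<or> half (sm 2 x) \<in> T"
    using sm_NZ[OF x two_ndvd] by blast
  then have "sm 2 x \<in> T \<or> sm 4 x \<in> T \<or> x \<in> T"
    using half_double(1)[OF NZ_V[OF x]] by (simp add: sm_sm)
  then show False
    using col_double[of x \<omega>] col_double[of "sm 2 x" \<omega>] col_double[of "sm 4 x" \<omega>] eq by (auto simp: sm_sm)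
qed

end

section \<open>Counting the colourings with prescribed values\<close>

context rot_tails
begin

definition Orb :: "(nat \<Rightarrow> int) set set" where "Orb = orb ` NZ"

definition \<Omega> :: "((nat \<Rightarrow> int) set \<Rightarrow> int) set" where "\<Omega> = Orb \<rightarrow>\<^sub>E {0..<int r}"

lemma finite_Orb: "finite Orb"
  by (simp add: Orb_def finite_NZ)

lemma finite_\<Omega>: "finite \<Omega>"
  by (simp add: \<Omega>_def finite_Orb finite_PiE)

lemma card_\<Omega>: "card \<Omega> = r ^ card Orb"
  by (simp add: \<Omega>_def card_PiE finite_Orb)

text \<open>The colour of d fixes the value of \<omega> at the orbit of \<open>rt d\<close>, and
  these orbits are distinct.\<close>

lemma card_prescribed_colour:
  assumes D: "D \<subseteq> NZ" and inj: "inj_on (\<lambda>d. orb (rt d)) D"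
  shows "card {\<omega> \<in> \<Omega>. \<forall>d\<in>D. col \<omega> d = k} \<le> r ^ (card Orb - card D)"
proof -
  define f where "f = (\<lambda>d. orb (rt d))"
  define t :: "(nat \<Rightarrow> int) \<Rightarrow> int" where "t = (\<lambda>d. int (ind (rt d)) + (if half d \<in> T then 1 else 0))"
  define v where "v = (\<lambda>U. (k - t (the_inv_into D f U)) mod int r)"
  have sub: "f ` D \<subseteq> Orb"
    using D rt_NZ by (auto simp: f_def Orb_def)
  have "{\<omega> \<in> \<Omega>. \<forall>d\<in>D. col \<omega> d = k} \<subseteq> {\<omega> \<in> Orb \<rightarrow>\<^sub>E {0..<int r}. \<forall>U\<in>f ` D. \<omega> U = v U}"
  proof (clarsimp simp: \<Omega>_def)
    fix \<omega> d assume w: "\<omega> \<in> Orb \<rightarrow>\<^sub>E {0..<int r}" "\<forall>d\<in>D. col \<omega> d = k" and d: "d \<in> D"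
    have rng: "\<omega> (f d) \<in> {0..<int r}"
      using w(1) sub d by (auto simp: PiE_iff)
    have "(\<omega> (f d) + t d) mod int r = k"
      using w(2) d by (auto simp: col_def f_def t_def add.assoc)
    then have "(k - t d) mod int r = ((\<omega> (f d) + t d) mod int r - t d) mod int r"
      by simp
    also have "\<dots> = \<omega> (f d) mod int r"
      by (simp add: mod_diff_left_eq)
    also have "\<dots> = \<omega> (f d)"
      using rng by simp
    finally show "\<omega> (f d) = v (f d)"
      using the_inv_into_f_f[OF inj[folded f_def] d] by (simp add: v_def)
  qed
  moreover have "finite {\<omega> \<in> Orb \<rightarrow>\<^sub>E {0..<int r}. \<forall>U\<in>f ` D. \<omega> U = v U}"
    using finite_\<Omega> by (simp add: \<Omega>_def)
  ultimately have "card {\<omega> \<in> \<Omega>. \<forall>d\<in>D. col \<omega> d = k} \<le> card {\<omega> \<in> Orb \<rightarrow>\<^sub>E {0..<int r}. \<forall>U\<in>f ` D. \<omega> U = v U}"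
    by (rule card_mono[rotated])
  also have "\<dots> \<le> card {0..<int r} ^ (card Orb - card (f ` D))"
    by (intro card_PiE_prescribed finite_Orb sub) simp
  also have "card (f ` D) = card D"
    using inj by (intro card_image) (simp add: f_def)
  finally show ?thesis
    by simp
qed

end

section \<open>Integer sequences modulo \<open>p\<close> as a reduced module\<close>

definition scl :: "int \<Rightarrow> (nat \<Rightarrow> int) \<Rightarrow> nat \<Rightarrow> int" where
  "scl a v = (\<lambda>i. a * v i)"

context rot_field
begin

definition NN :: "(nat \<Rightarrow> int) set" where "NN = {v. \<forall>i<n. int p dvd v i}"

text \<open>Two vectors with the same free colour differ by a factor m \<alpha> ^ j with m one of 1,
  2, 1/2, see \<open>rt_eq_imp\<close>. The class of - 1 occurs as \<alpha> ^ r, but only as a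
  residue in {0..<p}; \<open>reduced_module\<close> asks for the integer - 1 itself.\<close>

definition LamS :: "int set" where
  "LamS = insert (- 1) (\<Union>m\<in>{1, 2, i2}. (\<lambda>j. m * \<alpha> ^ j mod int p) ` {..<2 * r})"

definition LS :: "int set" where
  "LS = {0, 1, - 1} \<union> LamS \<union> uminus ` LamS \<union> (\<lambda>a. 1 - a) ` LamS \<union> (\<lambda>a. a - 1) ` LamS"

definition nzS :: "int set" where "nzS = {a. \<not> int p dvd a}"

lemma LamS_mem: "m \<in> {1, 2, i2} \<Longrightarrow> m * \<alpha> ^ j mod int p \<in> LamS"
proof -
  assume m: "m \<in> {1, 2, i2}"
  have "[\<alpha> ^ j = \<alpha> ^ (j mod (2 * r))] (mod int p)"
    unfolding pow_cong_iff by (simp add: cong_mod_def)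
  then have "[m * \<alpha> ^ j = m * \<alpha> ^ (j mod (2 * r))] (mod int p)"
    by (rule cong_scalar_left)
  then have "m * \<alpha> ^ j mod int p = m * \<alpha> ^ (j mod (2 * r)) mod int p"
    by (simp add: cong_mod_def)
  moreover have "j mod (2 * r) < 2 * r"
    using r_ge by simp
  ultimately have "m * \<alpha> ^ j mod int p \<in> (\<lambda>j. m * \<alpha> ^ j mod int p) ` {..<2 * r}"
    by blast
  then show ?thesis
    unfolding LamS_def using m by blast
qed

lemma LamS_cases:
  assumes "a \<in> LamS"
  obtains "a = - 1" | m j where "m \<in> {1, 2, i2}" "a = m * \<alpha> ^ j mod int p"
  using assms unfolding LamS_def by (elim insertE UN_E imageE) blast+

lemma LamS_one: "1 \<in> LamS"
  using LamS_mem[of 1 0] p_ge by simp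

lemma m_ndvd: "m \<in> {1, 2, i2} \<Longrightarrow> \<not> int p dvd m"
  using two_ndvd i2_ndvd p_ge by auto

lemma LamS_nz:
  assumes "a \<in> LamS"
  shows "\<not> int p dvd a"
  using assms
proof (cases rule: LamS_cases)
  case 1
  then show ?thesis using p_ge by auto
next
  case (2 m j)
  then have "\<not> int p dvd m * \<alpha> ^ j"
    using m_ndvd \<alpha>_pow_ndvd prime_dvd_mult_iff[OF prime_int_p] by blast
  then show ?thesis
    using 2 by (simp add: dvd_mod_iff)
qed

text \<open>Apart from - 1, the elements are reduced modulo \<open>p\<close>, so a multiplier
  congruent to 1 is equal to 1.\<close>

lemma LamS_diff_nz:
  assumes "a \<in> LamS" "a \<noteq> 1"
  shows "\<not> int p dvd 1 - a"
  using assms(1)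
proof (cases rule: LamS_cases)
  case 1
  then show ?thesis using two_ndvd by simp
next
  case (2 m j)
  have "0 \<le> a" "a < int p"
    using 2 p_pos by auto
  show ?thesis
  proof
    assume "int p dvd 1 - a"
    then have "\<bar>int p\<bar> \<le> \<bar>1 - a\<bar>"
      using assms(2) by (intro dvd_imp_le_int) auto
    moreover have "\<not> int p dvd 1"
      using p_ge by simp
    ultimately show False
      using \<open>0 \<le> a\<close> \<open>a < int p\<close> p_ge by (cases "a = 0") (use \<open>int p dvd 1 - a\<close> in auto)
  qed
qed

lemma LamS_inverse:
  assumes "a \<in> LamS"
  shows "\<exists>a'\<in>LamS. [a' * a = 1] (mod int p)"
  using assms
proof (cases rule: LamS_cases)
  case 1
  then show ?thesis
    using assms by (intro bexI[of _ a]) auto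
next
  case (2 m j)
  obtain m' where m': "m' \<in> {1, 2, i2}" "[m' * m = 1] (mod int p)"
  proof -
    have "[1 * 1 = 1] (mod int p)" "[i2 * 2 = 1] (mod int p)"
      using two_i2 by (simp_all add: mult.commute)
    then show thesis
      using 2(1) two_i2 that[of 1] that[of 2] that[of i2] by blast
  qed
  define j' where "j' = 2 * r * j - j"
  have "j \<le> 2 * r * j"
    using mult_le_mono1[of 1 "2 * r" j] r_ge by simp
  then have jj: "j' + j = 2 * r * j"
    by (simp add: j'_def)
  have "[\<alpha> ^ (2 * r * j) = \<alpha> ^ 0] (mod int p)"
    unfolding pow_cong_iff by (simp add: cong_mod_def)
  then have "[(m' * m) * \<alpha> ^ (j' + j) = 1 * 1] (mod int p)"
    unfolding jj using m'(2) by (intro cong_mult) simp_all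
  then have "[(m' * \<alpha> ^ j') * (m * \<alpha> ^ j) = 1] (mod int p)"
    by (simp add: power_add ac_simps)
  then have "[(m' * \<alpha> ^ j' mod int p) * a = 1] (mod int p)"
    unfolding 2(2) by (simp add: cong_mod_def mod_mult_eq)
  then show ?thesis
    using LamS_mem[OF m'(1)] by blast
qed

lemma card_LamS: "card LamS \<le> 7 * r"
proof -
  define U where "U = (\<Union>m\<in>{1, 2, i2}. (\<lambda>j. m * \<alpha> ^ j mod int p) ` {..<2 * r})"
  have "card U \<le> (\<Sum>m\<in>{1, 2, i2}. card ((\<lambda>j. m * \<alpha> ^ j mod int p) ` {..<2 * r}))"
    unfolding U_def by (rule card_UN_le) simp
  also have "\<dots> \<le> (\<Sum>m\<in>{1, 2, i2}. 2 * r)"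
    by (intro sum_mono order_trans[OF card_image_le]) auto
  also have "\<dots> = card {1, 2, i2} * (2 * r)"
    by simp
  also have "\<dots> \<le> 3 * (2 * r)"
    by (intro mult_le_mono1) (simp add: card_insert_if)
  finally have "card U \<le> 6 * r"
    by simp
  moreover have "card LamS \<le> Suc (card U)"
    unfolding LamS_def U_def[symmetric] by (intro card_insert_le_m1) (auto simp: U_def)
  ultimately show ?thesis
    using r_ge by linarith
qed

lemma finite_LamS: "finite LamS"
  by (auto simp: LamS_def)

lemma finite_LS: "finite LS"
  by (simp add: LS_def finite_LamS)

lemma card_LS: "card LS \<le> 31 * r"
proof -
  have "card LS \<le> 3 + card LamS + card LamS + card LamS + card LamS"
    unfolding LS_def
    by (intro order_trans[OF card_Un_le] add_mono card_image_le finite_LamS order_refl) (simp add: card_insert_if)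
  then show ?thesis
    using card_LamS r_ge by linarith
qed

lemma module_scl: "Modules.module scl"
  by unfold_locales (auto simp: scl_def fun_eq_iff algebra_simps)

sublocale RM: reduced_module scl NN V LS LamS nzS
proof (intro reduced_module.intro reduced_module_axioms.intro module_scl)
  show "Modules.module.subspace scl NN"
    by (auto simp: module.subspace_def[OF module_scl] NN_def scl_def)
  show "v \<in> NN" if "a \<in> nzS" "scl a v \<in> NN" for a v
    using that prime_dvd_mult_iff[OF prime_int_p] by (auto simp: nzS_def NN_def scl_def)
  show "finite V"
    by (rule finite_V)
  show "x = y" if "x \<in> V" "y \<in> V" "x - y \<in> NN" for x y
  proof (rule extensionalityI[of _ "{..<n}"])
    show "x \<in> extensional {..<n}" "y \<in> extensional {..<n}"
      using that by (auto simp: V_def PiE_iff)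
    fix i assume i: "i \<in> {..<n}"
    then have "int p dvd x i - y i"
      using that by (auto simp: NN_def)
    moreover have "x i \<in> {0..<int p}" "y i \<in> {0..<int p}"
      using that(1,2) PiE_mem[OF _ i] unfolding V_def by blast+
    ultimately show "x i = y i"
      by (metis atLeastLessThan_iff mod_eq_dvd_iff mod_pos_pos_trivial)
  qed
  show "\<exists>x\<in>V. v - x \<in> NN" for v
    using p_pos by (intro bexI[of _ "\<lambda>i\<in>{..<n}. v i mod int p"]) (auto simp: V_def NN_def)
  show "finite LS"
    by (rule finite_LS)
  show "0 \<in> LS" "1 \<in> LS"
    by (auto simp: LS_def)
  show "- a \<in> LS" if "a \<in> LS" for a
  proof -
    have "uminus ` LS \<subseteq> LS"
      by (auto simp: LS_def)
    then show ?thesis using that by blast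
  qed
  show "1 \<in> nzS"
    using p_ge by (simp add: nzS_def)
  show "- a \<in> nzS" if "a \<in> nzS" for a
    using that by (simp add: nzS_def)
  show "LamS \<subseteq> LS"
    by (auto simp: LS_def)
  show "LamS \<subseteq> nzS"
    using LamS_nz by (auto simp: nzS_def)
  show "1 - a \<in> LS" if "a \<in> LamS" for a
    using that by (auto simp: LS_def)
  show "1 - a \<in> nzS" if "a \<in> LamS" "a \<noteq> 1" for a
    using LamS_diff_nz[OF that] by (simp add: nzS_def)
  show "\<exists>a'\<in>LamS. \<forall>v. scl (a' * a) v - v \<in> NN" if a: "a \<in> LamS" for a
  proof -
    obtain a' where a': "a' \<in> LamS" "[a' * a = 1] (mod int p)"
      using LamS_inverse[OF a] by blast
    have "int p dvd a' * a * x - x" for x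
    proof -
      have "int p dvd (a' * a - 1) * x"
        using a'(2) by (simp add: cong_iff_dvd_diff)
      then show ?thesis
        by (simp add: left_diff_distrib)
    qed
    then show ?thesis
      using a'(1) by (intro bexI[of _ a']) (auto simp: NN_def scl_def)
  qed
  show "- 1 \<in> LamS"
    by (simp add: LamS_def)
qed simp

end

section \<open>Differences of vectors and the probability of being monochromatic\<close>

context rot_field
begin

definition vd :: "(nat \<Rightarrow> int) \<Rightarrow> (nat \<Rightarrow> int) \<Rightarrow> nat \<Rightarrow> int" where
  "vd x y = (\<lambda>i\<in>{..<n}. (x i - y i) mod int p)"

lemma vd_V: "vd x y \<in> V"
  using p_pos by (auto simp: vd_def V_def)

lemma vd_NN: "x - y - vd x y \<in> NN"
  by (auto simp: vd_def NN_def)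

lemma vd_NZ:
  assumes "x \<in> V" "y \<in> V" "x \<noteq> y"
  shows "vd x y \<in> NZ"
proof -
  have "vd x y \<noteq> zv"
  proof
    assume eq: "vd x y = zv"
    have "zv \<in> NN"
      by (auto simp: zv_def NN_def)
    with vd_NN[of x y] have "(x - y - zv) + zv \<in> NN"
      unfolding eq by (rule RM.N_add)
    then show False
      using RM.X_inj[OF assms(1,2)] assms(3) by simp
  qed
  then show ?thesis
    using vd_V by (simp add: NZ_def)
qed

lemma sm_vd:
  assumes "sm a (vd x y) = vd x' y'"
  shows "scl a (x - y) - (x' - y') \<in> NN"
proof -
  have "int p dvd a * (x i - y i) - (x' i - y' i)" if "i < n" for i
  proof -
    have "a * ((x i - y i) mod int p) mod int p = (x' i - y' i) mod int p"
      using fun_cong[OF assms, of i] that by (simp add: sm_def vd_def)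
    then show ?thesis
      by (simp add: mod_mult_right_eq mod_eq_dvd_iff)
  qed
  then show ?thesis
    by (auto simp: NN_def scl_def)
qed

end

context rot_tails
begin

text \<open>Going from d to its root multiplies by 1 or 1/2, moving between the roots by a power of
  \<alpha>, and going from a root to d' by 1 or 2.\<close>

lemma rt_eq_imp:
  assumes d: "d \<in> NZ" "d' \<in> NZ" and eq: "orb (rt d) = orb (rt d')"
  shows "\<exists>a\<in>LamS. sm a d = d'"
proof -
  have "rt d' \<in> orb (rt d)"
    using orb_self[OF NZ_V[OF rt_NZ[OF d(2)]]] eq by simp
  then obtain j where j: "rt d' = sm (\<alpha> ^ j) (rt d)"
    by (auto simp: orb_def)
  obtain m1 where m1: "rt d = sm m1 d" "m1 \<in> {1, i2}"
  proof (cases "half d \<in> T")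
    case True
    then have "rt d = sm i2 d"
      unfolding rt_def half_def by simp
    then show thesis by (rule that) simp
  next
    case False
    then have "rt d = sm 1 d"
      using sm_1[OF NZ_V[OF d(1)]] by (simp add: rt_def)
    then show thesis by (rule that) simp
  qed
  obtain m2 where m2: "d' = sm m2 (rt d')" "m2 \<in> {1, 2}"
  proof (cases "half d' \<in> T")
    case True
    then have "d' = sm 2 (rt d')"
      using half_double(2)[OF NZ_V[OF d(2)]] by (simp add: rt_def)
    then show thesis by (rule that) simp
  next
    case False
    then have "d' = sm 1 (rt d')"
      using sm_1[OF NZ_V[OF d(2)]] by (simp add: rt_def)
    then show thesis by (rule that) simp
  qed
  have d': "d' = sm (m2 * m1 * \<alpha> ^ j) d"
    using m2(1) unfolding j m1(1) by (simp add: sm_sm ac_simps)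
  obtain m where m: "m \<in> {1, 2, i2}" "[m2 * m1 = m] (mod int p)"
  proof -
    have "[2 * 1 = 2] (mod int p)" "[1 * 1 = 1] (mod int p)" "[1 * i2 = i2] (mod int p)"
      by simp_all
    then show thesis
      using m1(2) m2(2) two_i2 that[of 1] that[of 2] that[of i2] by blast
  qed
  have "[m2 * m1 * \<alpha> ^ j = m * \<alpha> ^ j mod int p] (mod int p)"
    using cong_scalar_right[OF m(2), of "\<alpha> ^ j"] by (simp add: cong_mod_def)
  then have "d' = sm (m * \<alpha> ^ j mod int p) d"
    unfolding d' by (rule sm_cong)
  then show ?thesis
    using LamS_mem[OF m(1), of j] by blast
qed

definition mono :: "((nat \<Rightarrow> int) set \<Rightarrow> int) \<Rightarrow> (nat \<Rightarrow> int) set \<Rightarrow> int \<Rightarrow> bool" where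
  "mono \<omega> A k \<longleftrightarrow> (\<forall>x\<in>A. \<forall>y\<in>A. x \<noteq> y \<longrightarrow> col \<omega> (vd x y) = k)"

text \<open>For a largest separated set of pairs, \<open>rt_eq_imp\<close> shows that the
  differences have pairwise distinct free colours, so a monochromatic \<open>A\<close> fixes
  \<open>maxsep A\<close> coordinates of \<omega>.\<close>

lemma mono_count:
  assumes A: "A \<subseteq> V"
  shows "real (card {\<omega> \<in> \<Omega>. mono \<omega> A k}) \<le> card \<Omega> * real r powr (- real (RM.maxsep A))"
proof -
  obtain P where P: "P \<subseteq> A \<times> A" "RM.sepd P" "card P = RM.maxsep A"
    by (rule RM.maxsep_witness[OF A])
  define g where "g = (\<lambda>(y, b). vd y b)"
  have neq: "y \<noteq> b" if "(y, b) \<in> P" for y b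
    by (rule RM.sepd_neq[OF P(2) that])
  have gNZ: "g ` P \<subseteq> NZ"
  proof
    fix d assume "d \<in> g ` P"
    then obtain y b where yb: "(y, b) \<in> P" "d = vd y b"
      by (auto simp: g_def)
    then have "y \<in> V" "b \<in> V"
      using P(1) A by auto
    then show "d \<in> NZ"
      unfolding yb(2) using neq[OF yb(1)] by (rule vd_NZ)
  qed
  have inj: "inj_on (\<lambda>q. orb (rt (g q))) P"
  proof (rule inj_onI, rule ccontr)
    fix q q' assume q: "q \<in> P" "q' \<in> P" "orb (rt (g q)) = orb (rt (g q'))" "q \<noteq> q'"
    obtain y b y' b' where e: "q = (y, b)" "q' = (y', b')"
      by (cases q, cases q')
    obtain a where a: "a \<in> LamS" "sm a (g q) = g q'"
      using rt_eq_imp[of "g q" "g q'"] gNZ q by blast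
    then have "scl a (y - b) - (y' - b') \<in> NN"
      by (intro sm_vd) (simp add: g_def e)
    moreover have "scl a (y - b) - (y' - b') \<notin> NN"
      using q e by (intro RM.sepdD[OF P(2) _ _ _ a(1)]) auto
    ultimately show False by contradiction
  qed
  then have inj_g: "inj_on g P"
    by (auto simp: inj_on_def)
  have inj': "inj_on (\<lambda>d. orb (rt d)) (g ` P)"
    using inj inj_g by (auto simp: inj_on_def)
  have finP: "finite P"
    using P(1) finite_subset[OF A finite_V] by (auto intro: finite_subset)
  have cP: "card (g ` P) = card P"
    by (rule card_image[OF inj_g])
  \<comment> \<open>Needed to turn the subtraction of naturals in the exponent into a real
    one.\<close>
  have "card ((\<lambda>d. orb (rt d)) ` g ` P) \<le> card Orb"
    using gNZ rt_NZ finite_Orb by (intro card_mono) (auto simp: Orb_def)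
  then have le: "RM.maxsep A \<le> card Orb"
    using card_image[OF inj'] cP P(3) by simp
  have "{\<omega> \<in> \<Omega>. mono \<omega> A k} \<subseteq> {\<omega> \<in> \<Omega>. \<forall>d\<in>g ` P. col \<omega> d = k}"
  proof clarify
    fix \<omega> y b assume "mono \<omega> A k" "(y, b) \<in> P"
    then show "col \<omega> (g (y, b)) = k"
      using P(1) neq by (auto simp: mono_def g_def)
  qed
  then have "card {\<omega> \<in> \<Omega>. mono \<omega> A k} \<le> card {\<omega> \<in> \<Omega>. \<forall>d\<in>g ` P. col \<omega> d = k}"
    using finite_\<Omega> by (intro card_mono) auto
  also have "\<dots> \<le> r ^ (card Orb - RM.maxsep A)"
    using card_prescribed_colour[OF gNZ inj'] by (simp add: cP P(3))
  finally have "real (card {\<omega> \<in> \<Omega>. mono \<omega> A k}) \<le> real (r ^ (card Orb - RM.maxsep A))"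
    by (rule of_nat_mono)
  also have "\<dots> = real r powr (real (card Orb) - real (RM.maxsep A))"
    using r_ge le by (simp add: of_nat_diff flip: powr_realpow)
  also have "\<dots> = real r powr (real (card Orb)) * real r powr (- real (RM.maxsep A))"
    by (simp flip: powr_add)
  also have "real r powr (real (card Orb)) = card \<Omega>"
    using r_ge by (simp add: card_\<Omega> powr_realpow)
  finally show ?thesis .
qed

end

section \<open>Identification with the module \<open>Fpn p n\<close>\<close>

context rot_field
begin

sublocale residues_prime p "residue_ring (int p)"
  by unfold_locales (auto simp: prime_p)

lemma cring_Fp: "cring (Fp p)"
  using cring by (simp add: Fp_def)

sublocale FM: Module.module "Fp p" "Fpn p n"
  unfolding Fpn_def by (rule module_coord_module[OF cring_Fp])

lemma Fp_simps:
  "carrier (Fp p) = {0..<int p}" "a \<oplus>\<^bsub>Fp p\<^esub> b = (a + b) mod int p" "a \<otimes>\<^bsub>Fp p\<^esub> b = (a * b) mod int p"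
  "\<zero>\<^bsub>Fp p\<^esub> = 0" "\<one>\<^bsub>Fp p\<^esub> = 1"
  using res_carrier_eq res_add_eq res_mult_eq res_zero_eq res_one_eq by (auto simp: Fp_def)

lemma Fpn_carrier: "carrier (Fpn p n) = V"
  by (simp add: Fpn_def coord_module_def Fp_simps V_def)

lemma Fpn_zero: "\<zero>\<^bsub>Fpn p n\<^esub> = zv"
  by (simp add: Fpn_def coord_module_def Fp_simps zv_def)

lemma Fpn_smult: "a \<odot>\<^bsub>Fpn p n\<^esub> x = sm a x"
  by (simp add: Fpn_def coord_module_def Fp_simps sm_def)

lemma Fpn_add: "x \<oplus>\<^bsub>Fpn p n\<^esub> y = (\<lambda>i\<in>{..<n}. (x i + y i) mod int p)"
  by (simp add: Fpn_def coord_module_def Fp_simps)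

lemma Fpn_nonzero: "nonzero_vecs p n = NZ"
  by (simp add: nonzero_vecs_def NZ_def Fpn_carrier Fpn_zero)

lemma Fpn_minus:
  assumes "x \<in> V" "y \<in> V"
  shows "x \<ominus>\<^bsub>Fpn p n\<^esub> y = vd x y"
proof -
  have x: "x \<in> {..<n} \<rightarrow>\<^sub>E {0..<int p}"
    using assms(1) by (simp add: V_def)
  have "vd x y \<oplus>\<^bsub>Fpn p n\<^esub> y = x"
  proof (rule extensionalityI[of _ "{..<n}"])
    show "vd x y \<oplus>\<^bsub>Fpn p n\<^esub> y \<in> extensional {..<n}" "x \<in> extensional {..<n}"
      using x by (auto simp: Fpn_add PiE_iff)
    fix i assume i: "i \<in> {..<n}"
    have "x i \<in> {0..<int p}"
      by (rule PiE_mem[OF x i])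
    then show "(vd x y \<oplus>\<^bsub>Fpn p n\<^esub> y) i = x i"
      using i by (simp add: Fpn_add vd_def mod_add_left_eq)
  qed
  then show ?thesis
    using assms vd_V[of x y] FM.M.minus_eq FM.M.add.inv_solve_right' by (metis Fpn_carrier FM.M.add.inv_solve_right)
qed

lemma Fpn_uminus:
  assumes "x \<in> V"
  shows "\<ominus>\<^bsub>Fpn p n\<^esub> x = sm (- 1) x"
proof -
  have "sm (- 1) x \<oplus>\<^bsub>Fpn p n\<^esub> x = \<zero>\<^bsub>Fpn p n\<^esub>"
    by (auto simp: Fpn_add Fpn_zero zv_def sm_def fun_eq_iff mod_add_left_eq)
  then show ?thesis
    using assms sm_V[of "- 1" x] by (metis FM.M.minus_equality Fpn_carrier)
qed

lemma Fpn_double: "x \<oplus>\<^bsub>Fpn p n\<^esub> x = sm 2 x"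
  by (simp add: Fpn_add sm_def)

end

section \<open>Proof of the theorem\<close>

text \<open>The dominant term on the left has order k powr (8/7).\<close>

lemma eventually_numeric:
  fixes c1 c2 c3 c4 c5 c6 :: real
  assumes "c6 > 0" "c1 > 0" "c2 > 0" "c3 > 0" "c4 > 0" "c5 > 0"
  shows "eventually (\<lambda>k::nat. c5 + ln (real k + 1) + c2 * real k * ln (c3 * (real k + 1)) + c4 * real k
    + c1 * (real k * (real k + 1) powr (1 / 7)) < c6 * real k powr (7 / 6)) at_top"
proof -
  have a: "(\<lambda>k::nat. c5) \<in> o(\<lambda>k. real k powr (7 / 6))" by real_asymp
  have b: "(\<lambda>k::nat. ln (real k + 1)) \<in> o(\<lambda>k. real k powr (7 / 6))" by real_asymp
  have c: "(\<lambda>k::nat. c2 * real k * ln (c3 * (real k + 1))) \<in> o(\<lambda>k. real k powr (7 / 6))" using assms by real_asymp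
  have d: "(\<lambda>k::nat. c4 * real k) \<in> o(\<lambda>k. real k powr (7 / 6))" using assms by real_asymp
  have e: "(\<lambda>k::nat. c1 * (real k * (real k + 1) powr (1 / 7))) \<in> o(\<lambda>k. real k powr (7 / 6))" using assms by real_asymp
  have "(\<lambda>k::nat. c5 + ln (real k + 1) + c2 * real k * ln (c3 * (real k + 1)) + c4 * real k
    + c1 * (real k * (real k + 1) powr (1 / 7))) \<in> o(\<lambda>k. real k powr (7 / 6))"
    by (intro sum_in_smallo a b c d e)
  then have "eventually (\<lambda>k::nat. norm (c5 + ln (real k + 1) + c2 * real k * ln (c3 * (real k + 1)) + c4 * real k
    + c1 * (real k * (real k + 1) powr (1 / 7))) \<le> c6 / 2 * norm (real k powr (7 / 6))) at_top"
    by (rule landau_o.smallD) (use assms in simp)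
  then show ?thesis
    using eventually_gt_at_top[of "0::nat"]
  proof eventually_elim
    case (elim k)
    have "c6 / 2 * norm (real k powr (7 / 6)) < c6 * real k powr (7 / 6)"
      using assms elim by simp
    with elim show ?case
      by (smt (verit) real_norm_def)
  qed
qed

text \<open>Take logarithms. The leading \<open>r\<close> counts the colours, \<open>C\<close> and
  \<open>e\<close> come from \<open>card_sp\<close>, \<open>w\<close> is the bound 7 r on the number
  of multipliers, and the factor 7 is the number s of rounds.\<close>

lemma union_bound_small:
  fixes r \<epsilon> \<eta> :: real and C :: nat and e :: nat
  assumes r: "r > 1" and \<epsilon>: "\<epsilon> > 0" and \<eta>: "\<eta> > 0" and C: "C > 0" and w: "w > 0"
  shows "eventually (\<lambda>k::nat. r * (real (k + 1) * real ((C * (k + 1)) ^ e) ^ k *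
     r powr (2 / \<eta> * (1 + 7 * (4 * w / \<eta> * (real k + 1) powr (1 / 7) + 1)) * (k / (2 + \<epsilon>))
        - \<eta> * ((real k powr (7 / 6) - 1) / w))) < 1) at_top"
proof -
  define a where "a = ln r"
  have a: "a > 0"
    using r by (simp add: a_def)
  define c1 where "c1 = a * (2 / \<eta>) * 7 * (4 * w / \<eta>) / (2 + \<epsilon>)"
  define c4 where "c4 = a * (2 / \<eta>) * 8 / (2 + \<epsilon>)"
  define c6 where "c6 = a * \<eta> / w"
  define c5 where "c5 = a + c6"
  have pos: "c6 > 0" "c1 > 0" "real e + 1 > 0" "real C > 0" "c4 > 0" "c5 > 0"
    using a \<epsilon> \<eta> C w by (auto simp: c1_def c4_def c5_def c6_def intro!: add_pos_pos mult_pos_pos divide_pos_pos)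
  have "eventually (\<lambda>k::nat. c5 + ln (real k + 1) + (real e + 1) * real k * ln (C * (real k + 1)) + c4 * real k
    + c1 * (real k * (real k + 1) powr (1 / 7)) < c6 * real k powr (7 / 6)) at_top"
    by (rule eventually_numeric[OF pos])
  then show ?thesis
  proof (rule eventually_mono)
    fix k :: nat
    assume lt: "c5 + ln (real k + 1) + (real e + 1) * real k * ln (C * (real k + 1)) + c4 * real k
      + c1 * (real k * (real k + 1) powr (1 / 7)) < c6 * real k powr (7 / 6)"
    define x where "x = 2 / \<eta> * (1 + 7 * (4 * w / \<eta> * (real k + 1) powr (1 / 7) + 1)) * (k / (2 + \<epsilon>))
        - \<eta> * ((real k powr (7 / 6) - 1) / w)"
    define y where "y = r * (real (k + 1) * real ((C * (k + 1)) ^ e) ^ k * r powr x)"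
    have C1: "real C * (real k + 1) \<ge> 1"
      using mult_mono[of 1 "real C" 1 "real k + 1"] C by simp
    define z where "z = (real C * (real k + 1)) ^ e"
    have z: "real ((C * (k + 1)) ^ e) = z" "z > 0"
      using C1 by (simp_all only: z_def of_nat_power of_nat_mult of_nat_add of_nat_1) simp
    have zk: "z ^ k > 0"
      using z(2) by simp
    have y_eq: "y = r * ((real k + 1) * z ^ k * r powr x)"
      by (simp add: y_def z(1)[simplified])
    have y: "y > 0"
      unfolding y_eq using r zk by (intro mult_pos_pos) auto
    have "ln y = ln r + (ln (real k + 1) + ln (z ^ k) + ln (r powr x))"
      unfolding y_eq using r zk z(2) by (simp add: ln_mult add_pos_nonneg del: ln_powr)
    also have "ln (z ^ k) = real k * (real e * ln (C * (real k + 1)))"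
      using z(2) C1 by (simp add: ln_realpow z_def)
    also have "ln (r powr x) = x * a"
      using r by (simp add: ln_powr a_def)
    also have "ln r = a"
      by (simp add: a_def)
    \<comment> \<open>The coefficient e + 1 is positive for every natural number e, as
      \<open>eventually_numeric\<close> requires.\<close>
    also have "real k * (real e * ln (C * (real k + 1))) \<le> (real e + 1) * real k * ln (C * (real k + 1))"
    proof -
      have "0 \<le> real k * ln (C * (real k + 1))"
        using C1 by (intro mult_nonneg_nonneg) auto
      then show ?thesis
        by (simp add: algebra_simps)
    qed
    also have "x * a = c4 * real k + c1 * (real k * (real k + 1) powr (1 / 7)) - c6 * real k powr (7 / 6) + c6"
    proof -
      \<comment> \<open>Reciprocals and powers become variables, which leaves a polynomial
        identity.\<close>
      have alg: "(2 * h * (1 + 7 * (4 * w * h * u + 1)) * (t * i) - \<eta> * ((s - 1) * v)) * a =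
          a * (2 * h) * 8 * i * t + a * (2 * h) * 7 * (4 * w * h) * i * (t * u) - a * \<eta> * v * s + a * \<eta> * v"
        for h u t i s v :: real
        by (simp add: algebra_simps)
      show ?thesis
        unfolding x_def c1_def c4_def c6_def divide_inverse by (rule alg)
    qed
    finally have "ln y < 0"
      using lt by (simp add: c5_def)
    then have "y < 1"
      using y by simp
    then show "r * (real (k + 1) * real ((C * (k + 1)) ^ e) ^ k *
      r powr (2 / \<eta> * (1 + 7 * (4 * w / \<eta> * (real k + 1) powr (1 / 7) + 1)) * (k / (2 + \<epsilon>))
        - \<eta> * ((real k powr (7 / 6) - 1) / w))) < 1"
      by (simp add: y_def x_def)
  qed
qed

text \<open>\<alpha> is the power of a generator with exponent (p - 1) / (2 r). From \<alpha> ^ (2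
  r) = 1 the power \<alpha> ^ r is 1 or - 1 modulo \<open>p\<close>, and the order excludes
  1.\<close>

lemma rot_field_exists:
  assumes p: "prime p" and r: "r \<ge> 2" and cong: "[p = 1] (mod 2 * r)"
  obtains \<alpha> where "\<alpha> \<in> carrier (mult_of (Fp p))" "group.ord (mult_of (Fp p)) \<alpha> = 2 * r" "rot_field p r \<alpha>"
    "\<And>k::nat. \<alpha> [^]\<^bsub>mult_of (Fp p)\<^esub> k = \<alpha> ^ k mod int p"
proof -
  have dvd: "2 * r dvd p - 1"
    by (rule cong_to_1_nat[OF cong])
  have "p - 1 > 0"
    using prime_gt_1_nat[OF p] by simp
  then have "2 * r \<le> p - 1"
    using dvd by (intro dvd_imp_le)
  then have p5: "p \<ge> 5"
    using r by simp
  interpret residues_prime p "residue_ring (int p)"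
    by unfold_locales (auto simp: p)
  have field: "field (Fp p)"
    using is_field by (simp add: Fp_def)
  have car: "carrier (Fp p) = {0..<int p}"
    unfolding Fp_def res_carrier_eq by auto
  have one: "\<one>\<^bsub>Fp p\<^esub> = 1" and zero: "\<zero>\<^bsub>Fp p\<^esub> = 0"
    unfolding Fp_def by (rule res_one_eq res_zero_eq)+
  interpret G: group "mult_of (Fp p)"
    by (rule field.field_mult_group[OF field])
  have fin: "finite (carrier (Fp p))"
    by (simp add: car)
  have carG: "carrier (mult_of (Fp p)) = {1..<int p}"
    by (auto simp: carrier_mult_of car zero)
  have finG: "finite (carrier (mult_of (Fp p)))"
    unfolding carG by simp
  obtain g where g: "g \<in> carrier (mult_of (Fp p))"
    "carrier (mult_of (Fp p)) = {g [^]\<^bsub>Fp p\<^esub> i | i::nat. i \<in> UNIV}"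
    using field.finite_field_mult_group_has_gen[OF field fin] by blast
  have pow_eq: "x [^]\<^bsub>mult_of (Fp p)\<^esub> (k::nat) = x [^]\<^bsub>Fp p\<^esub> k" for x k
    by (simp add: nat_pow_mult_of)
  have ordg: "G.ord g = p - 1"
  proof -
    have "carrier (mult_of (Fp p)) = {g [^]\<^bsub>mult_of (Fp p)\<^esub> i | i::nat. i \<in> UNIV}"
      using g(2) by (simp add: pow_eq)
    also have "\<dots> = (\<lambda>i. g [^]\<^bsub>mult_of (Fp p)\<^esub> i) ` {0..G.ord g - 1}"
      unfolding G.ord_elems[OF finG g(1)] by blast
    finally have "card (carrier (mult_of (Fp p))) = card {0..G.ord g - 1}"
      using card_image[OF G.ord_inj[OF g(1)]] by simp
    moreover have "G.ord g > 0"
      using G.ord_ge_1[OF finG g(1)] by simp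
    ultimately show ?thesis
      unfolding carG by simp
  qed
  define m where "m = (p - 1) div (2 * r)"
  have m: "p - 1 = m * (2 * r)" "m > 0"
    using dvd \<open>2 * r \<le> p - 1\<close> r by (auto simp: m_def div_greater_zero_iff)
  define \<alpha> where "\<alpha> = g [^]\<^bsub>mult_of (Fp p)\<^esub> m"
  have \<alpha>G: "\<alpha> \<in> carrier (mult_of (Fp p))"
    using g(1) by (simp add: \<alpha>_def del: mult_of_simps)
  have ord\<alpha>: "G.ord \<alpha> = 2 * r"
    unfolding \<alpha>_def G.ord_pow_gen[OF g(1)] ordg using m by (simp add: m(1))
  have \<alpha>r: "\<alpha> \<in> {1..<int p}"
    using \<alpha>G unfolding carG .
  have pow: "\<alpha> [^]\<^bsub>mult_of (Fp p)\<^esub> k = \<alpha> ^ k mod int p" for k :: nat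
    using pow_cong[of \<alpha> k] \<alpha>r unfolding pow_eq by (simp add: Fp_def)
  have pow_1: "[\<alpha> ^ k = 1] (mod int p) \<longleftrightarrow> 2 * r dvd k" for k :: nat
  proof -
    have "[\<alpha> ^ k = 1] (mod int p) \<longleftrightarrow> \<alpha> [^]\<^bsub>mult_of (Fp p)\<^esub> k = \<one>\<^bsub>mult_of (Fp p)\<^esub>"
      using p5 by (simp add: pow cong_mod_def one)
    also have "\<dots> \<longleftrightarrow> 2 * r dvd k"
      using G.pow_eq_id[OF \<alpha>G] ord\<alpha> by simp
    finally show ?thesis .
  qed
  have prime: "prime (int p)"
    using p by simp
  have "\<not> int p dvd \<alpha>"
    using \<alpha>r by (auto dest: zdvd_imp_le)
  then have cop: "coprime (\<alpha> ^ i) (int p)" for i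
    using prime_imp_coprime[OF prime] by (simp add: coprime_commute)
  have iff_le: "[\<alpha> ^ i = \<alpha> ^ j] (mod int p) \<longleftrightarrow> [i = j] (mod 2 * r)" if "i \<le> j" for i j
  proof -
    have "[\<alpha> ^ i = \<alpha> ^ j] (mod int p) \<longleftrightarrow> [\<alpha> ^ i * 1 = \<alpha> ^ i * \<alpha> ^ (j - i)] (mod int p)"
      using that by (simp flip: power_add)
    also have "\<dots> \<longleftrightarrow> [1 = \<alpha> ^ (j - i)] (mod int p)"
      by (rule cong_mult_lcancel[OF cop])
    also have "\<dots> \<longleftrightarrow> 2 * r dvd j - i"
      using pow_1[of "j - i"] by (simp add: cong_sym_eq)
    also have "\<dots> \<longleftrightarrow> [i = j] (mod 2 * r)"
      using that by (metis cong_altdef_nat cong_sym_eq)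
    finally show ?thesis .
  qed
  have "rot_field p r \<alpha>"
  proof
    show "[\<alpha> ^ i = \<alpha> ^ j] (mod int p) \<longleftrightarrow> [i = j] (mod 2 * r)" for i j
      using iff_le[of i j] iff_le[of j i] by (cases "i \<le> j") (auto simp: cong_sym_eq)
    have "int p dvd \<alpha> ^ (2 * r) - 1"
      using pow_1[of "2 * r"] by (simp add: cong_iff_dvd_diff)
    also have "\<alpha> ^ (2 * r) - 1 = (\<alpha> ^ r - 1) * (\<alpha> ^ r + 1)"
      by (simp add: power_mult power2_eq_square algebra_simps mult_2 power_add)
    finally have "int p dvd \<alpha> ^ r - 1 \<or> int p dvd \<alpha> ^ r + 1"
      using prime_dvd_mult_iff[OF prime] by blast
    moreover have "\<not> int p dvd \<alpha> ^ r - 1"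
      using pow_1[of r] r by (auto simp: cong_iff_dvd_diff dest: dvd_imp_le)
    ultimately show "[\<alpha> ^ r = - 1] (mod int p)"
      by (simp add: cong_iff_dvd_diff)
  qed (use p r p5 \<alpha>r in auto)
  then show thesis
    by (rule that[OF \<alpha>G ord\<alpha> _ pow])
qed

context rot_field
begin

definition dset :: "(nat \<Rightarrow> int) set \<Rightarrow> (nat \<Rightarrow> int) set" where
  "dset A = (\<lambda>(y, b). vd y b) ` (A \<times> A)"

lemma dset_large:
  assumes A: "A \<subseteq> V"
    and free: "\<And>x. x \<in> NZ \<Longrightarrow> x \<in> dset A \<Longrightarrow> sm 2 x \<in> dset A \<Longrightarrow> sm 4 x \<in> dset A \<Longrightarrow> sm 8 x \<in> dset A \<Longrightarrow> False"
  shows "card A ^ 7 \<le> card (dset A) ^ 6"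
proof -
  let ?G = "add_monoid (Fpn p n)"
  have G: "comm_group ?G"
    by (rule FM.M.a_comm_group)
  have mult: "x \<otimes>\<^bsub>?G\<^esub> x = sm 2 x" for x
    using Fpn_double[of x] by simp
  have diffs: "comm_group.diffs ?G A = dset A"
  proof -
    have "a \<otimes>\<^bsub>?G\<^esub> inv\<^bsub>?G\<^esub> b = vd a b" if "a \<in> A" "b \<in> A" for a b
      using Fpn_minus[of a b] that A by (auto simp: a_minus_def a_inv_def)
    then show ?thesis
      unfolding comm_group.diffs_def[OF G] dset_def by force
  qed
  show ?thesis
    unfolding diffs[symmetric]
  proof (rule comm_group.diffs_large[OF G])
    show "finite A"
      by (rule finite_subset[OF A finite_V])
    show "A \<subseteq> carrier ?G"
      using A by (simp add: Fpn_carrier)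
    fix u
    assume u: "u \<in> carrier ?G" "u \<noteq> \<one>\<^bsub>?G\<^esub>"
      and d: "u \<in> comm_group.diffs ?G A" "u \<otimes>\<^bsub>?G\<^esub> u \<in> comm_group.diffs ?G A"
        "(u \<otimes>\<^bsub>?G\<^esub> u) \<otimes>\<^bsub>?G\<^esub> (u \<otimes>\<^bsub>?G\<^esub> u) \<in> comm_group.diffs ?G A"
        "((u \<otimes>\<^bsub>?G\<^esub> u) \<otimes>\<^bsub>?G\<^esub> (u \<otimes>\<^bsub>?G\<^esub> u)) \<otimes>\<^bsub>?G\<^esub> ((u \<otimes>\<^bsub>?G\<^esub> u) \<otimes>\<^bsub>?G\<^esub> (u \<otimes>\<^bsub>?G\<^esub> u)) \<in> comm_group.diffs ?G A"
    have "u \<in> NZ"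
      using u by (simp add: NZ_def Fpn_carrier Fpn_zero)
    then show False
      using free[of u] d unfolding diffs mult sm_sm by simp
  qed
qed

lemma maxsep_large:
  assumes A: "A \<subseteq> V"
    and free: "\<And>x. x \<in> NZ \<Longrightarrow> x \<in> dset A \<Longrightarrow> sm 2 x \<in> dset A \<Longrightarrow> sm 4 x \<in> dset A \<Longrightarrow> sm 8 x \<in> dset A \<Longrightarrow> False"
  shows "(real (card A) powr (7 / 6) - 1) / (7 * r) \<le> RM.maxsep A"
proof -
  have "real (card A) ^ 7 \<le> real (card (dset A)) ^ 6"
    using of_nat_mono[OF dset_large[OF A free], where 'a = real] by simp
  then have "(real (card A) ^ 7) powr (1 / 6) \<le> (real (card (dset A)) ^ 6) powr (1 / 6)"
    by (intro powr_mono2) auto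
  moreover have "(real (card A) ^ 7) powr (1 / 6) = real (card A) powr (7 / 6)"
    by (cases "card A = 0") (auto simp: powr_powr simp flip: powr_numeral)
  moreover have "(real (card (dset A)) ^ 6) powr (1 / 6) = card (dset A)"
    by (cases "card (dset A) = 0") (auto simp: powr_powr simp flip: powr_numeral)
  ultimately have "real (card A) powr (7 / 6) \<le> card (dset A)"
    by simp
  also have "card (dset A) \<le> 1 + card LamS * RM.maxsep A"
    unfolding dset_def by (rule RM.diff_classes_le[OF A LamS_one vd_V vd_NN])
  also have "\<dots> \<le> 1 + 7 * r * RM.maxsep A"
    using card_LamS by simp
  finally have "real (card A) powr (7 / 6) - 1 \<le> 7 * r * real (RM.maxsep A)"
    by simp
  then show ?thesis
    using r_ge by (simp add: field_simps)
qed

end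

context rot_maximal
begin

text \<open>The first moment argument as a count: if every \<omega> had a monochromatic k-set, the
  sets of bad \<omega> would cover \<Omega>, although their sizes add up to less than |\<Omega>|.
  The 12 in the assumption is s + 5 with s = 7.\<close>

lemma good_colouring_exists:
  fixes \<epsilon> \<eta> :: real and k :: nat
  assumes \<epsilon>: "\<epsilon> > 0" and \<eta>: "\<eta> > 0" "\<eta> < 1" "(1 - \<eta>)\<^sup>2 = 2 / (2 + \<epsilon>)" and k: "k \<ge> 2"
    and N: "real (p ^ n) \<le> real r powr (k / (2 + \<epsilon>))"
    and small: "real r * (real (k + 1) * real ((8 * (31 * r) ^ 7 * (k + 1)) ^ (7 ^ Suc (nat \<lfloor>2 / \<eta>\<rfloor> * 12))) ^ k *
     real r powr (2 / \<eta> * (1 + 7 * (4 * (7 * r) / \<eta> * (real k + 1) powr (1 / 7) + 1)) * (k / (2 + \<epsilon>))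
        - \<eta> * ((real k powr (7 / 6) - 1) / (7 * r)))) < 1"
  shows "\<exists>\<omega>\<in>\<Omega>. \<forall>A\<subseteq>V. card A = k \<longrightarrow> (\<forall>c. \<not> mono \<omega> A c)"
proof (rule ccontr)
  assume bad: "\<not> ?thesis"
  \<comment> \<open>Only sets that some colouring makes monochromatic are counted: these contain no
    doubling chain among their differences, which gives \<open>sep\<close>.\<close>
  define \<K> where "\<K> = {A. A \<subseteq> V \<and> card A = k \<and> (\<exists>\<omega>\<in>\<Omega>. \<exists>c. mono \<omega> A c)}"
  have finK: "finite \<K>"
    using finite_V by (auto simp: \<K>_def intro: rev_finite_subset[of "Pow V"])
  \<comment> \<open>Chosen so that seven rounds suffice: (q \<eta> / (4 |\<Lambda>|)) ^ 7 \<ge> k +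
    1.\<close>
  define q where "q = nat \<lceil>4 * (7 * r) / \<eta> * (real k + 1) powr (1 / 7)\<rceil>"
  have q_ge: "4 * (7 * r) / \<eta> * (real k + 1) powr (1 / 7) \<le> q"
    unfolding q_def by (rule of_nat_ceiling)
  have q_le: "q \<le> 4 * (7 * r) / \<eta> * (real k + 1) powr (1 / 7) + 1"
  proof -
    have "0 \<le> 4 * (7 * r) / \<eta> * (real k + 1) powr (1 / 7)"
      using \<eta> by simp
    then show ?thesis
      unfolding q_def by linarith
  qed
  have r1: "real r > 1"
    using r_ge by simp
  have big: "(q * \<eta> / (4 * card LamS)) ^ 7 > k"
  proof -
    have pos: "real (card LamS) > 0"
      using RM.card_Lam_pos by simp
    have "(real k + 1) powr (1 / 7) * (4 * card LamS) \<le> (real k + 1) powr (1 / 7) * (4 * (7 * r))"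
      using card_LamS by (intro mult_left_mono) (auto simp flip: of_nat_mult)
    also have "\<dots> \<le> q * \<eta>"
      using q_ge \<eta> by (simp add: field_simps)
    finally have "(real k + 1) powr (1 / 7) \<le> q * \<eta> / (4 * card LamS)"
      using pos by (simp add: field_simps)
    then have "((real k + 1) powr (1 / 7)) ^ 7 \<le> (q * \<eta> / (4 * card LamS)) ^ 7"
      by (rule power_mono) simp
    moreover have "((real k + 1) powr (1 / 7)) ^ 7 = real k + 1"
      by (simp add: powr_powr flip: powr_numeral)
    ultimately show ?thesis
      by simp
  qed
  have mono_range: "c \<in> {0..<int r}" if "mono \<omega> A c" "card A = k" for \<omega> A c
  proof -
    obtain B where "B \<subseteq> A" "card B = 2"
      using obtain_subset_with_card_n[of 2 A] k \<open>card A = k\<close> by metis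
    then obtain x y where "x \<in> A" "y \<in> A" "x \<noteq> y"
      by (auto simp: card_2_iff)
    then show ?thesis
      using that col_range[of \<omega> "vd x y"] by (auto simp: mono_def)
  qed
  have sep: "(real k powr (7 / 6) - 1) / (7 * r) \<le> RM.maxsep A" if A: "A \<in> \<K>" for A
  proof -
    have AV: "A \<subseteq> V" and cA: "card A = k"
      using A by (auto simp: \<K>_def)
    obtain \<omega> c where m: "mono \<omega> A c"
      using A by (auto simp: \<K>_def)
    have colour: "col \<omega> x = c" if x: "x \<in> NZ" "x \<in> dset A" for x
    proof -
      obtain y b where yb: "y \<in> A" "b \<in> A" "x = vd y b"
        using x(2) by (auto simp: dset_def)
      have "y \<noteq> b"
      proof
        assume "y = b"
        then have "x = zv"
          by (auto simp: yb(3) vd_def zv_def)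
        then show False
          using x(1) by (simp add: NZ_def)
      qed
      then show ?thesis
        using m yb by (auto simp: mono_def)
    qed
    have nd: "\<not> int p dvd 4" "\<not> int p dvd 8"
      using two_ndvd prime_dvd_mult_iff[OF prime_int_p, of 2 2] prime_dvd_mult_iff[OF prime_int_p, of 2 4] by auto
    have "(real (card A) powr (7 / 6) - 1) / (7 * r) \<le> RM.maxsep A"
    proof (rule maxsep_large[OF AV])
      fix x assume x: "x \<in> NZ" "x \<in> dset A" "sm 2 x \<in> dset A" "sm 4 x \<in> dset A" "sm 8 x \<in> dset A"
      show False
        by (rule no_doubling_chain[OF x(1), of \<omega> c])
          (intro colour sm_NZ x two_ndvd nd)+
    qed
    then show ?thesis
      by (simp add: cA)
  qed
  have "(\<Sum>A\<in>\<K>. real r powr (- real (RM.maxsep A))) \<le>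
    real ((k + 1) * ((8 * card LS ^ 7 * (k + 1)) ^ (7 ^ Suc (nat \<lfloor>2 / \<eta>\<rfloor> * 12))) ^ k) *
    real r powr (2 / \<eta> * real (1 + 7 * q) * (k / (2 + \<epsilon>)) - \<eta> * ((real k powr (7 / 6) - 1) / (7 * r)))"
  proof (rule RM.sum_maxsep_bound[OF r1 \<epsilon> \<eta> _ big])
    show "\<K> \<subseteq> {A. A \<subseteq> V \<and> card A = k}"
      by (auto simp: \<K>_def)
    show "(real k powr (7 / 6) - 1) / (7 * r) \<le> RM.maxsep A" if "A \<in> \<K>" for A
      by (rule sep[OF that])
  qed (use k N card_V in simp_all)
  also have "\<dots> \<le> real ((k + 1) * ((8 * (31 * r) ^ 7 * (k + 1)) ^ (7 ^ Suc (nat \<lfloor>2 / \<eta>\<rfloor> * 12))) ^ k) *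
    real r powr (2 / \<eta> * (1 + 7 * (4 * (7 * r) / \<eta> * (real k + 1) powr (1 / 7) + 1)) * (k / (2 + \<epsilon>))
        - \<eta> * ((real k powr (7 / 6) - 1) / (7 * r)))"
  proof (rule mult_mono)
    show "real ((k + 1) * ((8 * card LS ^ 7 * (k + 1)) ^ (7 ^ Suc (nat \<lfloor>2 / \<eta>\<rfloor> * 12))) ^ k) \<le>
        real ((k + 1) * ((8 * (31 * r) ^ 7 * (k + 1)) ^ (7 ^ Suc (nat \<lfloor>2 / \<eta>\<rfloor> * 12))) ^ k)"
      by (intro of_nat_mono mult_le_mono power_mono le_refl card_LS) auto
    have "2 / \<eta> * real (1 + 7 * q) * (k / (2 + \<epsilon>)) \<le>
        2 / \<eta> * (1 + 7 * (4 * (7 * r) / \<eta> * (real k + 1) powr (1 / 7) + 1)) * (k / (2 + \<epsilon>))"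
      using q_le \<eta> \<epsilon> by (intro mult_right_mono mult_left_mono) auto
    then show "real r powr (2 / \<eta> * real (1 + 7 * q) * (k / (2 + \<epsilon>)) - \<eta> * ((real k powr (7 / 6) - 1) / (7 * r))) \<le>
        real r powr (2 / \<eta> * (1 + 7 * (4 * (7 * r) / \<eta> * (real k + 1) powr (1 / 7) + 1)) * (k / (2 + \<epsilon>))
          - \<eta> * ((real k powr (7 / 6) - 1) / (7 * r)))"
      using r1 by (intro powr_mono diff_right_mono) auto
  qed auto
  finally have sum: "real r * (\<Sum>A\<in>\<K>. real r powr (- real (RM.maxsep A))) < 1"
    using small r1 by (smt (verit) mult_left_mono of_nat_mult of_nat_power)
  have "\<Omega> \<subseteq> (\<Union>A\<in>\<K>. \<Union>c\<in>{0..<int r}. {\<omega> \<in> \<Omega>. mono \<omega> A c})"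
  proof
    fix \<omega> assume w: "\<omega> \<in> \<Omega>"
    then obtain A c where A: "A \<subseteq> V" "card A = k" "mono \<omega> A c"
      using bad by blast
    then have "A \<in> \<K>" "c \<in> {0..<int r}"
      using w mono_range[of \<omega> A c] unfolding \<K>_def by blast+
    then show "\<omega> \<in> (\<Union>A\<in>\<K>. \<Union>c\<in>{0..<int r}. {\<omega> \<in> \<Omega>. mono \<omega> A c})"
      using w A(3) by blast
  qed
  then have "card \<Omega> \<le> card (\<Union>A\<in>\<K>. \<Union>c\<in>{0..<int r}. {\<omega> \<in> \<Omega>. mono \<omega> A c})"
    using finK finite_\<Omega> by (intro card_mono) auto
  also have "\<dots> \<le> (\<Sum>A\<in>\<K>. card (\<Union>c\<in>{0..<int r}. {\<omega> \<in> \<Omega>. mono \<omega> A c}))"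
    by (rule card_UN_le[OF finK])
  also have "\<dots> \<le> (\<Sum>A\<in>\<K>. \<Sum>c\<in>{0..<int r}. card {\<omega> \<in> \<Omega>. mono \<omega> A c})"
    by (intro sum_mono card_UN_le) simp
  finally have "real (card \<Omega>) \<le> (\<Sum>A\<in>\<K>. \<Sum>c\<in>{0..<int r}. real (card {\<omega> \<in> \<Omega>. mono \<omega> A c}))"
    by (simp flip: of_nat_sum)
  also have "\<dots> \<le> (\<Sum>A\<in>\<K>. \<Sum>c\<in>{0..<int r}. card \<Omega> * real r powr (- real (RM.maxsep A)))"
    by (intro sum_mono mono_count) (auto simp: \<K>_def)
  also have "\<dots> = card \<Omega> * (real r * (\<Sum>A\<in>\<K>. real r powr (- real (RM.maxsep A))))"
    by (simp add: sum_distrib_left mult.left_commute)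
  finally have "real (card \<Omega>) * 1 \<le> card \<Omega> * (real r * (\<Sum>A\<in>\<K>. real r powr (- real (RM.maxsep A))))"
    by simp
  moreover have "real (card \<Omega>) > 0"
    using r_ge by (simp add: card_\<Omega>)
  ultimately show False
    using sum by (simp add: mult_le_cancel_left_pos)
qed

lemma col_cayley: "cayley_coloring r p n (col \<omega>)"
proof -
  have "col \<omega> x \<in> carrier (residue_ring (int r))" for x
    using col_range[of \<omega> x] by (simp add: residue_ring_def)
  moreover have "col \<omega> x = col \<omega> (\<ominus>\<^bsub>Fpn p n\<^esub> x)" if "x \<in> NZ" for x
    using col_neg[OF that] Fpn_uminus[OF NZ_V[OF that]] by simp
  ultimately show ?thesis
    by (auto simp: cayley_coloring_def Fpn_nonzero)
qed

lemma col_rotational: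
  assumes \<alpha>G: "\<alpha> \<in> carrier (mult_of (Fp p))" and ord: "group.ord (mult_of (Fp p)) \<alpha> = 2 * r"
    and pow: "\<And>k::nat. \<alpha> [^]\<^bsub>mult_of (Fp p)\<^esub> k = \<alpha> ^ k mod int p"
  shows "rotational r p n (col \<omega>)"
  unfolding rotational_def Fpn_nonzero
proof (intro bexI[OF _ \<alpha>G] conjI ord ballI allI)
  fix x and i :: int
  assume x: "x \<in> NZ"
  have "field (Fp p)"
    using is_field by (simp add: Fp_def)
  then interpret G: group "mult_of (Fp p)"
    by (rule field.field_mult_group)
  \<comment> \<open>A natural number congruent to i modulo 2 r.\<close>
  define j where "j = nat (i + int (2 * r) * \<bar>i\<bar>)"
  have "1 * \<bar>i\<bar> \<le> int (2 * r) * \<bar>i\<bar>"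
    using r_ge by (intro mult_right_mono) auto
  then have j: "int j = i + int (2 * r) * \<bar>i\<bar>"
    unfolding j_def by auto
  have "\<alpha> [^]\<^bsub>mult_of (Fp p)\<^esub> (int (2 * r) * \<bar>i\<bar>) = \<one>\<^bsub>mult_of (Fp p)\<^esub>"
    using G.int_pow_eq_id[OF \<alpha>G] ord by simp
  then have "\<alpha> [^]\<^bsub>mult_of (Fp p)\<^esub> i = \<alpha> [^]\<^bsub>mult_of (Fp p)\<^esub> (int j)"
    unfolding j using \<alpha>G by (simp only: G.int_pow_mult G.r_one G.int_pow_closed)
  also have "\<dots> = \<alpha> ^ j mod int p"
    unfolding int_pow_int by (rule pow)
  finally have pow_i: "\<alpha> [^]\<^bsub>mult_of (Fp p)\<^esub> i = \<alpha> ^ j mod int p" .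
  have "[\<alpha> ^ j mod int p = \<alpha> ^ j] (mod int p)"
    unfolding cong_mod_def by (rule mod_mod_trivial)
  from sm_cong[OF this, of x] have "[col \<omega> (\<alpha> [^]\<^bsub>mult_of (Fp p)\<^esub> i \<odot>\<^bsub>Fpn p n\<^esub> x) = col \<omega> x + int j] (mod int r)"
    unfolding Fpn_smult pow_i using col_pow[OF x, of \<omega> j] by simp
  also have "[col \<omega> x + int j = col \<omega> x + i] (mod int r)"
    by (simp add: j cong_iff_dvd_diff)
  finally show "[col \<omega> (\<alpha> [^]\<^bsub>mult_of (Fp p)\<^esub> i \<odot>\<^bsub>Fpn p n\<^esub> x) = col \<omega> x + i] (mod int r)" .
qed

lemma clique_mono:
  assumes "monochromatic_clique p n (col \<omega>) S"
  shows "S \<subseteq> V" "\<exists>c. mono \<omega> S c"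
proof -
  show S: "S \<subseteq> V"
    using assms by (simp add: monochromatic_clique_def Fpn_carrier)
  obtain c where "\<forall>x\<in>S. \<forall>y\<in>S. x \<noteq> y \<longrightarrow> edge_color p n (col \<omega>) x y = c"
    using assms by (auto simp: monochromatic_clique_def)
  moreover have "edge_color p n (col \<omega>) x y = col \<omega> (vd x y)" if "x \<in> S" "y \<in> S" for x y
    unfolding edge_color_def using Fpn_minus[of x y] that S by (simp add: subset_iff)
  ultimately show "\<exists>c. mono \<omega> S c"
    unfolding mono_def by auto
qed

end

theorem theorem4p5:
  fixes r :: nat
  assumes "r \<ge> 2"
  shows "\<forall>\<epsilon>::real. \<epsilon> > 0 \<longrightarrow>
    (\<exists>N0::nat. \<forall>(p::nat) (n::nat).
       prime p \<and> [p = 1] (mod (2 * r)) \<and> p ^ n \<ge> N0 \<longrightarrow>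
       (\<exists>c. cayley_coloring r p n c \<and> rotational r p n c \<and>
            (\<forall>S. monochromatic_clique p n c S \<longrightarrow>
                 real (card S) \<le> (2 + \<epsilon>) * log (real r) (real (p ^ n)))))"
proof (intro allI impI)
  fix \<epsilon> :: real
  assume \<epsilon>: "\<epsilon> > 0"
  \<comment> \<open>The solution of the equation for \<eta> in
    \<open>sum_maxsep_bound\<close>.\<close>
  define \<eta> where "\<eta> = 1 - sqrt (2 / (2 + \<epsilon>))"
  have \<eta>: "\<eta> > 0" "\<eta> < 1" "(1 - \<eta>)\<^sup>2 = 2 / (2 + \<epsilon>)"
    using \<epsilon> by (auto simp: \<eta>_def)
  have "eventually (\<lambda>k::nat. real r * (real (k + 1) * real ((8 * (31 * r) ^ 7 * (k + 1)) ^ (7 ^ Suc (nat \<lfloor>2 / \<eta>\<rfloor> * 12))) ^ k *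
     real r powr (2 / \<eta> * (1 + 7 * (4 * real (7 * r) / \<eta> * (real k + 1) powr (1 / 7) + 1)) * (k / (2 + \<epsilon>))
        - \<eta> * ((real k powr (7 / 6) - 1) / real (7 * r)))) < 1) at_top"
    by (rule union_bound_small) (use assms \<epsilon> \<eta> in auto)
  then obtain k1 where k1: "\<And>k::nat. k \<ge> k1 \<Longrightarrow> real r * (real (k + 1) * real ((8 * (31 * r) ^ 7 * (k + 1)) ^ (7 ^ Suc (nat \<lfloor>2 / \<eta>\<rfloor> * 12))) ^ k *
     real r powr (2 / \<eta> * (1 + 7 * (4 * real (7 * r) / \<eta> * (real k + 1) powr (1 / 7) + 1)) * (k / (2 + \<epsilon>))
        - \<eta> * ((real k powr (7 / 6) - 1) / real (7 * r)))) < 1"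
    unfolding eventually_at_top_linorder by blast
  define k0 where "k0 = max k1 2"
  show "\<exists>N0::nat. \<forall>(p::nat) (n::nat). prime p \<and> [p = 1] (mod (2 * r)) \<and> p ^ n \<ge> N0 \<longrightarrow>
       (\<exists>c. cayley_coloring r p n c \<and> rotational r p n c \<and>
            (\<forall>S. monochromatic_clique p n c S \<longrightarrow>
                 real (card S) \<le> (2 + \<epsilon>) * log (real r) (real (p ^ n))))"
  proof (intro exI[of _ "r ^ k0"] allI impI, elim conjE)
    fix p n :: nat
    assume p: "prime p" and cong: "[p = 1] (mod 2 * r)" and N: "p ^ n \<ge> r ^ k0"
    define l where "l = log (real r) (real (p ^ n))"
    have r1: "real r > 1"
      using assms by simp
    have Npos: "real (p ^ n) > 0"
      using prime_gt_0_nat[OF p] by simp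
    have "real k0 = log (real r) (real (r ^ k0))"
      using r1 by (simp add: log_nat_power)
    also have "\<dots> \<le> l"
      unfolding l_def using N r1 Npos by (subst log_le_cancel_iff) (auto simp flip: of_nat_power)
    finally have l: "real k0 \<le> l" .
    \<comment> \<open>The least integer above the claimed bound: a larger clique contains a clique
      with exactly k elements, and N is at most r powr (k / (2 + \<epsilon>)).\<close>
    define k where "k = nat \<lfloor>(2 + \<epsilon>) * l\<rfloor> + 1"
    have ge: "1 * l \<le> (2 + \<epsilon>) * l"
      using l \<epsilon> by (intro mult_right_mono) auto
    then have k_ge: "k \<ge> k0" and k_gt: "(2 + \<epsilon>) * l < k"
      using l unfolding k_def by linarith+
    have "l \<le> k / (2 + \<epsilon>)"
      using k_gt \<epsilon> by (simp add: field_simps)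
    then have N': "real (p ^ n) \<le> real r powr (k / (2 + \<epsilon>))"
      using r1 Npos unfolding l_def by (simp add: log_le_iff)
    obtain \<alpha> where gen: "\<alpha> \<in> carrier (mult_of (Fp p))" "group.ord (mult_of (Fp p)) \<alpha> = 2 * r" "rot_field p r \<alpha>"
      "\<And>k::nat. \<alpha> [^]\<^bsub>mult_of (Fp p)\<^esub> k = \<alpha> ^ k mod int p"
      using rot_field_exists[OF p assms cong] by blast
    interpret rot_field p n r \<alpha>
      by (rule gen(3))
    obtain T where T: "rot_tails p n r \<alpha> T"
      "(\<exists>j. [\<alpha> ^ j = 2] (mod int p)) \<or> (\<forall>x\<in>NZ. x \<in> T \<or> sm 2 x \<in> T \<or> half x \<in> T)"
      using tails_exist by blast
    interpret rot_maximal p n r \<alpha> T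
      by (intro rot_maximal.intro rot_maximal_axioms.intro T)
    obtain \<omega> where \<omega>: "\<forall>A\<subseteq>V. card A = k \<longrightarrow> (\<forall>c. \<not> mono \<omega> A c)"
      using good_colouring_exists[OF \<epsilon> \<eta> _ N'] k1[of k] k_ge by (auto simp: k0_def)
    have "real (card S) \<le> (2 + \<epsilon>) * l" if S: "monochromatic_clique p n (col \<omega>) S" for S
    proof (rule ccontr)
      assume "\<not> ?thesis"
      then have "k \<le> card S"
        using l ge unfolding k_def by linarith
      then obtain A where A: "A \<subseteq> S" "card A = k"
        using obtain_subset_with_card_n by blast
      obtain c where "mono \<omega> S c"
        using clique_mono(2)[OF S] by blast
      then have "mono \<omega> A c"
        using A(1) by (auto simp: mono_def)
      then show False
        using \<omega> A clique_mono(1)[OF S] by blast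
    qed
    then show "\<exists>c. cayley_coloring r p n c \<and> rotational r p n c \<and>
            (\<forall>S. monochromatic_clique p n c S \<longrightarrow>
                 real (card S) \<le> (2 + \<epsilon>) * log (real r) (real (p ^ n)))"
      using col_cayley[of \<omega>] col_rotational[OF gen(1,2,4), of \<omega>] unfolding l_def by blast
  qed
qed

end
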